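(* Let $g\ge1$ and $k,n\geq 3$. (i) There exist injective homomorphisms $\gamma_k: G_k\to G_k(\widehat\Sigma_g)$, $\alpha_{k,n}:B_{k,n}/\Gamma_2(B_{k,n})\to B_{k,n}(\widehat\Sigma_g)/\Gamma_3(B_{k,n}(\widehat\Sigma_g))$ and $\alpha_n:B_n/\Gamma_2(B_n)\to B_n(\widehat\Sigma_g)/\Gamma_3(B_n(\widehat\Sigma_g))$ such that $\gamma_k\circ p_k=\Phi_k\circ\iota_k$, $\alpha_{k,n}\circ r_{k,n}=\rho_{k,n}\circ\iota_{k,n}$, $\alpha_n\circ r_n=\rho_n\circ\iota_n$, and such that $(\gamma_k,\alpha_{k,n},\alpha_n)$ is a morphism from the short exact sequence $1\to G_k\to B_{k,n}/\Gamma_2(B_{k,n})\to B_n/\Gamma_2(B_n)\to1$ to the short exact sequence $1\to G_k(\widehat\Sigma_g)\to B_{k,n}(\widehat\Sigma_g)/\Gamma_3(B_{k,n}(\widehat\Sigma_g))\to B_n(\widehat\Sigma_g)/\Gamma_3(B_n(\widehat\Sigma_g))\to 1$. (ii) Let $G$ be a group, and let $\Phi_G:B_k(\widehat\Sigma_{g,n})\to G$ be a surjective homomorphism whose restriction to $B_k(\mathbb D_n)$ induces an injective homomorphism from $G_k$ to $G$ (i.e. $\Phi_G\circ\iota_k=j\circ p_k$ for some injective homomorphism $j:G_k\to G$). Then there is an isomorphism $\theta_G:G_k(\widehat\Sigma_g)\to G$ such that $\Phi_G=\theta_G\circ\Phi_k$. (iii) Let $H$ be a group, and let $\rho_H:B_{k,n}(\widehat\Sigma_g)\to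 H$ be a surjective homomorphism whose restriction to $B_{k,n}$ induces an injective homomorphism from $B_{k,n}/\Gamma_2(B_{k,n})$ to $H$ (i.e. $\rho_H\circ\iota_{k,n}=j\circ r_{k,n}$ with $j$ injective). Then there is an isomorphism $\theta_H:B_{k,n}(\widehat\Sigma_g)/\Gamma_3(B_{k,n}(\widehat\Sigma_g))\to H$ such that $\rho_H=\theta_H\circ\rho_{k,n}$. (iv) Let $K$ be a group, and let $\rho_K:B_n(\widehat\Sigma_g)\to K$ be a surjective homomorphism whose restriction to $B_n$ induces an injective homomorphism from $B_n/\Gamma_2(B_n)$ to $K$ (i.e. $\rho_K\circ\iota_n=j\circ r_n$ with $j$ injective). Then there is an isomorphism $\theta_K:B_n(\widehat\Sigma_g)/\Gamma_3(B_n(\widehat\Sigma_g))\to K$ such that $\rho_K=\theta_K\circ\rho_n$.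
   Context: For a connected surface $\Sigma$, $\mathbb F_m(\Sigma)=\{(x_1,\dots,x_m)\in\Sigma^m: x_i\neq x_j\ (i\ne j)\}$, $B_n(\Sigma)=\pi_1(\mathbb F_n(\Sigma)/S_n)$ (braid group), $B_{k,n}(\Sigma)=\pi_1(\mathbb F_{k+n}(\Sigma)/(S_k\times S_n))$ (mixed braid group). $B_n=B_n(\mathbb D^2)$, $B_{k,n}=B_{k,n}(\mathbb D^2)$; $\mathbb D_n$ is the disc minus $n$ interior points. $\widehat\Sigma_g$ is a compact connected orientable surface of genus $g$ with one boundary component, and $\widehat\Sigma_{g,n}$ is $\widehat\Sigma_g$ minus $n$ interior points. $\Gamma_1(G)=G$, $\Gamma_i(G)=[G,\Gamma_{i-1}(G)]$; $[x,y]=xyx^{-1}y^{-1}$, $x^y=y^{-1}xy$. Maps. Forgetting the first $k$ strings gives short exact sequences $1\to B_k(\mathbb D_n)\to B_{k,n}\to B_n\to1$ and $1\to B_k(\widehat\Sigma_{g,n})\to B_{k,n}(\widehat\Sigma_g)\to B_n(\widehat\Sigma_g)\to 1$. The maps $r_{k,n}:B_{k,n}\to B_{k,n}/\Gamma_2(B_{k,n})$, $r_n:B_n\to B_n/\Gamma_2(B_n)$, $\rho_{k,n}:B_{k,n}(\widehat\Sigma_g)\to B_{k,n}(\widehat\Sigma_g)/\Gamma_3(B_{k,n}(\widehat\Sigma_g))$, $\rho_n:B_n(\widehat\Sigma_g)\to B_n(\widehat\Sigma_g)/\Gamma_3(B_n(\widehat\Sigma_g))$ are the canonical projections. $G_k$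 is the kernel of the induced map $B_{k,n}/\Gamma_2(B_{k,n})\to B_n/\Gamma_2(B_n)$ and $p_k:B_k(\mathbb D_n)\to G_k$ is the (surjective) restriction of $r_{k,n}$. $G_k(\widehat\Sigma_g)$ is the kernel of the induced map $B_{k,n}(\widehat\Sigma_g)/\Gamma_3(B_{k,n}(\widehat\Sigma_g))\to B_n(\widehat\Sigma_g)/\Gamma_3(B_n(\widehat\Sigma_g))$ and $\Phi_k:B_k(\widehat\Sigma_{g,n})\to G_k(\widehat\Sigma_g)$ is the restriction of $\rho_{k,n}$. The natural inclusions $\iota_{k,n}:B_{k,n}\to B_{k,n}(\widehat\Sigma_g)$, $\iota_k:B_k(\mathbb D_n)\to B_k(\widehat\Sigma_{g,n})$, $\iota_n:B_n\to B_n(\widehat\Sigma_g)$ are induced by embedding a disc in $\widehat\Sigma_g$ (containing the $n$ punctures in the case of $\iota_k$). Presentations. $B_{k,n}(\widehat\Sigma_g)$ has generators $S=\{\sigma_1,\dots,\sigma_{k-1}\}$, $\widetilde S=\{\tilde\sigma_1,\dots,\tilde\sigma_{n-1}\}$, $AB=\{a_1,b_1,\dots,a_g,b_g\}$, $\widetilde{AB}=\{\tilde a_1,\tilde b_1,\dots,\tilde a_g,\tilde b_g\}$, $Z=\{\zeta_1,\dots,\zeta_n\}$. Write $c<d$ for $c\in\{a_i,b_i\}$, $d\in\{a_j,b_j\}$, $i<j$. Relations (for all indices for which they make sense): (a) $\sigma_i\sigma_j=\sigma_j\sigma_i$ for $|i-j|\ge2$; $\sigma_i\sigma_{i+1}\sigma_i=\sigma_{i+1}\sigma_i\sigma_{i+1}$;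 $c\sigma_i=\sigma_ic$ for $i\neq1$, $c\in AB\cup Z$; $c\sigma_1c\sigma_1=\sigma_1c\sigma_1c$ for $c\in AB\cup Z$; $a_i\sigma_1b_i=\sigma_1b_i\sigma_1a_i\sigma_1$; $\sigma_1^{-1}c\sigma_1$ commutes with $d$ for $c,d\in AB$, $c<d$; $\sigma_1^{-1}\zeta_i\sigma_1$ commutes with every $c\in AB$, and with $\zeta_j$ for $i<j$. (b) The relations of (a) among $S\cup AB$ only, with $k$ replaced by $n$ and $\sigma_i,a_i,b_i$ by $\tilde\sigma_i,\tilde a_i,\tilde b_i$. (c) $\tilde\sigma_i,\tilde a_i,\tilde b_i$ commute with every $\sigma_j$; $\tilde\sigma_i$ commutes with $a_j,b_j$; $\tilde\sigma_i\zeta_{i+1}\tilde\sigma_i^{-1}=\zeta_i$; $\tilde\sigma_i\zeta_i\tilde\sigma_i^{-1}=\zeta_i^{-1}\zeta_{i+1}\zeta_i$; $\tilde\sigma_i\zeta_j\tilde\sigma_i^{-1}=\zeta_j$ for $j\ne i,i+1$; for $(\tilde x,x)=(\tilde a_i,a_i)$ or $(\tilde b_i,b_i)$: $\tilde x\zeta_1\tilde x^{-1}=\zeta_1^{x\zeta_1}$, $\tilde x\zeta_j\tilde x^{-1}=\zeta_j^{[x^{-1},\zeta_1^{-1}]}$ for $j\ne1$, $\tilde xx\tilde x^{-1}=\zeta_1^{-1}x\zeta_1$, and for $d\in\{a_j,b_j\}$, $\tilde xd\tilde x^{-1}=d^{[x^{-1},\zeta_1^{-1}]}$ if $i>j$,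 $\tilde xd\tilde x^{-1}=d$ if $j>i$; $\tilde a_ib_i\tilde a_i^{-1}=b_i\zeta_1$; $\tilde b_ia_i\tilde b_i^{-1}=\zeta_1^{-1}a_i[b_i^{-1},\zeta_1^{-1}]$. $B_k(\widehat\Sigma_{g,n})$ is generated by $S\cup AB\cup Z$ with relations (a); $B_n(\widehat\Sigma_g)$ by $\widetilde S\cup\widetilde{AB}$ with relations (b). For $g=0$ (no $AB$, $\widetilde{AB}$) these give presentations of $B_{k,n}$, $B_k(\mathbb D_n)$, $B_n$. The inclusions $\iota_{k,n},\iota_k,\iota_n$ send each generator to the generator of the same name; the map forgetting the first $k$ strings kills $S\cup AB\cup Z$ and fixes $\widetilde S\cup\widetilde{AB}$. *)

theory Defs
  imports "HOL-Algebra.Exact_Sequence"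
begin

section \<open>Groups given by generators and relations\<close>

text \<open>
  A word is a list of signed letters, (x, True) standing for x and (x, False) for its inverse.
  A presentation is a set of generators together with a set of relations; a relation is a pair
  (u, v) of words, read as u = v.
\<close>

type_synonym 'x word = "('x \<times> bool) list"
type_synonym 'x presentation = "'x set \<times> ('x word \<times> 'x word) set"

definition words :: "'x set \<Rightarrow> 'x word set" where
  "words X = lists (X \<times> UNIV)"

definition winv :: "'x word \<Rightarrow> 'x word" where
  "winv w = rev (map (\<lambda>(x, e). (x, \<not> e)) w)"

definition pos :: "'x list \<Rightarrow> 'x word" where
  "pos xs = map (\<lambda>x. (x, True)) xs"

text \<open>Conventions: the conjugate of u by v is \<open>v\<inverse> u v\<close>; the commutator is \<open>u v u\<inverse> v\<inverse>\<close>.\<close>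

definition wconj :: "'x word \<Rightarrow> 'x word \<Rightarrow> 'x word" where
  "wconj u v = winv v @ u @ v"

definition wcomm :: "'x word \<Rightarrow> 'x word \<Rightarrow> 'x word" where
  "wcomm u v = u @ v @ winv u @ winv v"

inductive weq :: "'x presentation \<Rightarrow> 'x word \<Rightarrow> 'x word \<Rightarrow> bool" for P where
  refl: "u \<in> words (fst P) \<Longrightarrow> weq P u u"
| sym: "weq P u v \<Longrightarrow> weq P v u"
| trans: "weq P u v \<Longrightarrow> weq P v w \<Longrightarrow> weq P u w"
| append: "weq P u u' \<Longrightarrow> weq P v v' \<Longrightarrow> weq P (u @ v) (u' @ v')"
| cancel: "x \<in> fst P \<Longrightarrow> weq P [(x, e), (x, \<not> e)] []"
| rel: "(u, v) \<in> snd P \<Longrightarrow> u \<in> words (fst P) \<Longrightarrow> v \<in> words (fst P) \<Longrightarrow> weq P u v"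

definition wclass :: "'x presentation \<Rightarrow> 'x word \<Rightarrow> 'x word set" where
  "wclass P u = {v. weq P u v}"

definition presented_group :: "'x presentation \<Rightarrow> 'x word set monoid" where
  "presented_group P =
     \<lparr>carrier = wclass P ` words (fst P),
      mult = (\<lambda>A B. \<Union>u\<in>A. \<Union>v\<in>B. wclass P (u @ v)),
      one = wclass P []\<rparr>"

definition gen_of :: "'x presentation \<Rightarrow> 'x \<Rightarrow> 'x word set" where
  "gen_of P x = wclass P [(x, True)]"

definition weval :: "('h, 'm) monoid_scheme \<Rightarrow> ('x \<Rightarrow> 'h) \<Rightarrow> 'x word \<Rightarrow> 'h" where
  "weval H f w = foldr (\<lambda>(x, e) h. (if e then f x else inv\<^bsub>H\<^esub> f x) \<otimes>\<^bsub>H\<^esub> h) w \<one>\<^bsub>H\<^esub>"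

text \<open>
  The homomorphism from a presented group to H determined by the images \<open>f x\<close> of the generators.
  The choice of a representative of the class A is immaterial as soon as f respects the relations
  (lemma \<open>extend_hom\<close> below).
\<close>

definition extend :: "('h, 'm) monoid_scheme \<Rightarrow> ('x \<Rightarrow> 'h) \<Rightarrow> 'x word set \<Rightarrow> 'h" where
  "extend H f A = weval H f (SOME w. w \<in> A)"

lemma words_append [simp]: "u @ v \<in> words X \<longleftrightarrow> u \<in> words X \<and> v \<in> words X"
  by (auto simp: words_def)

lemma words_Nil [simp]: "[] \<in> words X"
  by (simp add: words_def)

lemma weq_words: "weq P u v \<Longrightarrow> u \<in> words (fst P) \<and> v \<in> words (fst P)"
  by (induction rule: weq.induct) (auto simp: words_def)

lemma wclass_eqI:
  assumes "weq P u v"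
  shows "wclass P u = wclass P v"
proof -
  have "weq P u w \<longleftrightarrow> weq P v w" for w
    using weq.trans[OF assms] weq.trans[OF weq.sym[OF assms]] by metis
  then show ?thesis
    by (simp add: wclass_def)
qed

lemma wclass_self: "u \<in> words (fst P) \<Longrightarrow> u \<in> wclass P u"
  by (simp add: wclass_def weq.refl)

lemma presented_mult:
  assumes "u \<in> words (fst P)" "v \<in> words (fst P)"
  shows "wclass P u \<otimes>\<^bsub>presented_group P\<^esub> wclass P v = wclass P (u @ v)"
proof -
  have "wclass P (u' @ v') = wclass P (u @ v)" if "u' \<in> wclass P u" "v' \<in> wclass P v" for u' v'
  proof (rule wclass_eqI)
    have "weq P u u'" "weq P v v'"
      using that by (simp_all add: wclass_def)
    then have "weq P (u @ v) (u' @ v')"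
      by (rule weq.append)
    then show "weq P (u' @ v') (u @ v)"
      by (rule weq.sym)
  qed
  then have "(\<Union>u'\<in>wclass P u. \<Union>v'\<in>wclass P v. wclass P (u' @ v')) = wclass P (u @ v)"
    using wclass_self[OF assms(1)] wclass_self[OF assms(2)] by blast
  then show ?thesis
    by (simp add: presented_group_def)
qed

lemma winv_words: "w \<in> words X \<Longrightarrow> winv w \<in> words X"
  by (auto simp: words_def winv_def)

lemma weq_winv: "w \<in> words (fst P) \<Longrightarrow> weq P (winv w @ w) []"
proof (induction w)
  case Nil
  then show ?case by (simp add: winv_def weq.refl)
next
  case (Cons y w)
  obtain x e where y: "y = (x, e)" by fastforce
  have x: "x \<in> fst P" and w: "w \<in> words (fst P)"
    using Cons.prems by (auto simp: words_def y)
  have "weq P [(x, \<not> e), (x, e)] []"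
    using weq.cancel[OF x, of "\<not> e"] by simp
  then have "weq P ([(x, \<not> e), (x, e)] @ w) ([] @ w)"
    using w by (intro weq.append weq.refl)
  then have "weq P (winv w @ [(x, \<not> e), (x, e)] @ w) (winv w @ w)"
    using w by (intro weq.append weq.refl) (auto intro: winv_words)
  then show ?case
    using Cons.IH[OF w] by (auto simp: winv_def y intro: weq.trans)
qed

lemma group_presented: "group (presented_group P)"
proof (rule groupI, goal_cases)
  case (1 A B)
  then obtain u v where "A = wclass P u" "B = wclass P v" "u \<in> words (fst P)" "v \<in> words (fst P)"
    by (auto simp: presented_group_def)
  then have "A \<otimes>\<^bsub>presented_group P\<^esub> B = wclass P (u @ v)" "u @ v \<in> words (fst P)"
    by (simp_all add: presented_mult)
  then show ?case by (simp add: presented_group_def)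
next
  case 2
  then show ?case by (auto simp: presented_group_def)
next
  case (3 A B C)
  then obtain u v w where "A = wclass P u" "B = wclass P v" "C = wclass P w"
    "u \<in> words (fst P)" "v \<in> words (fst P)" "w \<in> words (fst P)"
    by (auto simp: presented_group_def)
  then show ?case by (simp add: presented_mult)
next
  case (4 A)
  then obtain u where "A = wclass P u" "u \<in> words (fst P)"
    by (auto simp: presented_group_def)
  moreover have "\<one>\<^bsub>presented_group P\<^esub> = wclass P []"
    by (simp add: presented_group_def)
  ultimately show ?case by (simp add: presented_mult)
next
  case (5 A)
  then obtain u where u: "A = wclass P u" "u \<in> words (fst P)"
    by (auto simp: presented_group_def)
  have "\<one>\<^bsub>presented_group P\<^esub> = wclass P []"
    by (simp add: presented_group_def)
  then have "wclass P (winv u) \<otimes>\<^bsub>presented_group P\<^esub> A = \<one>\<^bsub>presented_group P\<^esub>"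
    using u by (simp add: presented_mult winv_words wclass_eqI[OF weq_winv])
  then show ?case
    using u by (intro bexI[of _ "wclass P (winv u)"]) (auto simp: presented_group_def winv_words)
qed

lemma weval_closed:
  assumes "group H" "f \<in> X \<rightarrow> carrier H" "w \<in> words X"
  shows "weval H f w \<in> carrier H"
proof -
  interpret group H by fact
  show ?thesis using assms(2,3)
    by (induction w) (auto simp: weval_def words_def Pi_iff)
qed

lemma weval_append:
  assumes "group H" "f \<in> X \<rightarrow> carrier H" "u \<in> words X" "v \<in> words X"
  shows "weval H f (u @ v) = weval H f u \<otimes>\<^bsub>H\<^esub> weval H f v"
proof -
  interpret group H by fact
  show ?thesis using assms(3)
  proof (induction u)
    case Nil
    then show ?case using weval_closed[OF assms(1,2,4)] by (simp add: weval_def)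
  next
    case (Cons y u)
    obtain x e where y: "y = (x, e)" by fastforce
    have x: "f x \<in> carrier H" and u: "u \<in> words X"
      using Cons.prems assms(2) by (auto simp: words_def y)
    have c: "weval H f u \<in> carrier H" "weval H f v \<in> carrier H"
      using weval_closed[OF assms(1,2)] u assms(4) by auto
    have s: "weval H f (y # w) = (if e then f x else inv\<^bsub>H\<^esub> f x) \<otimes>\<^bsub>H\<^esub> weval H f w" for w
      by (simp add: weval_def y)
    show ?case using Cons.IH[OF u] x c by (simp add: s m_assoc)
  qed
qed

lemma weval_weq:
  assumes "group H" "f \<in> fst P \<rightarrow> carrier H"
    and rels: "\<And>u v. (u, v) \<in> snd P \<Longrightarrow> weval H f u = weval H f v"
    and "weq P u v"
  shows "weval H f u = weval H f v"
proof -
  interpret group H by fact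
  show ?thesis using assms(4)
  proof (induction rule: weq.induct)
    case (append u u' v v')
    then show ?case
      using weval_append[OF assms(1,2)] weq_words by metis
  next
    case (cancel x e)
    then have "f x \<in> carrier H" using assms(2) by auto
    then show ?case by (auto simp: weval_def)
  qed (auto intro: rels)
qed

lemma extend_hom:
  assumes "group H" "f \<in> fst P \<rightarrow> carrier H"
    and rels: "\<And>u v. (u, v) \<in> snd P \<Longrightarrow> weval H f u = weval H f v"
  shows "extend H f \<in> hom (presented_group P) H"
    and "x \<in> fst P \<Longrightarrow> extend H f (gen_of P x) = f x"
proof -
  interpret group H by fact
  have ext: "extend H f (wclass P u) = weval H f u" if "u \<in> words (fst P)" for u
  proof -
    have "\<exists>w. w \<in> wclass P u"
      using wclass_self[OF that] by blast
    then have "(SOME w. w \<in> wclass P u) \<in> wclass P u" by (rule someI_ex)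
    then have "weq P u (SOME w. w \<in> wclass P u)" by (simp add: wclass_def)
    from weval_weq[OF assms this] show ?thesis by (simp add: extend_def)
  qed
  show "extend H f \<in> hom (presented_group P) H"
  proof (rule homI)
    fix A assume "A \<in> carrier (presented_group P)"
    then show "extend H f A \<in> carrier H"
      using weval_closed[OF assms(1,2)] by (auto simp: presented_group_def ext)
  next
    fix A B assume "A \<in> carrier (presented_group P)" "B \<in> carrier (presented_group P)"
    then obtain u v where "A = wclass P u" "B = wclass P v"
      "u \<in> words (fst P)" "v \<in> words (fst P)"
      by (auto simp: presented_group_def)
    then show "extend H f (A \<otimes>\<^bsub>presented_group P\<^esub> B) = extend H f A \<otimes>\<^bsub>H\<^esub> extend H f B"
      using weval_append[OF assms(1,2)] by (simp add: presented_mult ext)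
  qed
  assume x: "x \<in> fst P"
  then have "[(x, True)] \<in> words (fst P)" "f x \<in> carrier H"
    using assms(2) by (auto simp: words_def)
  then show "extend H f (gen_of P x) = f x"
    by (simp add: gen_of_def ext) (simp add: weval_def)
qed


section \<open>Lower central series, quotients and kernels\<close>

definition commutator_subgroup :: "('a, 'm) monoid_scheme \<Rightarrow> 'a set \<Rightarrow> 'a set \<Rightarrow> 'a set" where
  "commutator_subgroup G H K =
     generate G {h \<otimes>\<^bsub>G\<^esub> k \<otimes>\<^bsub>G\<^esub> inv\<^bsub>G\<^esub> h \<otimes>\<^bsub>G\<^esub> inv\<^bsub>G\<^esub> k |h k. h \<in> H \<and> k \<in> K}"

text \<open>The series starts at index 1; the value at index 0 is a dummy.\<close>

fun lower_central :: "('a, 'm) monoid_scheme \<Rightarrow> nat \<Rightarrow> 'a set" (\<open>\<Gamma>\<close>) where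
  "\<Gamma> G 0 = carrier G"
| "\<Gamma> G (Suc 0) = carrier G"
| "\<Gamma> G (Suc (Suc i)) = commutator_subgroup G (carrier G) (\<Gamma> G (Suc i))"

text \<open>For a homomorphism f into H, \<open>quot_map H M f\<close> is the map induced by f on cosets, with values
  in \<open>H Mod M\<close>: it sends the coset of x to the coset of \<open>f x\<close>.\<close>

definition quot_map :: "('b, 'm) monoid_scheme \<Rightarrow> 'b set \<Rightarrow> ('a \<Rightarrow> 'b) \<Rightarrow> 'a set \<Rightarrow> 'b set" where
  "quot_map H M f C = (\<Union>x\<in>C. M #>\<^bsub>H\<^esub> f x)"

definition kernel_group ::
    "('a, 'm) monoid_scheme \<Rightarrow> ('b, 'n) monoid_scheme \<Rightarrow> ('a \<Rightarrow> 'b) \<Rightarrow> ('a, 'm) monoid_scheme" where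
  "kernel_group G H f = G\<lparr>carrier := kernel G H f\<rparr>"

text \<open>
  \<open>ses_morphism\<close>: the triple \<open>(\<gamma>, \<alpha>, \<beta>)\<close> is a morphism from the short exact sequence
  \<open>1 \<rightarrow> A \<rightarrow> B \<rightarrow> C \<rightarrow> 1\<close> with maps i, p to \<open>1 \<rightarrow> A' \<rightarrow> B' \<rightarrow> C' \<rightarrow> 1\<close> with maps i', p'. Note that
  \<open>short_exact_sequence\<close> lists the groups and the maps from right to left.
\<close>

definition ses_morphism where
  "ses_morphism A B C i p A' B' C' i' p' \<gamma> \<alpha> \<beta> \<longleftrightarrow>
     short_exact_sequence C B A p i \<and> short_exact_sequence C' B' A' p' i' \<and>
     \<gamma> \<in> hom A A' \<and> \<alpha> \<in> hom B B' \<and> \<beta> \<in> hom C C' \<and>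
     (\<forall>x\<in>carrier A. \<alpha> (i x) = i' (\<gamma> x)) \<and>
     (\<forall>x\<in>carrier B. \<beta> (p x) = p' (\<alpha> x))"


section \<open>Surface braid groups and mixed braid groups\<close>

text \<open>
  The braid groups are taken in their standard presentations. Throughout, g is the genus of the
  compact surface with one boundary component; g = 0 gives the groups over the disc.
  The letters \<open>St\<close>, \<open>At\<close>, \<open>Bt\<close> are the generators decorated with a tilde, i.e. those that move the
  last n strands; \<open>Zeta j\<close> is the loop around the j-th puncture (or the j-th of the last n strands).
\<close>

datatype letter = S nat | A nat | B nat | Zeta nat | St nat | At nat | Bt nat

definition sigmas :: "(nat \<Rightarrow> letter) \<Rightarrow> nat \<Rightarrow> letter set" where
  "sigmas s m = s ` {1..<m}"

definition handles :: "(nat \<Rightarrow> letter) \<Rightarrow> (nat \<Rightarrow> letter) \<Rightarrow> nat \<Rightarrow> letter set" where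
  "handles a b g = a ` {1..g} \<union> b ` {1..g}"

definition zetas :: "nat \<Rightarrow> letter set" where
  "zetas n = Zeta ` {1..n}"

text \<open>
  Relations of the braid group on m strands of the surface of genus g with p punctures. The
  families s, a, b of generator names are parameters because the relations are used twice, for
  the plain generators and (with p = 0) for the generators with a tilde.
\<close>

inductive_set braid_rels ::
    "(nat \<Rightarrow> letter) \<Rightarrow> (nat \<Rightarrow> letter) \<Rightarrow> (nat \<Rightarrow> letter) \<Rightarrow> nat \<Rightarrow> nat \<Rightarrow> nat \<Rightarrow> (letter word \<times> letter word) set"
  for s a b m g p where
  far: "\<lbrakk>i \<in> {1..<m}; j \<in> {1..<m}; i + 2 \<le> j \<or> j + 2 \<le> i\<rbrakk> \<Longrightarrow>
    (pos [s i, s j], pos [s j, s i]) \<in> braid_rels s a b m g p"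
| braid: "\<lbrakk>i \<in> {1..<m}; i + 1 \<in> {1..<m}\<rbrakk> \<Longrightarrow>
    (pos [s i, s (i + 1), s i], pos [s (i + 1), s i, s (i + 1)]) \<in> braid_rels s a b m g p"
| sigma_comm: "\<lbrakk>c \<in> handles a b g \<union> zetas p; i \<in> {1..<m}; i \<noteq> 1\<rbrakk> \<Longrightarrow>
    (pos [c, s i], pos [s i, c]) \<in> braid_rels s a b m g p"
| sigma_first: "\<lbrakk>c \<in> handles a b g \<union> zetas p; 1 \<in> {1..<m}\<rbrakk> \<Longrightarrow>
    (pos [c, s 1, c, s 1], pos [s 1, c, s 1, c]) \<in> braid_rels s a b m g p"
| handle: "\<lbrakk>i \<in> {1..g}; 1 \<in> {1..<m}\<rbrakk> \<Longrightarrow>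
    (pos [a i, s 1, b i], pos [s 1, b i, s 1, a i, s 1]) \<in> braid_rels s a b m g p"
| handles_comm: "\<lbrakk>i \<in> {1..g}; j \<in> {1..g}; i < j; c \<in> {a i, b i}; d \<in> {a j, b j}; 1 \<in> {1..<m}\<rbrakk> \<Longrightarrow>
    (wconj (pos [c]) (pos [s 1]) @ pos [d], pos [d] @ wconj (pos [c]) (pos [s 1]))
      \<in> braid_rels s a b m g p"
| zeta_handle_comm: "\<lbrakk>i \<in> {1..p}; c \<in> handles a b g; 1 \<in> {1..<m}\<rbrakk> \<Longrightarrow>
    (wconj (pos [Zeta i]) (pos [s 1]) @ pos [c], pos [c] @ wconj (pos [Zeta i]) (pos [s 1]))
      \<in> braid_rels s a b m g p"
| zeta_zeta_comm: "\<lbrakk>i \<in> {1..p}; j \<in> {1..p}; i < j; 1 \<in> {1..<m}\<rbrakk> \<Longrightarrow>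
    (wconj (pos [Zeta i]) (pos [s 1]) @ pos [Zeta j], pos [Zeta j] @ wconj (pos [Zeta i]) (pos [s 1]))
      \<in> braid_rels s a b m g p"

text \<open>\<open>act y x\<close> is the word \<open>y x y\<inverse>\<close>.\<close>

abbreviation act :: "letter \<Rightarrow> letter \<Rightarrow> letter word" where
  "act y x \<equiv> wconj (pos [x]) (winv (pos [y]))"

inductive_set mixed_rels :: "nat \<Rightarrow> nat \<Rightarrow> nat \<Rightarrow> (letter word \<times> letter word) set"
  for g k n where
  tilde_sigma: "\<lbrakk>y \<in> sigmas St n \<union> handles At Bt g; j \<in> {1..<k}\<rbrakk> \<Longrightarrow>
    (pos [y, S j], pos [S j, y]) \<in> mixed_rels g k n"
| sigma_handle: "\<lbrakk>i \<in> {1..<n}; c \<in> handles A B g\<rbrakk> \<Longrightarrow>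
    (pos [St i, c], pos [c, St i]) \<in> mixed_rels g k n"
| sigma_zeta_next: "i \<in> {1..<n} \<Longrightarrow>
    (act (St i) (Zeta (i + 1)), pos [Zeta i]) \<in> mixed_rels g k n"
| sigma_zeta: "i \<in> {1..<n} \<Longrightarrow>
    (act (St i) (Zeta i), wconj (pos [Zeta (i + 1)]) (pos [Zeta i])) \<in> mixed_rels g k n"
| sigma_zeta_other: "\<lbrakk>i \<in> {1..<n}; j \<in> {1..n}; j \<noteq> i; j \<noteq> i + 1\<rbrakk> \<Longrightarrow>
    (act (St i) (Zeta j), pos [Zeta j]) \<in> mixed_rels g k n"
| handle_zeta_first: "\<lbrakk>i \<in> {1..g}; (y, x) \<in> {(At i, A i), (Bt i, B i)}; 1 \<in> {1..n}\<rbrakk> \<Longrightarrow>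
    (act y (Zeta 1), wconj (pos [Zeta 1]) (pos [x, Zeta 1])) \<in> mixed_rels g k n"
| handle_zeta: "\<lbrakk>i \<in> {1..g}; (y, x) \<in> {(At i, A i), (Bt i, B i)}; j \<in> {1..n}; j \<noteq> 1\<rbrakk> \<Longrightarrow>
    (act y (Zeta j), wconj (pos [Zeta j]) (wcomm (winv (pos [x])) (winv (pos [Zeta 1]))))
      \<in> mixed_rels g k n"
| handle_same: "\<lbrakk>i \<in> {1..g}; (y, x) \<in> {(At i, A i), (Bt i, B i)}; 1 \<in> {1..n}\<rbrakk> \<Longrightarrow>
    (act y x, wconj (pos [x]) (pos [Zeta 1])) \<in> mixed_rels g k n"
| handle_lower: "\<lbrakk>i \<in> {1..g}; (y, x) \<in> {(At i, A i), (Bt i, B i)};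
      j \<in> {1..g}; d \<in> {A j, B j}; i > j; 1 \<in> {1..n}\<rbrakk> \<Longrightarrow>
    (act y d, wconj (pos [d]) (wcomm (winv (pos [x])) (winv (pos [Zeta 1])))) \<in> mixed_rels g k n"
| handle_upper: "\<lbrakk>i \<in> {1..g}; y \<in> {At i, Bt i}; j \<in> {1..g}; d \<in> {A j, B j}; j > i\<rbrakk> \<Longrightarrow>
    (act y d, pos [d]) \<in> mixed_rels g k n"
| handle_ab: "\<lbrakk>i \<in> {1..g}; 1 \<in> {1..n}\<rbrakk> \<Longrightarrow>
    (act (At i) (B i), pos [B i, Zeta 1]) \<in> mixed_rels g k n"
| handle_ba: "\<lbrakk>i \<in> {1..g}; 1 \<in> {1..n}\<rbrakk> \<Longrightarrow>
    (act (Bt i) (A i),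
     winv (pos [Zeta 1]) @ pos [A i] @ wcomm (winv (pos [B i])) (winv (pos [Zeta 1])))
      \<in> mixed_rels g k n"

definition punctured_pres :: "nat \<Rightarrow> nat \<Rightarrow> nat \<Rightarrow> letter presentation" where
  "punctured_pres g k n = (sigmas S k \<union> handles A B g \<union> zetas n, braid_rels S A B k g n)"

definition surface_pres :: "nat \<Rightarrow> nat \<Rightarrow> letter presentation" where
  "surface_pres g n = (sigmas St n \<union> handles At Bt g, braid_rels St At Bt n g 0)"

definition mixed_pres :: "nat \<Rightarrow> nat \<Rightarrow> nat \<Rightarrow> letter presentation" where
  "mixed_pres g k n =
     (fst (punctured_pres g k n) \<union> fst (surface_pres g n),
      snd (punctured_pres g k n) \<union> snd (surface_pres g n) \<union> mixed_rels g k n)"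

text \<open>
  \<open>punctured_braid g k n\<close> is the braid group on k strands of the surface of genus g with one boundary
  component and n punctures, \<open>surface_braid g n\<close> the one on n strands without punctures, and
  \<open>mixed_braid g k n\<close> the mixed braid group on k + n strands without punctures.
\<close>

definition punctured_braid :: "nat \<Rightarrow> nat \<Rightarrow> nat \<Rightarrow> letter word set monoid" where
  "punctured_braid g k n = presented_group (punctured_pres g k n)"

definition surface_braid :: "nat \<Rightarrow> nat \<Rightarrow> letter word set monoid" where
  "surface_braid g n = presented_group (surface_pres g n)"

definition mixed_braid :: "nat \<Rightarrow> nat \<Rightarrow> nat \<Rightarrow> letter word set monoid" where
  "mixed_braid g k n = presented_group (mixed_pres g k n)"

text \<open>
  The inclusion of the k-strand group of the n-punctured surface into the mixed braid group, and
  the map forgetting the first k strands.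
\<close>

definition incl :: "nat \<Rightarrow> nat \<Rightarrow> nat \<Rightarrow> letter word set \<Rightarrow> letter word set" where
  "incl g k n = extend (mixed_braid g k n) (gen_of (mixed_pres g k n))"

definition forget :: "nat \<Rightarrow> nat \<Rightarrow> nat \<Rightarrow> letter word set \<Rightarrow> letter word set" where
  "forget g k n = extend (surface_braid g n)
     (\<lambda>x. if x \<in> fst (surface_pres g n) then gen_of (surface_pres g n) x else \<one>\<^bsub>surface_braid g n\<^esub>)"

text \<open>The maps from the groups over the disc induced by embedding a disc in the surface of genus g.\<close>

definition iota_mixed :: "nat \<Rightarrow> nat \<Rightarrow> nat \<Rightarrow> letter word set \<Rightarrow> letter word set" where
  "iota_mixed g k n = extend (mixed_braid g k n) (gen_of (mixed_pres g k n))"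

definition iota_punctured :: "nat \<Rightarrow> nat \<Rightarrow> nat \<Rightarrow> letter word set \<Rightarrow> letter word set" where
  "iota_punctured g k n = extend (punctured_braid g k n) (gen_of (punctured_pres g k n))"

definition iota_surface :: "nat \<Rightarrow> nat \<Rightarrow> letter word set \<Rightarrow> letter word set" where
  "iota_surface g n = extend (surface_braid g n) (gen_of (surface_pres g n))"

text \<open>
  The quotients by the i-th term of the lower central series, with their canonical projections.
  The relevant values are i = 2 over the disc (g = 0) and i = 3 for \<open>g \<ge> 1\<close>.
\<close>

definition mixed_quot :: "nat \<Rightarrow> nat \<Rightarrow> nat \<Rightarrow> nat \<Rightarrow> letter word set set monoid" where
  "mixed_quot i g k n = mixed_braid g k n Mod \<Gamma> (mixed_braid g k n) i"

definition surface_quot :: "nat \<Rightarrow> nat \<Rightarrow> nat \<Rightarrow> letter word set set monoid" where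
  "surface_quot i g n = surface_braid g n Mod \<Gamma> (surface_braid g n) i"

definition mixed_proj :: "nat \<Rightarrow> nat \<Rightarrow> nat \<Rightarrow> nat \<Rightarrow> letter word set \<Rightarrow> letter word set set" where
  "mixed_proj i g k n x = \<Gamma> (mixed_braid g k n) i #>\<^bsub>mixed_braid g k n\<^esub> x"

definition surface_proj :: "nat \<Rightarrow> nat \<Rightarrow> nat \<Rightarrow> letter word set \<Rightarrow> letter word set set" where
  "surface_proj i g n x = \<Gamma> (surface_braid g n) i #>\<^bsub>surface_braid g n\<^esub> x"

definition forget_quot ::
    "nat \<Rightarrow> nat \<Rightarrow> nat \<Rightarrow> nat \<Rightarrow> letter word set set \<Rightarrow> letter word set set" where
  "forget_quot i g k n = quot_map (surface_braid g n) (\<Gamma> (surface_braid g n) i) (forget g k n)"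

text \<open>The kernel of the induced map, and the restriction of the canonical projection to the k-strand
  group of the punctured surface (viewed in the mixed braid group through \<open>incl\<close>).\<close>

definition kernel_quot :: "nat \<Rightarrow> nat \<Rightarrow> nat \<Rightarrow> nat \<Rightarrow> letter word set set monoid" where
  "kernel_quot i g k n = kernel_group (mixed_quot i g k n) (surface_quot i g n) (forget_quot i g k n)"

definition kernel_proj :: "nat \<Rightarrow> nat \<Rightarrow> nat \<Rightarrow> nat \<Rightarrow> letter word set \<Rightarrow> letter word set set" where
  "kernel_proj i g k n = mixed_proj i g k n \<circ> incl g k n"

end

(*
  Modulo the third term of the lower central series the generators sigma_i, the zeta_j and the
  sigma-tilde_i collapse to three central elements s, z, t, and all handle generators commute up to
  [a_i, b_i] = s^2, [at_i, bt_i] = t^2, [at_i, b_i] = z, [bt_i, a_i] = z^-1.  The same collapse is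
  forced in any quotient whose restriction to the disc factors through the abelianised disc groups.
  If moreover s, z, t are independent, such a quotient is determined: the commutator form is
  nondegenerate on the handle exponents, so a word in the kernel has all handle exponents zero,
  hence equals s^p z^q t^r with p, q, r read off from the word, and p = q = r = 0.  So any two such
  quotients have the same kernel.  Independence of s, z, t in the lower central quotients is seen
  in an explicit Heisenberg-type group of class two.
*)

theory Submission
  imports Defs "HOL-Library.Product_Plus" "HOL-Library.Function_Algebras"
begin

section \<open>Homomorphisms, lower central series and presentations\<close>

text \<open>With s central, the relation a s b = s b s a s reads a b = s^2 b a, while at b at^-1 = b
  zeta yields a single z: hence the exponents 2 and 1. Centrality of s rests on sigma_2, which
  commutes with every handle generator and every loop and has the same value as sigma_1; likewise
  sigma-tilde_2 fixes zeta_1, so t and z commute. This is where three strands of each kind enter.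
  Injectivity in (i) is also a comparison of kernels, between the two maps from a disc group to its
  abelianisation and to the surface quotient. The delicate group is G_k of the surface, a kernel
  rather than a lower central quotient of the k-strand group. Two facts about it come from the mixed
  group: the equality of the zeta_j, which the tilde generators conjugate into each other, and the
  surjectivity of Phi_k, from a factorisation inside the mixed quotient. One framework serves the
  three families of groups: the neutral element fills the slot of an absent s, z or t, and
  independence is required only for exponents that the available letters can produce.\<close>

lemma same_kernel_factor:
  assumes G: "group G" "group H" "group K"
    and f: "f \<in> epi G H" and h: "h \<in> hom G K"
    and ker: "\<And>x. x \<in> carrier G \<Longrightarrow> f x = \<one>\<^bsub>H\<^esub> \<longleftrightarrow> h x = \<one>\<^bsub>K\<^esub>"
  obtains \<theta> where "\<theta> \<in> mon H K" "\<And>x. x \<in> carrier G \<Longrightarrow> h x = \<theta> (f x)"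
proof -
  interpret f: group_hom G H f
    using G f by (auto simp: group_hom_def group_hom_axioms_def epi_def)
  interpret h: group_hom G K h
    using G h by (auto simp: group_hom_def group_hom_axioms_def)
  define \<theta> where "\<theta> y = h (inv_into (carrier G) f y)" for y
  have im: "f ` carrier G = carrier H"
    using f by (simp add: epi_def)
  have diff: "f x = f y \<longleftrightarrow> h x = h y" if "x \<in> carrier G" "y \<in> carrier G" for x y
  proof -
    have "f x = f y \<longleftrightarrow> f (x \<otimes>\<^bsub>G\<^esub> inv\<^bsub>G\<^esub> y) = \<one>\<^bsub>H\<^esub>"
      using that by (simp add: f.H.inv_solve_right')
    also have "\<dots> \<longleftrightarrow> h (x \<otimes>\<^bsub>G\<^esub> inv\<^bsub>G\<^esub> y) = \<one>\<^bsub>K\<^esub>"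
      using that ker[of "x \<otimes>\<^bsub>G\<^esub> inv\<^bsub>G\<^esub> y"] by simp
    also have "\<dots> \<longleftrightarrow> h x = h y"
      using that by (simp add: h.H.inv_solve_right')
    finally show ?thesis .
  qed
  have \<theta>: "\<theta> (f x) = h x" if "x \<in> carrier G" for x
  proof -
    have "inv_into (carrier G) f (f x) \<in> carrier G" "f (inv_into (carrier G) f (f x)) = f x"
      using that by (auto intro: inv_into_into f_inv_into_f)
    then show ?thesis
      using diff that by (simp add: \<theta>_def)
  qed
  have "\<theta> \<in> mon H K"
    unfolding mon_def hom_def im[symmetric]
    by (auto simp: \<theta> inj_on_def diff simp flip: f.hom_mult)
  then show thesis
    using that \<theta> by simp
qed

lemma same_kernel_iso:
  assumes "group G" "group H" "group K" "f \<in> epi G H" "h \<in> epi G K"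
    and "\<And>x. x \<in> carrier G \<Longrightarrow> f x = \<one>\<^bsub>H\<^esub> \<longleftrightarrow> h x = \<one>\<^bsub>K\<^esub>"
  shows "\<exists>\<theta> \<in> iso H K. \<forall>x \<in> carrier G. h x = \<theta> (f x)"
proof -
  obtain \<theta> where \<theta>: "\<theta> \<in> mon H K" "\<And>x. x \<in> carrier G \<Longrightarrow> h x = \<theta> (f x)"
    using assms same_kernel_factor[of G H K f h] unfolding epi_def by blast
  have "carrier K = h ` carrier G" "carrier H = f ` carrier G"
    using assms(4,5) by (auto simp: epi_def)
  then have "carrier K = \<theta> ` carrier H"
    using \<theta>(2) by (force simp: image_iff)
  then have "\<theta> \<in> iso H K"
    using \<theta>(1) by (simp add: iso_iff_mon_epi epi_def mon_def)
  with \<theta>(2) show ?thesis by blast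
qed

section \<open>Lower central series and the braid relation\<close>

context group
begin

lemma inv_cancel_left [simp]:
  assumes "x \<in> carrier G" "y \<in> carrier G"
  shows "inv x \<otimes> (x \<otimes> y) = y" "x \<otimes> (inv x \<otimes> y) = y"
  using assms by (simp_all flip: m_assoc)

lemma commutator_mem_lower_central:
  assumes "x \<in> carrier G" "y \<in> \<Gamma> G (Suc i)"
  shows "x \<otimes> y \<otimes> inv x \<otimes> inv y \<in> \<Gamma> G (Suc (Suc i))"
  using assms by (auto simp: commutator_subgroup_def intro!: generate.incl)

lemma normal_lower_central: "\<Gamma> G i \<lhd> G"
proof (induction i)
  case (Suc i)
  show ?case
  proof (cases i)
    case (Suc j)
    then interpret N: normal "\<Gamma> G (Suc j)" G
      using Suc.IH by simp
    have "generate G {h \<otimes> k \<otimes> inv h \<otimes> inv k |h k. h \<in> carrier G \<and> k \<in> \<Gamma> G (Suc j)} \<lhd> G"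
    proof (rule normal_generateI, goal_cases)
      case (2 c x)
      then obtain h k where c: "c = h \<otimes> k \<otimes> inv h \<otimes> inv k"
        and hk: "h \<in> carrier G" "k \<in> \<Gamma> G (Suc j)" by auto
      then have k: "k \<in> carrier G" using N.subset by auto
      have x: "x \<in> carrier G" by fact
      have "x \<otimes> c \<otimes> inv x = (x \<otimes> h \<otimes> inv x) \<otimes> (x \<otimes> k \<otimes> inv x) \<otimes> inv (x \<otimes> h \<otimes> inv x) \<otimes> inv (x \<otimes> k \<otimes> inv x)"
        using hk(1) k x by (simp add: c m_assoc inv_mult_group)
      moreover have "x \<otimes> k \<otimes> inv x \<in> \<Gamma> G (Suc j)"
        using hk x by (intro N.inv_op_closed2)
      ultimately show ?case using hk x by blast
    qed (use N.subset in auto)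
    then show ?thesis by (simp add: Suc commutator_subgroup_def)
  qed (simp add: normal_self)
qed (simp add: normal_self)

lemma lower_central_subset: "\<Gamma> G i \<subseteq> carrier G"
  using normal_lower_central[of i] normal_imp_subgroup subgroup.subset by blast

text \<open>One statement serves both quotients: [w, [x, y]] is a commutator, hence in \<Gamma>_2,
  and since [x, y] is itself in \<Gamma>_2 it is also in \<Gamma>_3.\<close>

lemma commutator_central_mod_lower_central:
  assumes "i \<in> {2, 3}" "x \<in> carrier G" "y \<in> carrier G" "w \<in> carrier G"
  shows "w \<otimes> (x \<otimes> y \<otimes> inv x \<otimes> inv y) \<otimes> inv w \<otimes> inv (x \<otimes> y \<otimes> inv x \<otimes> inv y) \<in> \<Gamma> G i"
proof -
  have "x \<otimes> y \<otimes> inv x \<otimes> inv y \<in> \<Gamma> G 2"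
    using commutator_mem_lower_central[of x y 0] assms by (simp add: numeral_2_eq_2)
  then have "x \<otimes> y \<otimes> inv x \<otimes> inv y \<in> \<Gamma> G (Suc 0)" "x \<otimes> y \<otimes> inv x \<otimes> inv y \<in> \<Gamma> G (Suc (Suc 0))"
    using assms by (simp_all add: numeral_2_eq_2)
  then show ?thesis
    using commutator_mem_lower_central[of w _ 0] commutator_mem_lower_central[of w _ "Suc 0"] assms
    by (auto simp: numeral_2_eq_2 numeral_3_eq_3 simp del: lower_central.simps)
qed

text \<open>With c = [x, y] commuting with y, the conjugate x y x^-1 = c y equals y c = y x y x^-1
  y^-1, which the braid relation turns into x; hence y = x.\<close>

lemma braid_relation_collapse:
  assumes x: "x \<in> carrier G" and y: "y \<in> carrier G"
    and braid: "x \<otimes> y \<otimes> x = y \<otimes> x \<otimes> y"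
    and central: "y \<otimes> (x \<otimes> y \<otimes> inv x \<otimes> inv y) = (x \<otimes> y \<otimes> inv x \<otimes> inv y) \<otimes> y"
  shows "x = y"
proof -
  have "x \<otimes> y \<otimes> inv x = y \<otimes> (x \<otimes> y \<otimes> inv x \<otimes> inv y)"
    using x y by (simp only: central) (simp add: m_assoc)
  also have "\<dots> = (y \<otimes> x \<otimes> y) \<otimes> inv x \<otimes> inv y"
    using x y by (simp add: m_assoc)
  also have "\<dots> = (x \<otimes> y \<otimes> x) \<otimes> inv x \<otimes> inv y"
    by (simp only: braid)
  also have "\<dots> = x"
    using x y by (simp add: m_assoc)
  finally have "x \<otimes> y = x \<otimes> x"
    using x y by (metis inv_solve_right' m_closed)
  then show ?thesis
    using x y by simp
qed

end

lemma hom_lower_central: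
  assumes "group G" "group H" "h \<in> hom G H" "x \<in> \<Gamma> G i"
  shows "h x \<in> \<Gamma> H i"
  using assms(4)
proof (induction i arbitrary: x)
  case (Suc i)
  interpret h: group_hom G H h
    using assms by (auto simp: group_hom_def group_hom_axioms_def)
  show ?case
  proof (cases i)
    case (Suc j)
    have "x \<in> generate G {h \<otimes>\<^bsub>G\<^esub> k \<otimes>\<^bsub>G\<^esub> inv\<^bsub>G\<^esub> h \<otimes>\<^bsub>G\<^esub> inv\<^bsub>G\<^esub> k |h k. h \<in> carrier G \<and> k \<in> \<Gamma> G (Suc j)}"
      using Suc.prems by (simp add: Suc commutator_subgroup_def)
    then show ?thesis
    proof (induction rule: generate.induct)
      case one
      then show ?case
        using subgroup.one_closed[OF normal_imp_subgroup[OF h.H.normal_lower_central]] by simp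
    next
      case (incl x)
      then obtain u v where "x = u \<otimes>\<^bsub>G\<^esub> v \<otimes>\<^bsub>G\<^esub> inv\<^bsub>G\<^esub> u \<otimes>\<^bsub>G\<^esub> inv\<^bsub>G\<^esub> v" "u \<in> carrier G" "v \<in> \<Gamma> G (Suc j)"
        by auto
      then show ?case
        using h.H.commutator_mem_lower_central[of "h u" "h v" j] Suc.IH[of v] Suc
          h.G.lower_central_subset[of "Suc j"] by (auto simp: subset_iff)
    next
      case (inv x)
      then obtain u v where "x = u \<otimes>\<^bsub>G\<^esub> v \<otimes>\<^bsub>G\<^esub> inv\<^bsub>G\<^esub> u \<otimes>\<^bsub>G\<^esub> inv\<^bsub>G\<^esub> v" "u \<in> carrier G" "v \<in> \<Gamma> G (Suc j)"
        by auto
      then show ?case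
        using h.H.commutator_mem_lower_central[of "h u" "h v" j] Suc.IH[of v] Suc
          subgroup.m_inv_closed[OF normal_imp_subgroup[OF h.H.normal_lower_central],
            of "h u \<otimes>\<^bsub>H\<^esub> h v \<otimes>\<^bsub>H\<^esub> inv\<^bsub>H\<^esub> h u \<otimes>\<^bsub>H\<^esub> inv\<^bsub>H\<^esub> h v" "Suc (Suc j)"]
          h.G.lower_central_subset[of "Suc j"] by (auto simp: subset_iff)
    next
      case (eng x y)
      have "generate G {h \<otimes>\<^bsub>G\<^esub> k \<otimes>\<^bsub>G\<^esub> inv\<^bsub>G\<^esub> h \<otimes>\<^bsub>G\<^esub> inv\<^bsub>G\<^esub> k |h k. h \<in> carrier G \<and> k \<in> \<Gamma> G (Suc j)} \<subseteq> carrier G"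
        using h.G.lower_central_subset[of "Suc (Suc j)"] by (simp add: commutator_subgroup_def)
      then have "x \<in> carrier G" "y \<in> carrier G" using eng by auto
      then show ?case
        using eng subgroup.m_closed[OF normal_imp_subgroup[OF h.H.normal_lower_central]] by simp
    qed
  qed (use Suc.prems in simp)
qed (use assms in \<open>auto simp: hom_def\<close>)

section \<open>Homomorphisms out of a presented group\<close>

lemma weval_Nil [simp]: "weval H f [] = \<one>\<^bsub>H\<^esub>"
  by (simp add: weval_def)

lemma weval_Cons [simp]:
  "weval H f ((x, e) # w) = (if e then f x else inv\<^bsub>H\<^esub> f x) \<otimes>\<^bsub>H\<^esub> weval H f w"
  by (simp add: weval_def)

lemma words_Cons [simp]: "(x, e) # w \<in> words X \<longleftrightarrow> x \<in> X \<and> w \<in> words X"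
  by (simp add: words_def)

lemma weval_cong:
  assumes "w \<in> words X" "\<And>x. x \<in> X \<Longrightarrow> f x = f' x"
  shows "weval H f w = weval H f' w"
  using assms(1) by (induction w) (auto simp: assms(2))

lemma carrier_presented: "carrier (presented_group P) = wclass P ` words (fst P)"
  by (simp add: presented_group_def)

lemma one_presented: "\<one>\<^bsub>presented_group P\<^esub> = wclass P []"
  by (simp add: presented_group_def)

lemma gen_of_closed: "x \<in> fst P \<Longrightarrow> gen_of P x \<in> carrier (presented_group P)"
  by (simp add: gen_of_def carrier_presented)

text \<open>Turns every homomorphism out of a presented group into an evaluation of words, so that
  the later arguments only concern \<open>weval\<close>.\<close>

lemma hom_wclass:
  assumes "group H" "\<rho> \<in> hom (presented_group P) H" "w \<in> words (fst P)"
  shows "\<rho> (wclass P w) = weval H (\<lambda>x. \<rho> (gen_of P x)) w"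
proof -
  interpret h: group_hom "presented_group P" H \<rho>
    using assms group_presented[of P] by (simp add: group_hom_def group_hom_axioms_def)
  show ?thesis using assms(3)
  proof (induction w)
    case Nil
    then show ?case using h.hom_one by (simp add: one_presented)
  next
    case (Cons y w)
    obtain x e where y: "y = (x, e)" by fastforce
    have x: "x \<in> fst P" and w: "w \<in> words (fst P)"
      using Cons.prems by (auto simp: y)
    have letter: "wclass P [(x, e)] = (if e then gen_of P x else inv\<^bsub>presented_group P\<^esub> gen_of P x)"
    proof (cases e)
      case False
      have "wclass P [(x, False)] \<otimes>\<^bsub>presented_group P\<^esub> gen_of P x = \<one>\<^bsub>presented_group P\<^esub>"
        using x weq.cancel[OF x, of False] by (simp add: gen_of_def presented_mult one_presented wclass_eqI)
      then have "inv\<^bsub>presented_group P\<^esub> gen_of P x = wclass P [(x, False)]"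
        using x by (intro h.G.inv_equality) (auto simp: gen_of_closed, auto simp: carrier_presented)
      with False show ?thesis by simp
    qed (simp add: gen_of_def)
    have "wclass P (y # w) = wclass P [(x, e)] \<otimes>\<^bsub>presented_group P\<^esub> wclass P w"
      using x w by (simp add: y presented_mult)
    moreover have "wclass P w \<in> carrier (presented_group P)"
      using w by (simp add: carrier_presented)
    ultimately show ?case
      using gen_of_closed[OF x] Cons.IH[OF w] by (simp add: y letter)
  qed
qed

lemma hom_relation:
  assumes "group H" "\<rho> \<in> hom (presented_group P) H"
    and "(u, v) \<in> snd P" "u \<in> words (fst P)" "v \<in> words (fst P)"
  shows "weval H (\<lambda>x. \<rho> (gen_of P x)) u = weval H (\<lambda>x. \<rho> (gen_of P x)) v"
  using hom_wclass[OF assms(1,2,4)] hom_wclass[OF assms(1,2,5)] wclass_eqI[OF weq.rel[OF assms(3-5)]]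
  by simp

lemma hom_presented_eqI:
  assumes "group H" "\<rho> \<in> hom (presented_group P) H" "\<rho>' \<in> hom (presented_group P) H"
    and "\<And>x. x \<in> fst P \<Longrightarrow> \<rho> (gen_of P x) = \<rho>' (gen_of P x)"
    and "y \<in> carrier (presented_group P)"
  shows "\<rho> y = \<rho>' y"
  using assms(5) weval_cong[OF _ assms(4)] hom_wclass[OF assms(1,2)] hom_wclass[OF assms(1,3)]
  by (auto simp: carrier_presented)

lemma weval_gen_of:
  "w \<in> words (fst P) \<Longrightarrow> weval (presented_group P) (gen_of P) w = wclass P w"
  using hom_wclass[of "presented_group P" "\<lambda>x. x" P w] group_presented[of P] by (simp add: hom_def)

text \<open>The inclusions between the braid groups and the section of \<open>forget\<close> keep
  the names of the letters and add generators and relations; all of them are instances of this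
  lemma.\<close>

lemma extend_subpresentation:
  assumes "fst P \<subseteq> fst P'" "snd P \<subseteq> snd P'"
    and words: "\<And>u v. (u, v) \<in> snd P \<Longrightarrow> u \<in> words (fst P) \<and> v \<in> words (fst P)"
  shows "extend (presented_group P') (gen_of P') \<in> hom (presented_group P) (presented_group P')"
    and "x \<in> fst P \<Longrightarrow> extend (presented_group P') (gen_of P') (gen_of P x) = gen_of P' x"
proof -
  have rels: "weval (presented_group P') (gen_of P') u = weval (presented_group P') (gen_of P') v"
    if "(u, v) \<in> snd P" for u v
  proof -
    have "u \<in> words (fst P')" "v \<in> words (fst P')"
      using words[OF that] assms(1) by (auto simp: words_def)
    moreover have "(u, v) \<in> snd P'"
      using assms(2) that by auto
    ultimately show ?thesis
      by (simp add: weval_gen_of wclass_eqI weq.rel)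
  qed
  have gens: "gen_of P' \<in> fst P \<rightarrow> carrier (presented_group P')"
    using assms(1) by (auto intro: gen_of_closed)
  show "extend (presented_group P') (gen_of P') \<in> hom (presented_group P) (presented_group P')"
    by (rule extend_hom[OF group_presented gens rels])
  show "x \<in> fst P \<Longrightarrow> extend (presented_group P') (gen_of P') (gen_of P x) = gen_of P' x"
    by (rule extend_hom(2)[OF group_presented gens rels])
qed

section \<open>Words in groups with central handle commutators\<close>

fun is_handle :: "letter \<Rightarrow> bool" where
  "is_handle (A i) = True"
| "is_handle (B i) = True"
| "is_handle (At i) = True"
| "is_handle (Bt i) = True"
| "is_handle _ = False"

text \<open>Triples are exponents of the three central elements represented by \<open>S\<close>, \<open>Zeta\<close> and \<open>St\<close>, in this
  order; \<open>comm_form\<close> gives the exponents of the commutator of two handle letters.\<close>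

definition wt :: "letter \<Rightarrow> int \<times> int \<times> int" where
  "wt x = (case x of S _ \<Rightarrow> (1, 0, 0) | Zeta _ \<Rightarrow> (0, 1, 0) | St _ \<Rightarrow> (0, 0, 1) | _ \<Rightarrow> (0, 0, 0))"

text \<open>Half of the commutator form, chosen so that its antisymmetrisation gives the commutators
  of the handle letters. Its bilinear extension is the cocycle \<open>beta\<close> of the
  model.\<close>

definition bform :: "letter \<Rightarrow> letter \<Rightarrow> int \<times> int \<times> int" where
  "bform x y =
     (case x of
        A i \<Rightarrow> (case y of B j \<Rightarrow> if i = j then (2, 0, 0) else (0, 0, 0) | _ \<Rightarrow> (0, 0, 0))
      | At i \<Rightarrow> (case y of B j \<Rightarrow> if i = j then (0, 1, 0) else (0, 0, 0)
                         | Bt j \<Rightarrow> if i = j then (0, 0, 2) else (0, 0, 0) | _ \<Rightarrow> (0, 0, 0))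
      | Bt i \<Rightarrow> (case y of A j \<Rightarrow> if i = j then (0, -1, 0) else (0, 0, 0) | _ \<Rightarrow> (0, 0, 0))
      | _ \<Rightarrow> (0, 0, 0))"

definition comm_form :: "letter \<Rightarrow> letter \<Rightarrow> int \<times> int \<times> int" where
  "comm_form x y = bform x y - bform y x"

definition signed :: "bool \<Rightarrow> 'a::group_add \<Rightarrow> 'a" where
  "signed e c = (if e then c else - c)"

fun expo :: "letter word \<Rightarrow> letter \<Rightarrow> int" where
  "expo [] y = 0"
| "expo ((x, e) # w) y = (if x = y then signed e 1 else 0) + expo w y"

text \<open>Central commutators are additive in each argument, so the commutator of a word with y is
  the signed sum over the letters of the word.\<close>

fun comm_exp :: "letter word \<Rightarrow> letter \<Rightarrow> int \<times> int \<times> int" where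
  "comm_exp [] y = 0"
| "comm_exp ((x, e) # w) y = signed e (comm_form x y) + comm_exp w y"

text \<open>\<open>reduces w c\<close>: cancelling opposite pairs of handle letters turns w into the central
  element with exponents c. Since c depends on the word only, it is the same in every
  group in which the handle commutators take the central values given by \<open>comm_form\<close>.\<close>

inductive reduces :: "letter word \<Rightarrow> int \<times> int \<times> int \<Rightarrow> bool" where
  Nil: "reduces [] 0"
| central: "reduces w c \<Longrightarrow> \<not> is_handle x \<Longrightarrow> reduces ((x, e) # w) (signed e (wt x) + c)"
| handle: "reduces (v @ w) c \<Longrightarrow> is_handle x \<Longrightarrow>
    reduces ((x, e) # v @ (x, \<not> e) # w) (- signed e (comm_exp v x) + c)"

text \<open>The exponents that the letters of X can produce. In the surface and punctured groups the
  neutral element stands in for an absent s, z or t, so independence can hold only on this subgroup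
  of the triples.\<close>

inductive_set weights :: "letter set \<Rightarrow> (int \<times> int \<times> int) set" for X where
  zero: "0 \<in> weights X"
| add: "c \<in> weights X \<Longrightarrow> d \<in> weights X \<Longrightarrow> c + d \<in> weights X"
| minus: "c \<in> weights X \<Longrightarrow> - c \<in> weights X"
| wt: "x \<in> X \<Longrightarrow> wt x \<in> weights X"
| comm_form: "x \<in> X \<Longrightarrow> y \<in> X \<Longrightarrow> comm_form x y \<in> weights X"

lemma signed_simps [simp]: "signed True c = c" "signed False c = - c"
  by (simp_all add: signed_def)

lemma weights_signed: "c \<in> weights X \<Longrightarrow> signed e c \<in> weights X"
  by (cases e) (auto intro: weights.minus)

lemma expo_append: "expo (v @ w) y = expo v y + expo w y"
  by (induction v) auto

lemma expo_neg: "expo w x < 0 \<Longrightarrow> (x, False) \<in> set w"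
  and expo_pos: "expo w x > 0 \<Longrightarrow> (x, True) \<in> set w"
  by (induction w) (auto simp: signed_def split: if_splits)

lemma expo_notin: "w \<in> words X \<Longrightarrow> x \<notin> X \<Longrightarrow> expo w x = 0"
  by (induction w) auto

text \<open>A leading handle letter has exponent sum zero in w, so its inverse occurs further right;
  removing the pair shortens w and keeps all exponent sums. A leading central letter is split
  off.\<close>

lemma reduces_exists:
  assumes "\<And>x. is_handle x \<Longrightarrow> expo w x = 0"
  shows "\<exists>c. reduces w c"
  using assms
proof (induction w rule: length_induct)
  case (1 w)
  show ?case
  proof (cases w)
    case Nil
    then show ?thesis using reduces.Nil by blast
  next
    case (Cons y v)
    obtain x e where y: "y = (x, e)" by fastforce
    show ?thesis
    proof (cases "is_handle x")
      case True
      then have "expo v x = - signed e 1"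
        using "1.prems"[OF True] by (simp add: Cons y)
      then have "(x, \<not> e) \<in> set v"
        by (cases e) (simp_all add: expo_neg expo_pos)
      then obtain v1 v2 where v: "v = v1 @ (x, \<not> e) # v2"
        by (meson split_list)
      have "expo (v1 @ v2) z = 0" if "is_handle z" for z
        using "1.prems"[OF that] by (cases e) (auto simp: Cons y v expo_append split: if_splits)
      moreover have "length (v1 @ v2) < length w"
        by (simp add: Cons v)
      ultimately obtain c where "reduces (v1 @ v2) c"
        using "1.IH" by blast
      then have "reduces w (- signed e (comm_exp v1 x) + c)"
        using reduces.handle[of v1 v2 c x e] True by (simp add: Cons y v)
      then show ?thesis by blast
    next
      case False
      then have "expo v z = 0" if "is_handle z" for z
        using "1.prems"[OF that] that by (auto simp: Cons y split: if_splits)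
      then obtain c where "reduces v c"
        using "1.IH" by (auto simp: Cons)
      then show ?thesis
        using reduces.central[of v c x e] False unfolding Cons y by blast
    qed
  qed
qed

lemma comm_exp_weights: "w \<in> words X \<Longrightarrow> y \<in> X \<Longrightarrow> comm_exp w y \<in> weights X"
proof (induction w)
  case (Cons a w)
  then show ?case
    by (cases a) (simp add: weights.add weights_signed weights.comm_form)
qed (simp add: weights.zero)

lemma reduces_weights: "reduces w c \<Longrightarrow> w \<in> words X \<Longrightarrow> c \<in> weights X"
proof (induction rule: reduces.induct)
  case (central w c x e)
  then show ?case
    by (simp add: weights.add weights_signed weights.wt)
next
  case (handle v w c x e)
  then have "c \<in> weights X" "- signed e (comm_exp v x) \<in> weights X"
    by (simp_all add: weights.minus weights_signed comm_exp_weights)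
  then show ?case
    by (metis weights.add)
qed (simp add: weights.zero)

lemma comm_form_not_handle:
  "\<not> is_handle x \<Longrightarrow> comm_form x y = 0" "\<not> is_handle x \<Longrightarrow> comm_form y x = 0"
proof -
  assume x: "\<not> is_handle x"
  then have "bform x y = 0" "bform y x = 0"
    by (cases x; simp add: bform_def zero_prod_def split: letter.split)+
  then show "comm_form x y = 0" "comm_form y x = 0"
    by (simp_all add: comm_form_def)
qed

text \<open>Nondegeneracy: every handle exponent is visible in the commutator with a partner letter.
  \<open>B i\<close> detects \<open>A i\<close>, \<open>Bt i\<close> detects \<open>At i\<close>,
  and conversely.\<close>

lemma comm_exp_handle:
  "comm_exp w (B i) = (2 * expo w (A i), expo w (At i), 0)"
  "comm_exp w (A i) = (- 2 * expo w (B i), - expo w (Bt i), 0)"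
  "comm_exp w (Bt i) = (0, expo w (A i), 2 * expo w (At i))"
  "comm_exp w (At i) = (0, - expo w (B i), - 2 * expo w (Bt i))"
proof -
  have forms: "comm_form x (B i) = (if A i = x then (2, 0, 0) else if At i = x then (0, 1, 0) else (0, 0, 0))"
    "comm_form x (A i) = (if B i = x then (-2, 0, 0) else if Bt i = x then (0, -1, 0) else (0, 0, 0))"
    "comm_form x (Bt i) = (if A i = x then (0, 1, 0) else if At i = x then (0, 0, 2) else (0, 0, 0))"
    "comm_form x (At i) = (if B i = x then (0, -1, 0) else if Bt i = x then (0, 0, -2) else (0, 0, 0))"
    for x
    by (auto simp: comm_form_def bform_def zero_prod_def split: letter.split)
  show "comm_exp w (B i) = (2 * expo w (A i), expo w (At i), 0)"
    by (induction w) (auto simp: zero_prod_def signed_def forms)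
  show "comm_exp w (A i) = (- 2 * expo w (B i), - expo w (Bt i), 0)"
    by (induction w) (auto simp: zero_prod_def signed_def forms)
  show "comm_exp w (Bt i) = (0, expo w (A i), 2 * expo w (At i))"
    by (induction w) (auto simp: zero_prod_def signed_def forms)
  show "comm_exp w (At i) = (0, - expo w (B i), - 2 * expo w (Bt i))"
    by (induction w) (auto simp: zero_prod_def signed_def forms)
qed

section \<open>Evaluation of words when s, z and t are central\<close>

lemma (in group) int_pow_commute:
  assumes "a \<in> carrier G" "b \<in> carrier G" "a \<otimes> b = b \<otimes> a"
  shows "a [^] (p :: int) \<otimes> b = b \<otimes> a [^] p"
proof -
  \<comment> \<open>The centraliser of b is a subgroup, hence closed under integer powers.\<close>
  have "subgroup {c \<in> carrier G. c \<otimes> b = b \<otimes> c} G"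
  proof
    fix x assume x: "x \<in> {c \<in> carrier G. c \<otimes> b = b \<otimes> c}"
    then have c: "x \<in> carrier G" and xb: "b \<otimes> x = x \<otimes> b" by auto
    have "inv x \<otimes> b = inv x \<otimes> (b \<otimes> x) \<otimes> inv x"
      using c assms(2) by (simp add: m_assoc)
    also have "\<dots> = b \<otimes> inv x"
      using c assms(2) by (simp add: xb)
    finally show "inv x \<in> {c \<in> carrier G. c \<otimes> b = b \<otimes> c}"
      using c by simp
  next
    fix x y assume "x \<in> {c \<in> carrier G. c \<otimes> b = b \<otimes> c}" "y \<in> {c \<in> carrier G. c \<otimes> b = b \<otimes> c}"
    then have c: "x \<in> carrier G" "y \<in> carrier G" and xb: "x \<otimes> b = b \<otimes> x" "y \<otimes> b = b \<otimes> y" by auto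
    have "x \<otimes> y \<otimes> b = (x \<otimes> b) \<otimes> y"
      using c assms(2) by (simp add: xb(2) m_assoc)
    also have "\<dots> = b \<otimes> (x \<otimes> y)"
      using c assms(2) by (simp add: xb(1) m_assoc)
    finally show "x \<otimes> y \<in> {c \<in> carrier G. c \<otimes> b = b \<otimes> c}"
      using c by simp
  qed (use assms in auto)
  then have "a [^] p \<in> {c \<in> carrier G. c \<otimes> b = b \<otimes> c}"
    using assms by (intro subgroup_int_pow_closed) auto
  then show ?thesis by simp
qed

definition kap :: "('a, 'm) monoid_scheme \<Rightarrow> 'a \<Rightarrow> 'a \<Rightarrow> 'a \<Rightarrow> int \<times> int \<times> int \<Rightarrow> 'a" where
  "kap H s z t c = s [^]\<^bsub>H\<^esub> fst c \<otimes>\<^bsub>H\<^esub> (z [^]\<^bsub>H\<^esub> fst (snd c) \<otimes>\<^bsub>H\<^esub> t [^]\<^bsub>H\<^esub> snd (snd c))"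

locale central_triple = group H for H (structure) +
  fixes s z t
  assumes stz_closed [simp]: "s \<in> carrier H" "z \<in> carrier H" "t \<in> carrier H"
    and stz_comm: "s \<otimes> z = z \<otimes> s" "s \<otimes> t = t \<otimes> s" "z \<otimes> t = t \<otimes> z"
begin

abbreviation "\<kappa> \<equiv> kap H s z t"

lemma kap_closed [simp]: "\<kappa> c \<in> carrier H"
  by (simp add: kap_def)

lemma kap_zero [simp]: "\<kappa> 0 = \<one>"
  by (simp add: kap_def)

lemma kap_add: "\<kappa> (c + d) = \<kappa> c \<otimes> \<kappa> d"
proof -
  have pows: "s [^] p \<otimes> z [^] q = z [^] q \<otimes> s [^] p" "s [^] p \<otimes> t [^] q = t [^] q \<otimes> s [^] p"
    "z [^] p \<otimes> t [^] q = t [^] q \<otimes> z [^] p" for p q :: int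
    using stz_comm by (auto intro!: int_pow_commute int_pow_commute[symmetric])
  then have pows': "z [^] q \<otimes> (s [^] p \<otimes> a) = s [^] p \<otimes> (z [^] q \<otimes> a)"
    "t [^] q \<otimes> (s [^] p \<otimes> a) = s [^] p \<otimes> (t [^] q \<otimes> a)"
    "t [^] q \<otimes> (z [^] p \<otimes> a) = z [^] p \<otimes> (t [^] q \<otimes> a)" if "a \<in> carrier H" for p q :: int and a
    using that by (simp_all flip: m_assoc)
  show ?thesis
    by (simp add: kap_def int_pow_mult m_assoc pows')
qed

lemma kap_minus: "\<kappa> (- c) = inv \<kappa> c"
proof -
  have "\<kappa> (- c) \<otimes> \<kappa> c = \<one>"
    using kap_add[of "- c" c] by simp
  then show ?thesis
    using inv_equality by (metis kap_closed)
qed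

end

text \<open>The situation after the collapse. Commutation with s, z, t is demanded only of the
  values of letters in X, because H may be larger than the subgroup they generate, as for disc
  letters sent to a surface quotient.\<close>

locale central_rep = central_triple H s z t for H (structure) and s z t +
  fixes X :: "letter set" and f
  assumes f_closed: "f \<in> X \<rightarrow> carrier H"
    and stz_central: "x \<in> X \<Longrightarrow> c \<in> {s, z, t} \<Longrightarrow> c \<otimes> f x = f x \<otimes> c"
    and f_central: "x \<in> X \<Longrightarrow> \<not> is_handle x \<Longrightarrow> f x = \<kappa> (wt x)"
    and f_handle: "x \<in> X \<Longrightarrow> y \<in> X \<Longrightarrow> is_handle x \<Longrightarrow> is_handle y \<Longrightarrow>
      f x \<otimes> f y = \<kappa> (comm_form x y) \<otimes> (f y \<otimes> f x)"
begin

lemma f_mem_carrier [simp]: "x \<in> X \<Longrightarrow> f x \<in> carrier H"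
  using f_closed by auto

lemma weval_f_closed [simp]: "w \<in> words X \<Longrightarrow> weval H f w \<in> carrier H"
  using weval_closed[OF is_group f_closed] .

lemma kap_commute_f:
  assumes "x \<in> X" shows "\<kappa> c \<otimes> f x = f x \<otimes> \<kappa> c"
proof -
  have *: "a [^] p \<otimes> f x = f x \<otimes> a [^] p" if "a \<in> {s, z, t}" for a and p :: int
    using that assms stz_central[OF assms that] by (intro int_pow_commute) auto
  have "a [^] p \<otimes> (f x \<otimes> b) = f x \<otimes> (a [^] p \<otimes> b)"
    if "a \<in> {s, z, t}" "b \<in> carrier H" for a b and p :: int
    using that assms *[OF that(1), of p] by (auto simp flip: m_assoc)
  with * show ?thesis
    using assms by (simp add: kap_def m_assoc)
qed

lemma f_commute:
  assumes "x \<in> X" "y \<in> X"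
  shows "f x \<otimes> f y = \<kappa> (comm_form x y) \<otimes> (f y \<otimes> f x)"
proof -
  consider "is_handle x" "is_handle y" | "\<not> is_handle x" | "\<not> is_handle y" by blast
  then show ?thesis
  proof cases
    case 1
    with assms show ?thesis by (rule f_handle)
  next
    case 2
    then have "comm_form x y = 0"
      by (simp add: comm_form_not_handle)
    with assms show ?thesis
      using kap_commute_f[of y "wt x"] by (simp add: f_central[OF _ 2])
  next
    case 3
    then have "comm_form x y = 0"
      by (simp add: comm_form_not_handle)
    with assms show ?thesis
      using kap_commute_f[of x "wt y"] by (simp add: f_central[OF _ 3])
  qed
qed

definition letter_val :: "letter \<Rightarrow> bool \<Rightarrow> 'a" where
  "letter_val x e = (if e then f x else inv f x)"

lemma letter_val_closed [simp]: "x \<in> X \<Longrightarrow> letter_val x e \<in> carrier H"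
  by (simp add: letter_val_def)

lemma weval_letter: "weval H f ((x, e) # w) = letter_val x e \<otimes> weval H f w"
  by (simp add: letter_val_def)

lemma letter_val_cancel [simp]: "x \<in> X \<Longrightarrow> letter_val x e \<otimes> letter_val x (\<not> e) = \<one>"
  by (simp add: letter_val_def)

lemma kap_commute_letter:
  assumes "x \<in> X" shows "\<kappa> c \<otimes> letter_val x e = letter_val x e \<otimes> \<kappa> c"
proof (cases e)
  case False
  have "inv f x \<otimes> (\<kappa> c \<otimes> f x) \<otimes> inv f x = \<kappa> c \<otimes> inv f x"
    using assms by (simp add: kap_commute_f)
  then show ?thesis
    using False assms by (simp add: letter_val_def m_assoc)
qed (use kap_commute_f[OF assms] in \<open>simp add: letter_val_def\<close>)

lemma letter_kap_left:
  assumes "x \<in> X" "a \<in> carrier H"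
  shows "letter_val x e \<otimes> (\<kappa> c \<otimes> a) = \<kappa> c \<otimes> (letter_val x e \<otimes> a)"
  using assms kap_commute_letter[of x c e] by (simp flip: m_assoc)

lemma letter_commute:
  assumes "x \<in> X" "y \<in> X"
  shows "letter_val x e \<otimes> f y = \<kappa> (signed e (comm_form x y)) \<otimes> (f y \<otimes> letter_val x e)"
proof (cases e)
  case False
  let ?k = "\<kappa> (comm_form x y)"
  have "inv f x \<otimes> f y = inv ?k \<otimes> (?k \<otimes> (inv f x \<otimes> f y))"
    using assms by simp
  also have "?k \<otimes> (inv f x \<otimes> f y) = inv f x \<otimes> (?k \<otimes> (f y \<otimes> f x)) \<otimes> inv f x"
    using assms letter_kap_left[of x _ False "comm_form x y"]
    by (simp add: m_assoc letter_val_def)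
  also have "\<dots> = f y \<otimes> inv f x"
    using assms by (simp add: m_assoc flip: f_commute)
  finally show ?thesis
    using False by (simp add: letter_val_def kap_minus)
qed (use f_commute[OF assms] in \<open>simp add: letter_val_def\<close>)

lemma weval_commute:
  assumes "w \<in> words X" "y \<in> X"
  shows "weval H f w \<otimes> f y = \<kappa> (comm_exp w y) \<otimes> (f y \<otimes> weval H f w)"
  using assms(1)
proof (induction w)
  case Nil
  then show ?case using assms by simp
next
  case (Cons a w)
  obtain x e where a: "a = (x, e)" by fastforce
  have x: "x \<in> X" and w: "w \<in> words X" using Cons.prems by (auto simp: a)
  let ?l = "letter_val x e" and ?c = "comm_exp w y" and ?d = "signed e (comm_form x y)"
  have "weval H f (a # w) \<otimes> f y = ?l \<otimes> (\<kappa> ?c \<otimes> (f y \<otimes> weval H f w))"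
    using x w assms(2) Cons.IH[OF w] by (simp add: a weval_letter m_assoc del: weval_Cons)
  also have "\<dots> = \<kappa> ?c \<otimes> ((?l \<otimes> f y) \<otimes> weval H f w)"
    using x w assms(2) by (simp add: letter_kap_left m_assoc)
  also have "\<dots> = \<kappa> ?c \<otimes> (\<kappa> ?d \<otimes> (f y \<otimes> ?l) \<otimes> weval H f w)"
    using x w assms(2) letter_commute[of x y e] by simp
  also have "\<dots> = \<kappa> (?d + ?c) \<otimes> (f y \<otimes> weval H f (a # w))"
    using x w assms(2) by (simp add: a weval_letter m_assoc kap_add add.commute[of ?d] del: weval_Cons)
  finally show ?case by (simp add: a)
qed

text \<open>Conjugation by a letter changes a word only by a central factor. This allows a pair of
  opposite letters to be cancelled across a word, and later a tilde letter to be moved past a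
  punctured word.\<close>

lemma weval_conj:
  assumes "w \<in> words X" "x \<in> X"
  shows "letter_val x e \<otimes> (weval H f w \<otimes> letter_val x (\<not> e)) = \<kappa> (- signed e (comm_exp w x)) \<otimes> weval H f w"
proof (cases e)
  case True
  let ?k = "\<kappa> (comm_exp w x)" and ?w = "weval H f w"
  have "f x \<otimes> (?w \<otimes> inv f x) = inv ?k \<otimes> (?k \<otimes> (f x \<otimes> ?w)) \<otimes> inv f x"
    using assms by (simp add: m_assoc)
  also have "\<dots> = inv ?k \<otimes> (?w \<otimes> f x) \<otimes> inv f x"
    using weval_commute[OF assms] by simp
  also have "\<dots> = inv ?k \<otimes> ?w"
    using assms by (simp add: m_assoc)
  finally show ?thesis
    using True by (simp add: letter_val_def kap_minus)
next
  case False
  have "inv f x \<otimes> (weval H f w \<otimes> f x) = (inv f x \<otimes> \<kappa> (comm_exp w x)) \<otimes> (f x \<otimes> weval H f w)"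
    using assms weval_commute[OF assms] by (simp add: m_assoc)
  also have "\<dots> = \<kappa> (comm_exp w x) \<otimes> weval H f w"
    using assms letter_kap_left[of x _ False] by (simp add: letter_val_def m_assoc)
  finally show ?thesis
    using False by (simp add: letter_val_def)
qed

text \<open>The exponent c is computed without reference to H, so the same c gives the value of w in
  every such group. This is what carries information from one quotient to another.\<close>

lemma weval_reduces:
  assumes "reduces w c" "w \<in> words X"
  shows "weval H f w = \<kappa> c"
  using assms
proof (induction rule: reduces.induct)
  case (central w c x e)
  then have x: "x \<in> X" "w \<in> words X" by auto
  have "letter_val x e = \<kappa> (signed e (wt x))"
    using x f_central central.hyps by (cases e) (simp_all add: letter_val_def kap_minus)
  then show ?case
    using central x by (simp add: weval_letter kap_add del: weval_Cons)
next
  case (handle v w c x e)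
  then have x: "x \<in> X" "w \<in> words X" "v \<in> words X" by auto
  have "weval H f ((x, e) # v @ (x, \<not> e) # w)
      = letter_val x e \<otimes> (weval H f v \<otimes> letter_val x (\<not> e)) \<otimes> weval H f w"
    using x weval_append[OF is_group f_closed] by (simp add: weval_letter m_assoc del: weval_Cons)
  also have "\<dots> = \<kappa> (- signed e (comm_exp v x)) \<otimes> weval H f (v @ w)"
    using x weval_append[OF is_group f_closed] by (simp add: weval_conj m_assoc)
  also have "\<dots> = \<kappa> (- signed e (comm_exp v x) + c)"
    using handle x by (simp only: kap_add) simp
  finally show ?case .
qed simp

end

text \<open>The exponent of a handle letter is detected through its partner in
  \<open>comm_exp_handle\<close>, so the partner has to belong to X as well.\<close>

definition paired :: "letter set \<Rightarrow> bool" where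
  "paired X \<longleftrightarrow> (\<forall>i. (A i \<in> X \<longleftrightarrow> B i \<in> X) \<and> (At i \<in> X \<longleftrightarrow> Bt i \<in> X))"

text \<open>The form \<open>comm_form\<close> is nondegenerate on the handle letters, so a word that dies in the
  first group has vanishing handle exponents, hence is central with an exponent read off
  from the word alone.\<close>

lemma central_rep_kernel:
  assumes "central_rep H s z t X f" "central_rep H' s' z' t' X f'" "paired X"
    and inj: "\<And>c. c \<in> weights X \<Longrightarrow> kap H s z t c = \<one>\<^bsub>H\<^esub> \<Longrightarrow> c = 0"
    and w: "w \<in> words X" "weval H f w = \<one>\<^bsub>H\<^esub>"
  shows "weval H' f' w = \<one>\<^bsub>H'\<^esub>"
proof -
  interpret R: central_rep H s z t X f by fact
  interpret R': central_rep H' s' z' t' X f' by fact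
  \<comment> \<open>A word with trivial value commutes with \<open>f y\<close>, so the central
    factor in \<open>weval_commute\<close> is trivial; independence then applies to its
    exponent.\<close>
  have comm0: "comm_exp w y = (0, 0, 0)" if "y \<in> X" for y
  proof -
    have "R.\<kappa> (comm_exp w y) = \<one>\<^bsub>H\<^esub>"
      using R.weval_commute[OF w(1) that] w(2) that by (simp add: R.r_cancel_one)
    then show ?thesis
      using inj comm_exp_weights[OF w(1) that] by (simp add: zero_prod_def)
  qed
  have "expo w x = 0" if "is_handle x" for x
  proof (cases "x \<in> X")
    case True
    have pair: "A i \<in> X \<longleftrightarrow> B i \<in> X" "At i \<in> X \<longleftrightarrow> Bt i \<in> X" for i
      using \<open>paired X\<close> by (simp_all add: paired_def)
    show ?thesis
    proof (cases x)
      case (A i)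
      then show ?thesis using True comm0[of "B i"] pair by (simp add: comm_exp_handle)
    next
      case (B i)
      then show ?thesis using True comm0[of "A i"] pair by (simp add: comm_exp_handle)
    next
      case (At i)
      then show ?thesis using True comm0[of "Bt i"] pair by (simp add: comm_exp_handle)
    next
      case (Bt i)
      then show ?thesis using True comm0[of "At i"] pair by (simp add: comm_exp_handle)
    qed (use that in simp_all)
  qed (use w expo_notin in auto)
  then obtain c where c: "reduces w c"
    using reduces_exists by blast
  \<comment> \<open>Independence is used a second time, now for the value of w itself.\<close>
  then have "c = 0"
    using R.weval_reduces[OF c w(1)] w inj reduces_weights by simp
  then show ?thesis
    using R'.weval_reduces[OF c w(1)] by simp
qed

section \<open>Consequences of the braid relations\<close>

lemma braid_rels_words:
  assumes "(u, v) \<in> braid_rels s a b m g p"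
  shows "u \<in> words (sigmas s m \<union> handles a b g \<union> zetas p)"
    and "v \<in> words (sigmas s m \<union> handles a b g \<union> zetas p)"
  using assms
  by (cases rule: braid_rels.cases;
      force simp: pos_def wconj_def winv_def sigmas_def handles_def zetas_def)+

lemma mixed_rels_words:
  assumes "(u, v) \<in> mixed_rels g k n"
  shows "u \<in> words (fst (mixed_pres g k n))" and "v \<in> words (fst (mixed_pres g k n))"
  using assms
  by (cases rule: mixed_rels.cases;
      force simp: pos_def wconj_def winv_def wcomm_def sigmas_def handles_def zetas_def
        mixed_pres_def punctured_pres_def surface_pres_def)+

lemma fst_pres:
  "fst (punctured_pres g k n) = sigmas S k \<union> handles A B g \<union> zetas n"
  "fst (surface_pres g n) = sigmas St n \<union> handles At Bt g"
  "fst (mixed_pres g k n) = sigmas S k \<union> handles A B g \<union> zetas n \<union> (sigmas St n \<union> handles At Bt g)"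
  by (simp_all add: punctured_pres_def surface_pres_def mixed_pres_def)

lemma snd_pres:
  "snd (punctured_pres g k n) = braid_rels S A B k g n"
  "snd (surface_pres g n) = braid_rels St At Bt n g 0"
  "snd (mixed_pres g k n) = braid_rels S A B k g n \<union> braid_rels St At Bt n g 0 \<union> mixed_rels g k n"
  by (simp_all add: punctured_pres_def surface_pres_def mixed_pres_def)

lemma pres_words:
  "(u, v) \<in> snd (punctured_pres g k n) \<Longrightarrow>
     u \<in> words (fst (punctured_pres g k n)) \<and> v \<in> words (fst (punctured_pres g k n))"
  "(u, v) \<in> snd (surface_pres g n) \<Longrightarrow>
     u \<in> words (fst (surface_pres g n)) \<and> v \<in> words (fst (surface_pres g n))"
  "(u, v) \<in> snd (mixed_pres g k n) \<Longrightarrow>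
     u \<in> words (fst (mixed_pres g k n)) \<and> v \<in> words (fst (mixed_pres g k n))"
proof -
  have mono: "w \<in> words X \<Longrightarrow> X \<subseteq> Y \<Longrightarrow> w \<in> words Y" for w :: "letter word" and X Y
    by (auto simp: words_def)
  show "(u, v) \<in> snd (punctured_pres g k n) \<Longrightarrow>
     u \<in> words (fst (punctured_pres g k n)) \<and> v \<in> words (fst (punctured_pres g k n))"
    using braid_rels_words by (auto simp: fst_pres snd_pres)
  show "(u, v) \<in> snd (surface_pres g n) \<Longrightarrow>
     u \<in> words (fst (surface_pres g n)) \<and> v \<in> words (fst (surface_pres g n))"
    using braid_rels_words[of u v St At Bt n g 0] by (auto simp: fst_pres snd_pres zetas_def)
  show "(u, v) \<in> snd (mixed_pres g k n) \<Longrightarrow>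
     u \<in> words (fst (mixed_pres g k n)) \<and> v \<in> words (fst (mixed_pres g k n))"
    using mixed_rels_words[of u v g k n] braid_rels_words[of u v S A B k g n]
      braid_rels_words[of u v St At Bt n g 0]
    by (auto simp: fst_pres snd_pres zetas_def intro: mono)
qed

lemma braid_rels_genus_mono: "braid_rels s a b m 0 p \<subseteq> braid_rels s a b m g p"
proof (rule subrelI)
  fix u v assume "(u, v) \<in> braid_rels s a b m 0 p"
  then show "(u, v) \<in> braid_rels s a b m g p"
    by (cases rule: braid_rels.cases)
      (auto simp: handles_def zetas_def simp del: One_nat_def intro: braid_rels.intros)
qed

lemma mixed_rels_genus_mono: "mixed_rels 0 k n \<subseteq> mixed_rels g k n"
proof (rule subrelI)
  fix u v assume "(u, v) \<in> mixed_rels 0 k n"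
  then show "(u, v) \<in> mixed_rels g k n"
    by (cases rule: mixed_rels.cases)
      (auto simp: handles_def zetas_def simp del: One_nat_def intro: mixed_rels.intros)
qed

text \<open>The letter families stay abstract so that plain and tilde generators share one argument;
  \<sigma> is the common value of the Artin generators.\<close>

locale collapsed_braid = group H for H (structure) +
  fixes f :: "letter \<Rightarrow> 'a" and s a b :: "nat \<Rightarrow> letter" and m g p :: nat and \<sigma> :: 'a
  assumes rels: "(u, v) \<in> braid_rels s a b m g p \<Longrightarrow> weval H f u = weval H f v"
    and closed: "f \<in> sigmas s m \<union> handles a b g \<union> zetas p \<rightarrow> carrier H"
    and m: "m \<ge> 3"
    and sigma: "i \<in> {1..<m} \<Longrightarrow> f (s i) = \<sigma>"
begin

lemma sigma_closed [simp]: "\<sigma> \<in> carrier H"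
proof -
  have "f (s 1) \<in> carrier H"
    using closed m by (force simp: sigmas_def)
  then show ?thesis using sigma[of 1] m by simp
qed

lemma letter_closed [simp]: "c \<in> handles a b g \<Longrightarrow> f c \<in> carrier H" "i \<in> {1..p} \<Longrightarrow> f (Zeta i) \<in> carrier H"
  "c \<in> zetas p \<Longrightarrow> f c \<in> carrier H"
  using closed by (auto simp: zetas_def)

lemma handle_closed [simp]: "i \<in> {1..g} \<Longrightarrow> f (a i) \<in> carrier H" "i \<in> {1..g} \<Longrightarrow> f (b i) \<in> carrier H"
  by (auto simp: handles_def)

text \<open>The relations let c commute with \<open>s i\<close> only for i different from 1. The
  third strand provides \<open>s 2\<close>, whose value is the same \<sigma>.\<close>

lemma sigma_commute: "c \<in> handles a b g \<union> zetas p \<Longrightarrow> \<sigma> \<otimes> f c = f c \<otimes> \<sigma>"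
  using rels[OF braid_rels.sigma_comm[of c a b g p 2 m s]] sigma[of 2] m closed
  by (auto simp: pos_def)

lemma sigma_conj: "c \<in> handles a b g \<union> zetas p \<Longrightarrow> inv \<sigma> \<otimes> (f c \<otimes> \<sigma>) = f c"
  using sigma_commute[of c] closed by (auto simp flip: sigma_commute)

text \<open>Source of the exponent 2: in a s b = s b s a s, once s commutes with a and b, one of the
  three s on the right cancels and two remain.\<close>

lemma handle_commutator:
  assumes "i \<in> {1..g}"
  shows "f (a i) \<otimes> f (b i) = \<sigma> \<otimes> \<sigma> \<otimes> (f (b i) \<otimes> f (a i))"
proof -
  have i: "a i \<in> handles a b g" "b i \<in> handles a b g"
    using assms by (auto simp: handles_def)
  have sf: "\<sigma> \<otimes> f (a i) = f (a i) \<otimes> \<sigma>" "\<sigma> \<otimes> f (b i) = f (b i) \<otimes> \<sigma>"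
    using sigma_commute i by auto
  then have sf': "\<sigma> \<otimes> (f (a i) \<otimes> x) = f (a i) \<otimes> (\<sigma> \<otimes> x)" "\<sigma> \<otimes> (f (b i) \<otimes> x) = f (b i) \<otimes> (\<sigma> \<otimes> x)"
    if "x \<in> carrier H" for x
    using that i by (simp_all flip: m_assoc)
  have "f (a i) \<otimes> (\<sigma> \<otimes> f (b i)) = \<sigma> \<otimes> (f (b i) \<otimes> (\<sigma> \<otimes> (f (a i) \<otimes> \<sigma>)))"
    using rels[OF braid_rels.handle[OF assms]] sigma[of 1] m i by (simp add: pos_def)
  then have "(f (a i) \<otimes> f (b i)) \<otimes> \<sigma> = (f (b i) \<otimes> (f (a i) \<otimes> (\<sigma> \<otimes> \<sigma>))) \<otimes> \<sigma>"
    using i by (simp add: sf sf' m_assoc)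
  then have "f (a i) \<otimes> f (b i) = f (b i) \<otimes> (f (a i) \<otimes> (\<sigma> \<otimes> \<sigma>))"
    using i by simp
  then show ?thesis
    using i by (simp add: sf sf' m_assoc)
qed

text \<open>Conjugation by \<sigma> is trivial on handle values, so the relation for the conjugate
  of c becomes plain commutation. It is given for i < j; exchanging c and d covers i > j.\<close>

lemma handles_commute:
  assumes "i \<in> {1..g}" "j \<in> {1..g}" "i \<noteq> j" "c \<in> {a i, b i}" "d \<in> {a j, b j}"
  shows "f c \<otimes> f d = f d \<otimes> f c"
proof -
  have *: "f c \<otimes> f d = f d \<otimes> f c"
    if "i < j" "c \<in> {a i, b i}" "d \<in> {a j, b j}" "i \<in> {1..g}" "j \<in> {1..g}" for i j c d
  proof -
    have cd: "c \<in> handles a b g" "d \<in> handles a b g"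
      using that by (auto simp: handles_def)
    have "(inv \<sigma> \<otimes> (f c \<otimes> \<sigma>)) \<otimes> f d = f d \<otimes> (inv \<sigma> \<otimes> (f c \<otimes> \<sigma>))"
      using rels[OF braid_rels.handles_comm[of i g j c a b d m s p]] that m sigma[of 1] cd
      by (simp add: pos_def wconj_def winv_def m_assoc)
    then show ?thesis
      using cd by (simp add: sigma_conj)
  qed
  show ?thesis
    using *[of i j c d] *[of j i d c] assms by (metis nat_neq_iff)
qed

lemma zeta_handle_commute:
  assumes "i \<in> {1..p}" "c \<in> handles a b g"
  shows "f (Zeta i) \<otimes> f c = f c \<otimes> f (Zeta i)"
proof -
  have "(inv \<sigma> \<otimes> (f (Zeta i) \<otimes> \<sigma>)) \<otimes> f c = f c \<otimes> (inv \<sigma> \<otimes> (f (Zeta i) \<otimes> \<sigma>))"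
    using rels[OF braid_rels.zeta_handle_comm[of i p c a b g m s]] assms m sigma[of 1]
    by (simp add: pos_def wconj_def winv_def m_assoc)
  then show ?thesis
    using assms by (simp add: sigma_conj zetas_def)
qed

end

context central_triple
begin

definition twisted :: "int \<times> int \<times> int \<Rightarrow> 'a \<Rightarrow> 'a \<Rightarrow> bool" where
  "twisted c x y \<longleftrightarrow> x \<otimes> y = \<kappa> c \<otimes> (y \<otimes> x)"

lemma twisted_swap:
  assumes "twisted c x y" "x \<in> carrier H" "y \<in> carrier H"
  shows "twisted (- c) y x"
  using assms by (simp add: twisted_def kap_minus)

lemma kap_simps:
  "\<kappa> (0, 0, 0) = \<one>" "\<kappa> (2, 0, 0) = s \<otimes> s" "\<kappa> (0, 1, 0) = z" "\<kappa> (0, 0, 2) = t \<otimes> t"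
  "\<kappa> (1, 0, 0) = s" "\<kappa> (0, 0, 1) = t" "\<kappa> (0, -1, 0) = inv z"
proof -
  have "x [^] (2 :: int) = x \<otimes> x" if "x \<in> carrier H" for x
    using int_pow_mult[OF that, of 1 1] that by simp
  moreover have "x [^] (- 1 :: int) = inv x" if "x \<in> carrier H" for x
    using int_pow_neg[OF that, of 1] that by simp
  ultimately show "\<kappa> (0, 0, 0) = \<one>" "\<kappa> (2, 0, 0) = s \<otimes> s" "\<kappa> (0, 1, 0) = z" "\<kappa> (0, 0, 2) = t \<otimes> t"
    "\<kappa> (1, 0, 0) = s" "\<kappa> (0, 0, 1) = t" "\<kappa> (0, -1, 0) = inv z"
    by (simp_all add: kap_def)
qed

end

lemma comm_form_antisym: "comm_form y x = - comm_form x y"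
  by (simp add: comm_form_def)

lemma comm_form_simps:
  "comm_form (A i) (B j) = (if i = j then (2, 0, 0) else 0)"
  "comm_form (At i) (Bt j) = (if i = j then (0, 0, 2) else 0)"
  "comm_form (At i) (B j) = (if i = j then (0, 1, 0) else 0)"
  "comm_form (Bt i) (A j) = (if i = j then (0, -1, 0) else 0)"
  "comm_form (A i) (A j) = 0" "comm_form (B i) (B j) = 0"
  "comm_form (At i) (At j) = 0" "comm_form (Bt i) (Bt j) = 0"
  "comm_form (At i) (A j) = 0" "comm_form (Bt i) (B j) = 0"
  by (auto simp: comm_form_def bform_def zero_prod_def)

context central_triple
begin

lemma twisted_zero [simp]: "x \<in> carrier H \<Longrightarrow> y \<in> carrier H \<Longrightarrow> twisted 0 x y \<longleftrightarrow> x \<otimes> y = y \<otimes> x"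
  by (simp add: twisted_def)

text \<open>Applied with c = (2, 0, 0) to the plain handles, where \<sigma> is s, and with c = (0,
  0, 2) to the tilde handles, where \<sigma> is t.\<close>

lemma collapsed_twisted:
  assumes "collapsed_braid H f sg a b m g p \<sigma>" and c: "\<kappa> c = \<sigma> \<otimes> \<sigma>"
    and form: "\<And>i j. comm_form (a i) (b j) = (if i = j then c else 0)"
      "\<And>i j. comm_form (a i) (a j) = 0" "\<And>i j. comm_form (b i) (b j) = 0"
    and xy: "x \<in> handles a b g" "y \<in> handles a b g"
  shows "twisted (comm_form x y) (f x) (f y)"
proof -
  interpret collapsed_braid H f sg a b m g p \<sigma> by fact
  have ab: "twisted (comm_form (a i) (b j)) (f (a i)) (f (b j))" if "i \<in> {1..g}" "j \<in> {1..g}" for i j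
  proof (cases "i = j")
    case True
    then show ?thesis
      using handle_commutator that by (simp add: twisted_def form c)
  next
    case False
    then show ?thesis
      using handles_commute[of i j "a i" "b j"] that by (simp add: form)
  qed
  have ba: "twisted (comm_form (b j) (a i)) (f (b j)) (f (a i))" if "i \<in> {1..g}" "j \<in> {1..g}" for i j
    using twisted_swap[OF ab[OF that]] that by (simp add: comm_form_antisym[of "b j"])
  have same: "f (a i) \<otimes> f (a j) = f (a j) \<otimes> f (a i)" "f (b i) \<otimes> f (b j) = f (b j) \<otimes> f (b i)"
    if "i \<in> {1..g}" "j \<in> {1..g}" for i j
    using handles_commute[of i j "a i" "a j"] handles_commute[of i j "b i" "b j"] that
    by (cases "i = j"; simp)+
  from xy obtain i j where "i \<in> {1..g}" "j \<in> {1..g}" "x = a i \<or> x = b i" "y = a j \<or> y = b j"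
    by (auto simp: handles_def)
  then show ?thesis
    using ab ba same by (auto simp: form)
qed

end

section \<open>The three presentations after the collapse\<close>

text \<open>Without tilde letters no relation conjugates one \<open>Zeta i\<close> into another, so
  their common value is a hypothesis. The slot of t holds the neutral element.\<close>

lemma (in group) punctured_central_rep:
  assumes f: "f \<in> fst (punctured_pres g k n) \<rightarrow> carrier G"
    and rels: "\<And>u v. (u, v) \<in> snd (punctured_pres g k n) \<Longrightarrow> weval G f u = weval G f v"
    and kn: "k \<ge> 3" "n \<ge> 1"
    and S: "\<And>i. i \<in> {1..<k} \<Longrightarrow> f (S i) = s"
    and Z: "\<And>i. i \<in> {1..n} \<Longrightarrow> f (Zeta i) = z"
  shows "central_rep G (s) (z) \<one> (fst (punctured_pres g k n)) f"
proof -
  interpret b: collapsed_braid G f S A B k g n "s"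
    using f rels S kn by unfold_locales (auto simp: fst_pres snd_pres)
  have Z1: "z \<in> carrier G"
    using kn Z[of 1] f by (auto simp: fst_pres zetas_def)
  have sz: "s \<otimes> z = z \<otimes> s"
    using b.sigma_commute[of "Zeta 1"] kn Z[of 1] by (simp add: zetas_def)
  interpret c: central_triple G "s" "z" "\<one>"
    using Z1 sz by unfold_locales simp_all
  show ?thesis
  proof
    show "f \<in> fst (punctured_pres g k n) \<rightarrow> carrier G" by fact
  next
    fix x c assume x: "x \<in> fst (punctured_pres g k n)" and c: "c \<in> {s, z, \<one>}"
    have "f x \<in> carrier G" using f x by auto
    moreover have "s \<otimes> f x = f x \<otimes> s"
      using x S b.sigma_commute[of x] by (auto simp: fst_pres sigmas_def)
    moreover have "z \<otimes> f x = f x \<otimes> z"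
      using x S Z[of 1] Z sz b.zeta_handle_commute[of 1 x] kn by (auto simp: fst_pres sigmas_def zetas_def)
    ultimately show "c \<otimes> f x = f x \<otimes> c"
      using c by auto
  next
    fix x assume "x \<in> fst (punctured_pres g k n)" "\<not> is_handle x"
    then show "f x = c.\<kappa> (wt x)"
      using S Z by (auto simp: fst_pres sigmas_def zetas_def handles_def wt_def c.kap_simps)
  next
    fix x y assume "x \<in> fst (punctured_pres g k n)" "y \<in> fst (punctured_pres g k n)" "is_handle x" "is_handle y"
    then have "x \<in> handles A B g" "y \<in> handles A B g"
      by (auto simp: fst_pres sigmas_def zetas_def)
    then have "c.twisted (comm_form x y) (f x) (f y)"
      using c.kap_simps by (intro c.collapsed_twisted[OF b.collapsed_braid_axioms]) (auto simp: comm_form_simps)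
    then show "f x \<otimes> f y = c.\<kappa> (comm_form x y) \<otimes> (f y \<otimes> f x)"
      by (simp add: c.twisted_def)
  qed
qed

text \<open>Only tilde letters occur, so the slots of s and z hold the neutral element.\<close>

lemma (in group) surface_central_rep:
  assumes f: "f \<in> fst (surface_pres g n) \<rightarrow> carrier G"
    and rels: "\<And>u v. (u, v) \<in> snd (surface_pres g n) \<Longrightarrow> weval G f u = weval G f v"
    and n: "n \<ge> 3"
    and St: "\<And>i. i \<in> {1..<n} \<Longrightarrow> f (St i) = t"
  shows "central_rep G \<one> \<one> (t) (fst (surface_pres g n)) f"
proof -
  interpret b: collapsed_braid G f St At Bt n g 0 "t"
    using f rels St n by unfold_locales (auto simp: fst_pres snd_pres zetas_def)
  interpret c: central_triple G "\<one>" "\<one>" "t"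
    by unfold_locales simp_all
  show ?thesis
  proof
    show "f \<in> fst (surface_pres g n) \<rightarrow> carrier G" by fact
  next
    fix x c assume x: "x \<in> fst (surface_pres g n)" and c: "c \<in> {\<one>, \<one>, t}"
    have "f x \<in> carrier G" using f x by auto
    moreover have "t \<otimes> f x = f x \<otimes> t"
      using x St b.sigma_commute[of x] by (auto simp: fst_pres sigmas_def)
    ultimately show "c \<otimes> f x = f x \<otimes> c"
      using c by auto
  next
    fix x assume "x \<in> fst (surface_pres g n)" "\<not> is_handle x"
    then show "f x = c.\<kappa> (wt x)"
      using St by (auto simp: fst_pres sigmas_def zetas_def handles_def wt_def c.kap_simps)
  next
    fix x y assume "x \<in> fst (surface_pres g n)" "y \<in> fst (surface_pres g n)" "is_handle x" "is_handle y"
    then have "x \<in> handles At Bt g" "y \<in> handles At Bt g"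
      by (auto simp: fst_pres sigmas_def zetas_def)
    then have "c.twisted (comm_form x y) (f x) (f y)"
      using c.kap_simps by (intro c.collapsed_twisted[OF b.collapsed_braid_axioms]) (auto simp: comm_form_simps)
    then show "f x \<otimes> f y = c.\<kappa> (comm_form x y) \<otimes> (f y \<otimes> f x)"
      by (simp add: c.twisted_def)
  qed
qed

lemma (in group) conj_eq_iff:
  assumes "x \<in> carrier G" "y \<in> carrier G" "w \<in> carrier G"
  shows "y \<otimes> (x \<otimes> inv y) = w \<longleftrightarrow> y \<otimes> x = w \<otimes> y"
  using assms by (metis inv_solve_right m_assoc inv_closed m_closed)

text \<open>Only the Artin generators are assumed to have common values; the equality of the
  \<open>Zeta i\<close> and the centrality of z follow from the relations.\<close>

lemma (in group) mixed_central_rep: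
  assumes f: "f \<in> fst (mixed_pres g k n) \<rightarrow> carrier G"
    and rels: "\<And>u v. (u, v) \<in> snd (mixed_pres g k n) \<Longrightarrow> weval G f u = weval G f v"
    and kn: "k \<ge> 3" "n \<ge> 3"
    and S: "\<And>i. i \<in> {1..<k} \<Longrightarrow> f (S i) = s"
    and St: "\<And>i. i \<in> {1..<n} \<Longrightarrow> f (St i) = t"
  shows "central_rep G (s) (f (Zeta 1)) (t) (fst (mixed_pres g k n)) f"
    and "i \<in> {1..n} \<Longrightarrow> f (Zeta i) = f (Zeta 1)"
proof -
  interpret b: collapsed_braid G f S A B k g n "s"
    using f rels S kn by unfold_locales (auto simp: fst_pres snd_pres)
  interpret bt: collapsed_braid G f St At Bt n g 0 "t"
    using f rels St kn by unfold_locales (auto simp: fst_pres snd_pres zetas_def)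
  have rel: "weval G f u = weval G f v" if "(u, v) \<in> mixed_rels g k n" for u v
    using that rels by (simp add: snd_pres)
  define z where "z = f (Zeta 1)"
  have z [simp]: "z \<in> carrier G"
    using kn by (simp add: z_def)
  have sz: "s \<otimes> z = z \<otimes> s"
    using b.sigma_commute[of "Zeta 1"] kn by (simp add: zetas_def z_def)
  have tilde_sigma: "s \<otimes> f y = f y \<otimes> s" if "y \<in> sigmas St n \<union> handles At Bt g" for y
  proof -
    have "f y \<in> carrier G" using that f by (auto simp: fst_pres)
    then show ?thesis
      using rel[OF mixed_rels.tilde_sigma[OF that, of 1 k]] kn S[of 1] by (simp add: pos_def)
  qed
  have st: "s \<otimes> t = t \<otimes> s"
    using tilde_sigma[of "St 1"] kn St[of 1] by (simp add: sigmas_def)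
  \<comment> \<open>\<open>St 2\<close> fixes \<open>Zeta 1\<close>, whereas \<open>St 1\<close>
    moves it; this is where n must be at least 3.\<close>
  have zt: "t \<otimes> z = z \<otimes> t"
    using rel[OF mixed_rels.sigma_zeta_other[of 2 n 1]] kn St[of 2] z
    by (simp add: z_def pos_def wconj_def winv_def conj_eq_iff)
  \<comment> \<open>\<open>St i\<close> conjugates \<open>Zeta (i + 1)\<close> to
    \<open>Zeta i\<close>; as t commutes with z, equality propagates upwards from index 1.\<close>
  have Z: "f (Zeta i) = z" if "i \<in> {1..n}" for i
  proof -
    have "1 \<le> i" using that by simp
    then show ?thesis using that
    proof (induction i rule: dec_induct)
      case (step i)
      then have i: "i \<in> {1..<n}" "i \<in> {1..n}" "i + 1 \<in> {1..n}" by auto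
      then have "t \<otimes> f (Zeta (i + 1)) = z \<otimes> t"
        using rel[OF mixed_rels.sigma_zeta_next[OF i(1)]] St[OF i(1)] step.IH
        by (simp add: pos_def wconj_def winv_def conj_eq_iff)
      then have "t \<otimes> f (Zeta (i + 1)) = t \<otimes> z"
        by (simp add: zt)
      then show ?case
        using i by simp
    qed (simp add: z_def)
  qed
  then show "i \<in> {1..n} \<Longrightarrow> f (Zeta i) = f (Zeta 1)"
    by (simp only: z_def)
  have Z1: "f (Zeta (Suc 0)) = z"
    by (simp add: z_def)
  have zh: "z \<otimes> f x = f x \<otimes> z" if "x \<in> handles A B g" for x
    using b.zeta_handle_commute[of 1 x] that kn by (simp add: z_def)
  \<comment> \<open>All are consequences of \<open>zh\<close>, in the right-nested shapes taken by
    the evaluated relation words.\<close>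
  have zh_conj: "inv z \<otimes> (f x \<otimes> z) = f x" "inv f x \<otimes> (z \<otimes> f x) = z"
    "inv f x \<otimes> (inv z \<otimes> (f x \<otimes> z)) = \<one>" "inv f x \<otimes> (z \<otimes> (f x \<otimes> w)) = z \<otimes> w"
    "inv f x \<otimes> (inv z \<otimes> (f x \<otimes> (z \<otimes> w))) = w" "inv z \<otimes> (f x \<otimes> (z \<otimes> w)) = f x \<otimes> w"
    if "x \<in> handles A B g" "w \<in> carrier G" for x w
  proof -
    have x: "f x \<in> carrier G" using that by simp
    show 1: "inv z \<otimes> (f x \<otimes> z) = f x" "inv f x \<otimes> (z \<otimes> f x) = z"
      using x by (simp flip: zh[OF that(1)], simp add: zh[OF that(1)])
    show 2: "inv f x \<otimes> (inv z \<otimes> (f x \<otimes> z)) = \<one>"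
      using x by (simp add: 1)
    have "inv f x \<otimes> (z \<otimes> (f x \<otimes> w)) = (inv f x \<otimes> (z \<otimes> f x)) \<otimes> w"
      "inv f x \<otimes> (inv z \<otimes> (f x \<otimes> (z \<otimes> w))) = (inv f x \<otimes> (inv z \<otimes> (f x \<otimes> z))) \<otimes> w"
      "inv z \<otimes> (f x \<otimes> (z \<otimes> w)) = (inv z \<otimes> (f x \<otimes> z)) \<otimes> w"
      using x that(2) by (simp_all add: m_assoc)
    then show "inv f x \<otimes> (z \<otimes> (f x \<otimes> w)) = z \<otimes> w"
      "inv f x \<otimes> (inv z \<otimes> (f x \<otimes> (z \<otimes> w))) = w" "inv z \<otimes> (f x \<otimes> (z \<otimes> w)) = f x \<otimes> w"
      using x that(2) by (simp_all add: 1 2)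
  qed
  \<comment> \<open>z discharges the premise on w in the three facts that do not mention w.\<close>
  note zh_conj = zh_conj(1-3)[OF _ z] zh_conj(4-6)
  \<comment> \<open>The relation sends z to its conjugate by x z; z commutes with x, so this
    conjugate is z.\<close>
  have zth: "z \<otimes> f y = f y \<otimes> z" if y: "y \<in> handles At Bt g" for y
  proof -
    obtain i x where i: "i \<in> {1..g}" "(y, x) \<in> {(At i, A i), (Bt i, B i)}"
      using y unfolding handles_def by blast
    then have x: "x \<in> handles A B g" by (auto simp: handles_def)
    have "f y \<otimes> (z \<otimes> inv f y) = inv z \<otimes> (inv f x \<otimes> (z \<otimes> (f x \<otimes> z)))"
      using rel[OF mixed_rels.handle_zeta_first[OF i, of n k]] kn x that
      by (simp add: pos_def wconj_def winv_def Z1)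
    also have "\<dots> = z"
      using x by (simp add: zh_conj)
    finally show ?thesis
      using y by (simp add: conj_eq_iff)
  qed
  interpret c: central_triple G s z t
    using sz st zt by unfold_locales simp_all
  \<comment> \<open>In the three relations involved, d is conjugated by z, by the commutator of the
    commuting elements x^-1 and z^-1, or by nothing; each leaves \<open>f d\<close>
    unchanged.\<close>
  have cross_zero: "f y \<otimes> f d = f d \<otimes> f y"
    if i: "i \<in> {1..g}" "(y, x) \<in> {(At i, A i), (Bt i, B i)}" and j: "j \<in> {1..g}" "d \<in> {A j, B j}"
      and "i \<noteq> j \<or> d = x" for i j y x d
  proof -
    have mem: "x \<in> handles A B g" "d \<in> handles A B g" "y \<in> handles At Bt g"
      using i j by (auto simp: handles_def)
    have "f y \<otimes> (f d \<otimes> inv f y) = f d"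
    proof -
      consider "i = j" "d = x" | "i > j" | "j > i"
        using \<open>i \<noteq> j \<or> d = x\<close> i j by fastforce
      then show ?thesis
      proof cases
        case 1
        then show ?thesis
          using rel[OF mixed_rels.handle_same[OF i, of n k]] kn mem
          by (simp add: pos_def wconj_def winv_def Z1 zh_conj)
      next
        case 2
        then show ?thesis
          using rel[OF mixed_rels.handle_lower[OF i j 2, of n k]] kn mem
          by (simp add: pos_def wconj_def winv_def wcomm_def Z1 zh_conj)
      next
        case 3
        then show ?thesis
          using rel[OF mixed_rels.handle_upper[OF i(1) _ j 3, of y k n]] i mem
          by (auto simp: pos_def wconj_def winv_def)
      qed
    qed
    then show ?thesis
      using mem by (simp add: conj_eq_iff)
  qed
  \<comment> \<open>Here and in \<open>cross_ba\<close> a factor z or its inverse survives: the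
    entries 1 and -1 of \<open>comm_form\<close>.\<close>
  have cross_ab: "f (At i) \<otimes> f (B i) = z \<otimes> (f (B i) \<otimes> f (At i))" if i: "i \<in> {1..g}" for i
  proof -
    have mem: "B i \<in> handles A B g" "At i \<in> handles At Bt g" using i by (auto simp: handles_def)
    have "f (At i) \<otimes> (f (B i) \<otimes> inv f (At i)) = z \<otimes> f (B i)"
      using rel[OF mixed_rels.handle_ab[OF i, of n k]] kn mem
      by (simp add: pos_def wconj_def winv_def Z1 zh)
    then show ?thesis
      using mem by (simp add: conj_eq_iff m_assoc)
  qed
  have cross_ba: "f (Bt i) \<otimes> f (A i) = inv z \<otimes> (f (A i) \<otimes> f (Bt i))" if i: "i \<in> {1..g}" for i
  proof -
    have mem: "B i \<in> handles A B g" "A i \<in> handles A B g" "Bt i \<in> handles At Bt g"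
      using i by (auto simp: handles_def)
    have "f (Bt i) \<otimes> (f (A i) \<otimes> inv f (Bt i)) = inv z \<otimes> f (A i)"
      using rel[OF mixed_rels.handle_ba[OF i, of n k]] kn mem
      by (simp add: pos_def wconj_def winv_def wcomm_def Z1 zh_conj)
    then show ?thesis
      using mem by (simp add: conj_eq_iff m_assoc)
  qed
  have cross: "c.twisted (comm_form y d) (f y) (f d)"
    if y: "y \<in> handles At Bt g" and d: "d \<in> handles A B g" for y d
  proof -
    obtain i x where i: "i \<in> {1..g}" "(y, x) \<in> {(At i, A i), (Bt i, B i)}"
      using y unfolding handles_def by blast
    obtain j where j: "j \<in> {1..g}" "d \<in> {A j, B j}"
      using d by (auto simp: handles_def)
    show ?thesis
    proof (cases "i \<noteq> j \<or> d = x")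
      case True
      then have "comm_form y d = 0"
        using i j by (auto simp: comm_form_simps)
      then show ?thesis
        using cross_zero[OF i j True] y d by simp
    next
      case False
      then show ?thesis
        using i j cross_ab[of i] cross_ba[of i] by (auto simp: c.twisted_def c.kap_simps comm_form_simps)
    qed
  qed
  have "central_rep G s z t (fst (mixed_pres g k n)) f"
  proof
    show "f \<in> fst (mixed_pres g k n) \<rightarrow> carrier G" by fact
  next
    fix x c assume x: "x \<in> fst (mixed_pres g k n)" and c: "c \<in> {s, z, t}"
    have th: "t \<otimes> f x = f x \<otimes> t" if x: "x \<in> handles A B g"
      using rel[OF mixed_rels.sigma_handle[OF _ x, of 1 n k]] kn St[of 1] x by (simp add: pos_def)
    consider (S) i where "x = S i" "i \<in> {1..<k}" | (St) i where "x = St i" "i \<in> {1..<n}"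
      | (Z) i where "x = Zeta i" "i \<in> {1..n}" | (h) "x \<in> handles A B g" | (ht) "x \<in> handles At Bt g"
      using x by (auto simp: fst_pres sigmas_def zetas_def)
    then show "c \<otimes> f x = f x \<otimes> c"
    proof cases
      case S
      then show ?thesis using c sz st assms(5) by auto
    next
      case St
      then show ?thesis using c zt st assms(6) by auto
    next
      case Z
      then have "f x = z" using \<open>\<And>i. i \<in> {1..n} \<Longrightarrow> f (Zeta i) = z\<close> by simp
      then show ?thesis using c sz zt by auto
    next
      case h
      then have "s \<otimes> f x = f x \<otimes> s" "z \<otimes> f x = f x \<otimes> z" "t \<otimes> f x = f x \<otimes> t"
        using b.sigma_commute zh th by auto
      then show ?thesis using c by auto
    next
      case ht
      then have "s \<otimes> f x = f x \<otimes> s" "z \<otimes> f x = f x \<otimes> z" "t \<otimes> f x = f x \<otimes> t"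
        using tilde_sigma zth bt.sigma_commute by auto
      then show ?thesis using c by auto
    qed
  next
    fix x assume "x \<in> fst (mixed_pres g k n)" "\<not> is_handle x"
    then show "f x = c.\<kappa> (wt x)"
      using S St Z by (auto simp: fst_pres sigmas_def zetas_def handles_def wt_def c.kap_simps)
  next
    fix x y assume xy: "x \<in> fst (mixed_pres g k n)" "y \<in> fst (mixed_pres g k n)" "is_handle x" "is_handle y"
    then have mem: "x \<in> handles A B g \<or> x \<in> handles At Bt g" "y \<in> handles A B g \<or> y \<in> handles At Bt g"
      by (auto simp: fst_pres sigmas_def zetas_def)
    have "f x \<in> carrier G" "f y \<in> carrier G"
      using xy f by auto
    \<comment> \<open>The relations describe a tilde handle followed by a plain one; the opposite
      order has the inverse commutator.\<close>
    then have swap: "c.twisted (comm_form x y) (f x) (f y)" if "c.twisted (comm_form y x) (f y) (f x)"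
      using c.twisted_swap[OF that] by (simp flip: comm_form_antisym)
    have "c.twisted (comm_form x y) (f x) (f y)" if "x \<in> handles A B g" "y \<in> handles A B g"
      using that c.kap_simps
      by (intro c.collapsed_twisted[OF b.collapsed_braid_axioms]) (auto simp: comm_form_simps)
    moreover have "c.twisted (comm_form x y) (f x) (f y)" if "x \<in> handles At Bt g" "y \<in> handles At Bt g"
      using that c.kap_simps
      by (intro c.collapsed_twisted[OF bt.collapsed_braid_axioms]) (auto simp: comm_form_simps)
    ultimately have "c.twisted (comm_form x y) (f x) (f y)"
      using mem cross swap by blast
    then show "f x \<otimes> f y = c.\<kappa> (comm_form x y) \<otimes> (f y \<otimes> f x)"
      by (simp add: c.twisted_def)
  qed
  then show "central_rep G s (f (Zeta 1)) t (fst (mixed_pres g k n)) f"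
    by (simp add: z_def)
qed

section \<open>A Heisenberg-type model\<close>

text \<open>Bilinear extension of \<open>bform\<close> to exponent vectors, restricted to handle
  indices up to g.\<close>

definition beta :: "nat \<Rightarrow> (letter \<Rightarrow> int) \<Rightarrow> (letter \<Rightarrow> int) \<Rightarrow> int \<times> int \<times> int" where
  "beta g u v = (\<Sum>i = 1..g. 2 * u (A i) * v (B i),
     \<Sum>i = 1..g. u (At i) * v (B i) - u (Bt i) * v (A i),
     \<Sum>i = 1..g. 2 * u (At i) * v (Bt i))"

text \<open>Central extension of the exponent vectors by the lattice of triples, with 2-cocycle
  \<open>beta\<close>; bilinearity gives associativity. Vectors may be arbitrary functions on
  letters, since \<open>beta\<close> reads only finitely many coordinates.\<close>

definition model :: "nat \<Rightarrow> ((letter \<Rightarrow> int) \<times> (int \<times> int \<times> int)) monoid" where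
  "model g = \<lparr>carrier = UNIV, mult = (\<lambda>x y. (fst x + fst y, snd x + snd y + beta g (fst x) (fst y))),
     one = (0, 0)\<rparr>"

definition delta :: "letter \<Rightarrow> letter \<Rightarrow> int" where
  "delta x = (if is_handle x then (\<lambda>y. if y = x then 1 else 0) else 0)"

definition model_gen :: "letter \<Rightarrow> (letter \<Rightarrow> int) \<times> (int \<times> int \<times> int)" where
  "model_gen x = (delta x, wt x)"

lemma beta_add: "beta g (u + u') v = beta g u v + beta g u' v" "beta g u (v + v') = beta g u v + beta g u v'"
  by (simp_all add: beta_def algebra_simps sum.distrib sum_subtractf sum_negf)

lemma beta_zero [simp]: "beta g 0 v = 0" "beta g u 0 = 0"
  by (simp_all add: beta_def zero_prod_def)

lemma beta_minus: "beta g (- u) v = - beta g u v" "beta g u (- v) = - beta g u v"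
  by (simp_all add: beta_def sum_negf algebra_simps flip: sum_negf)

lemma beta_delta:
  "i \<in> {1..g} \<Longrightarrow> beta g (delta (A i)) v = (2 * v (B i), 0, 0)"
  "beta g (delta (B i)) v = (0, 0, 0)"
  "i \<in> {1..g} \<Longrightarrow> beta g (delta (At i)) v = (0, v (B i), 2 * v (Bt i))"
  "i \<in> {1..g} \<Longrightarrow> beta g (delta (Bt i)) v = (0, - v (A i), 0)"
proof -
  have if_mult: "2 * (if P then 1 else 0) * x = (if P then 2 * x else 0)"
    "(if P then 1 else 0) * x = (if P then x else 0)" "(0 :: int) - (if P then x else 0) = (if P then - x else 0)"
    for P and x :: int
    by auto
  show "i \<in> {1..g} \<Longrightarrow> beta g (delta (A i)) v = (2 * v (B i), 0, 0)"
    "beta g (delta (B i)) v = (0, 0, 0)"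
    "i \<in> {1..g} \<Longrightarrow> beta g (delta (At i)) v = (0, v (B i), 2 * v (Bt i))"
    "i \<in> {1..g} \<Longrightarrow> beta g (delta (Bt i)) v = (0, - v (A i), 0)"
    by (simp_all add: beta_def delta_def if_mult sum_negf)
qed

lemma group_model: "group (model g)"
proof (rule groupI)
  fix x assume "x \<in> carrier (model g)"
  show "\<exists>y\<in>carrier (model g). y \<otimes>\<^bsub>model g\<^esub> x = \<one>\<^bsub>model g\<^esub>"
    by (rule bexI[of _ "(- fst x, - snd x + beta g (fst x) (fst x))"])
      (auto simp: model_def beta_minus)
qed (auto simp: model_def beta_add algebra_simps)

lemma model_simps:
  "carrier (model g) = UNIV" "x \<otimes>\<^bsub>model g\<^esub> y = (fst x + fst y, snd x + snd y + beta g (fst x) (fst y))"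
  "\<one>\<^bsub>model g\<^esub> = (0, 0)"
  by (simp_all add: model_def)

lemma model_inv: "inv\<^bsub>model g\<^esub> x = (- fst x, - snd x + beta g (fst x) (fst x))"
  by (rule group.inv_equality[OF group_model]) (simp_all add: model_simps beta_minus)

lemma delta_not_handle [simp]: "\<not> is_handle x \<Longrightarrow> delta x = 0"
  by (simp add: delta_def)

lemma delta_apply: "is_handle x \<Longrightarrow> delta x y = (if y = x then 1 else 0)"
  by (simp add: delta_def)

lemmas word_simps = pos_def wconj_def winv_def wcomm_def
lemmas model_eval = model_simps model_inv model_gen_def beta_add beta_minus beta_delta delta_apply wt_def
  prod_eq_iff fun_eq_iff

text \<open>Relations become identities between vectors and between triples. In
  \<open>handle\<close>, the value 2 of \<open>beta\<close> on the pair of a and b balances the two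
  additional letters \<open>s 1\<close> on the right-hand side.\<close>

lemma model_braid_rels:
  "(u, v) \<in> braid_rels S A B k g n \<Longrightarrow> weval (model g) model_gen u = weval (model g) model_gen v"
  by (cases rule: braid_rels.cases, assumption)
    (auto simp: word_simps model_eval handles_def zetas_def algebra_simps)

lemma model_braid_rels_tilde:
  "(u, v) \<in> braid_rels St At Bt n g 0 \<Longrightarrow> weval (model g) model_gen u = weval (model g) model_gen v"
  by (cases rule: braid_rels.cases, assumption)
    (auto simp: word_simps model_eval handles_def zetas_def algebra_simps)

lemma model_mixed_rels:
  assumes "(u, v) \<in> mixed_rels g k n"
  shows "weval (model g) model_gen u = weval (model g) model_gen v"
  using assms
proof (cases rule: mixed_rels.cases)
  case (tilde_sigma y j)
  then show ?thesis
    by (auto simp: word_simps model_eval sigmas_def handles_def algebra_simps)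
next
  case (sigma_handle i c)
  then show ?thesis
    by (auto simp: word_simps model_eval sigmas_def handles_def algebra_simps)
next
  case (handle_zeta_first i y x)
  then show ?thesis
    by (auto simp: word_simps model_eval algebra_simps)
next
  case (handle_zeta i y x j)
  then show ?thesis
    by (auto simp: word_simps model_eval algebra_simps)
next
  case (handle_same i y x)
  then show ?thesis
    by (auto simp: word_simps model_eval algebra_simps)
next
  case (handle_lower i y x j d)
  then show ?thesis
    by (auto simp: word_simps model_eval algebra_simps)
next
  case (handle_upper i y j d)
  then show ?thesis
    by (auto simp: word_simps model_eval algebra_simps)
next
  case (handle_ab i)
  then show ?thesis
    by (auto simp: word_simps model_eval algebra_simps)
next
  case (handle_ba i)
  then show ?thesis
    by (auto simp: word_simps model_eval algebra_simps)
qed (auto simp: word_simps model_eval algebra_simps)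

lemma model_rels:
  "(u, v) \<in> snd (mixed_pres g k n) \<Longrightarrow> weval (model g) model_gen u = weval (model g) model_gen v"
  using model_braid_rels model_braid_rels_tilde model_mixed_rels by (auto simp: snd_pres)

lemma model_commutator:
  "x \<otimes>\<^bsub>model g\<^esub> y \<otimes>\<^bsub>model g\<^esub> inv\<^bsub>model g\<^esub> x \<otimes>\<^bsub>model g\<^esub> inv\<^bsub>model g\<^esub> y
    = (0, beta g (fst x) (fst y) - beta g (fst y) (fst x))"
  by (simp add: model_simps model_inv beta_add beta_minus)

text \<open>Commutators have first component 0 and are therefore central, so \<Gamma>_3 is trivial;
  for g = 0 the sums in \<open>beta\<close> are empty and the group is abelian. The two cases cover
  the disc quotients by \<Gamma>_2 and the surface quotients by \<Gamma>_3.\<close>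

lemma model_lower_central:
  assumes "i = 2 \<and> g = 0 \<or> i = 3"
  shows "\<Gamma> (model g) i \<subseteq> {\<one>\<^bsub>model g\<^esub>}"
proof -
  interpret group "model g" by (rule group_model)
  have "subgroup {x. fst x = 0} (model g)"
    by unfold_locales (auto simp: model_simps model_inv)
  then have two: "\<Gamma> (model g) 2 \<subseteq> {x. fst x = 0}"
    unfolding numeral_2_eq_2 lower_central.simps commutator_subgroup_def
    by (intro generate_subgroup_incl) (auto simp: model_commutator)
  show ?thesis
  proof (cases "i = 3")
    case True
    have "h \<otimes>\<^bsub>model g\<^esub> k \<otimes>\<^bsub>model g\<^esub> inv\<^bsub>model g\<^esub> h \<otimes>\<^bsub>model g\<^esub> inv\<^bsub>model g\<^esub> k = \<one>\<^bsub>model g\<^esub>"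
      if "k \<in> \<Gamma> (model g) (Suc (Suc 0))" for h k
    proof -
      have "fst k = 0"
        using two that unfolding numeral_2_eq_2 by blast
      then show ?thesis
        unfolding model_commutator by (simp add: model_simps zero_prod_def)
    qed
    then have "\<Gamma> (model g) (Suc (Suc (Suc 0))) \<subseteq> {\<one>\<^bsub>model g\<^esub>}"
      unfolding lower_central.simps(3)[of _ "Suc 0"] commutator_subgroup_def
      using triv_subgroup by (intro generate_subgroup_incl) blast+
    with True show ?thesis by (simp only: numeral_3_eq_3)
  next
    case False
    then have "i = Suc (Suc 0)" "g = 0" using assms by auto
    have "h \<otimes>\<^bsub>model g\<^esub> k \<otimes>\<^bsub>model g\<^esub> inv\<^bsub>model g\<^esub> h \<otimes>\<^bsub>model g\<^esub> inv\<^bsub>model g\<^esub> k = \<one>\<^bsub>model g\<^esub>" for h k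
      unfolding model_commutator using \<open>g = 0\<close> by (simp add: model_simps beta_def zero_prod_def)
    then show ?thesis
      unfolding \<open>i = Suc (Suc 0)\<close> lower_central.simps commutator_subgroup_def
      using triv_subgroup by (intro generate_subgroup_incl) blast+
  qed
qed

lemma model_int_pow:
  "(0, (a, b, c)) [^]\<^bsub>model g\<^esub> (p :: int) = (0, (p * a, p * b, p * c))"
proof -
  interpret group "model g" by (rule group_model)
  have nat: "(0, (a, b, c)) [^]\<^bsub>model g\<^esub> m = (0, (int m * a, int m * b, int m * c))" for m :: nat
    by (induction m) (auto simp: model_simps zero_prod_def algebra_simps beta_zero[unfolded zero_fun_def])
  show ?thesis
    by (cases p rule: int_cases2)
      (simp_all add: int_pow_int nat int_pow_neg_int model_simps model_inv)
qed

lemma model_kap: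
  "kap (model g) (model_gen (S i)) (model_gen (Zeta j)) (model_gen (St l)) c = (0, c)"
  by (cases c) (simp add: kap_def model_gen_def wt_def model_int_pow, simp add: model_simps zero_prod_def)

lemma hom_kap:
  assumes "group_hom G H h" "s \<in> carrier G" "z \<in> carrier G" "t \<in> carrier G"
  shows "h (kap G s z t c) = kap H (h s) (h z) (h t) c"
proof -
  interpret group_hom G H h by fact
  show ?thesis
    using assms by (simp add: kap_def hom_int_pow)
qed

text \<open>The homomorphism to the model sends the element with exponents c to (0, c), and
  \<Gamma>_i into the trivial \<Gamma>_i of the model.\<close>

lemma mixed_independent:
  assumes "i = 2 \<and> g = 0 \<or> i = 3" "k \<ge> 2" "n \<ge> 2"
    and c: "kap (mixed_braid g k n) (gen_of (mixed_pres g k n) (S 1)) (gen_of (mixed_pres g k n) (Zeta 1))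
        (gen_of (mixed_pres g k n) (St 1)) c \<in> \<Gamma> (mixed_braid g k n) i"
  shows "c = 0"
proof -
  let ?P = "mixed_pres g k n"
  let ?M = "extend (model g) model_gen"
  have gens: "model_gen \<in> fst ?P \<rightarrow> carrier (model g)"
    by (simp add: model_simps)
  note M = extend_hom[OF group_model gens model_rels]
  have M_hom: "?M \<in> hom (mixed_braid g k n) (model g)"
    using M(1) by (simp add: mixed_braid_def)
  have grp: "group (mixed_braid g k n)"
    by (simp add: mixed_braid_def group_presented)
  have mem: "S 1 \<in> fst ?P" "Zeta 1 \<in> fst ?P" "St 1 \<in> fst ?P"
    using assms by (auto simp: fst_pres sigmas_def zetas_def)
  have "?M (kap (mixed_braid g k n) (gen_of ?P (S 1)) (gen_of ?P (Zeta 1)) (gen_of ?P (St 1)) c) = (0, c)"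
    using M(2) mem M_hom grp group_model gen_of_closed[of _ ?P]
    by (subst hom_kap[where H = "model g"])
      (auto simp: group_hom_def group_hom_axioms_def mixed_braid_def model_kap simp del: One_nat_def)
  moreover have "?M (kap (mixed_braid g k n) (gen_of ?P (S 1)) (gen_of ?P (Zeta 1)) (gen_of ?P (St 1)) c) \<in> \<Gamma> (model g) i"
    using hom_lower_central[OF grp group_model M_hom c] .
  ultimately show ?thesis
    using model_lower_central[OF assms(1)] by (auto simp: model_simps zero_prod_def)
qed

section \<open>The lower central quotients\<close>

lemma group_braids [simp]:
  "group (mixed_braid g k n)" "group (punctured_braid g k n)" "group (surface_braid g n)"
  by (simp_all add: mixed_braid_def punctured_braid_def surface_braid_def group_presented)

lemma (in normal) quotient_epi: "(\<lambda>x. H #> x) \<in> epi G (G Mod H)"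
  using r_coset_hom_Mod by (simp add: epi_def carrier_FactGroup)

lemma (in normal) quotient_kernel: "x \<in> carrier G \<Longrightarrow> H #> x = \<one>\<^bsub>G Mod H\<^esub> \<longleftrightarrow> x \<in> H"
  using coset_join1[OF _ _ subgroup_axioms] coset_join2[OF _ subgroup_axioms] by auto

lemma quotient_groups [simp]: "group (mixed_quot i g k n)" "group (surface_quot i g n)"
  by (simp_all add: mixed_quot_def surface_quot_def group.normal_lower_central normal.factorgroup_is_group)

lemma proj_epi:
  "mixed_proj i g k n \<in> epi (mixed_braid g k n) (mixed_quot i g k n)"
  "surface_proj i g n \<in> epi (surface_braid g n) (surface_quot i g n)"
  using normal.quotient_epi[OF group.normal_lower_central, of "mixed_braid g k n" i]
    normal.quotient_epi[OF group.normal_lower_central, of "surface_braid g n" i]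
  by (simp_all add: mixed_quot_def surface_quot_def mixed_proj_def[abs_def] surface_proj_def[abs_def])

lemma proj_hom:
  "mixed_proj i g k n \<in> hom (mixed_braid g k n) (mixed_quot i g k n)"
  "surface_proj i g n \<in> hom (surface_braid g n) (surface_quot i g n)"
  using proj_epi by (simp_all add: epi_def)

lemma proj_kernel:
  "x \<in> carrier (mixed_braid g k n) \<Longrightarrow>
     mixed_proj i g k n x = \<one>\<^bsub>mixed_quot i g k n\<^esub> \<longleftrightarrow> x \<in> \<Gamma> (mixed_braid g k n) i"
  "y \<in> carrier (surface_braid g n) \<Longrightarrow>
     surface_proj i g n y = \<one>\<^bsub>surface_quot i g n\<^esub> \<longleftrightarrow> y \<in> \<Gamma> (surface_braid g n) i"
  using normal.quotient_kernel[OF group.normal_lower_central, of "mixed_braid g k n" x i]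
    normal.quotient_kernel[OF group.normal_lower_central, of "surface_braid g n" y i]
  by (simp_all add: mixed_quot_def surface_quot_def mixed_proj_def surface_proj_def)

lemma gen_mem:
  "x \<in> fst (mixed_pres g k n) \<Longrightarrow> gen_of (mixed_pres g k n) x \<in> carrier (mixed_braid g k n)"
  "x \<in> fst (punctured_pres g k n) \<Longrightarrow> gen_of (punctured_pres g k n) x \<in> carrier (punctured_braid g k n)"
  "x \<in> fst (surface_pres g n) \<Longrightarrow> gen_of (surface_pres g n) x \<in> carrier (surface_braid g n)"
  by (simp_all add: mixed_braid_def punctured_braid_def surface_braid_def gen_of_closed)

text \<open>Relations (b) are among those of the mixed group, so \<open>forget\<close> has a section on presentations.\<close>

definition section_map :: "nat \<Rightarrow> nat \<Rightarrow> nat \<Rightarrow> letter word set \<Rightarrow> letter word set" where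
  "section_map g k n = extend (mixed_braid g k n) (gen_of (mixed_pres g k n))"

lemma fst_pres_mono:
  "fst (mixed_pres 0 k n) \<subseteq> fst (mixed_pres g k n)" "fst (punctured_pres 0 k n) \<subseteq> fst (punctured_pres g k n)"
  "fst (surface_pres 0 n) \<subseteq> fst (surface_pres g n)" "fst (punctured_pres g k n) \<subseteq> fst (mixed_pres g k n)"
  "fst (surface_pres g n) \<subseteq> fst (mixed_pres g k n)"
  by (auto simp: fst_pres handles_def)

lemma snd_pres_mono:
  "snd (mixed_pres 0 k n) \<subseteq> snd (mixed_pres g k n)" "snd (punctured_pres 0 k n) \<subseteq> snd (punctured_pres g k n)"
  "snd (surface_pres 0 n) \<subseteq> snd (surface_pres g n)" "snd (punctured_pres g k n) \<subseteq> snd (mixed_pres g k n)"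
  "snd (surface_pres g n) \<subseteq> snd (mixed_pres g k n)"
  using braid_rels_genus_mono[of S A B k n g] braid_rels_genus_mono[of St At Bt n 0 g]
    mixed_rels_genus_mono[of k n g]
  by (auto simp: snd_pres)

lemmas inclusion_extends =
  extend_subpresentation[OF fst_pres_mono(4) snd_pres_mono(4) pres_words(1)]
  extend_subpresentation[OF fst_pres_mono(1) snd_pres_mono(1) pres_words(3)]
  extend_subpresentation[OF fst_pres_mono(2) snd_pres_mono(2) pres_words(1)]
  extend_subpresentation[OF fst_pres_mono(3) snd_pres_mono(3) pres_words(2)]
  extend_subpresentation[OF fst_pres_mono(5) snd_pres_mono(5) pres_words(2)]

lemma inclusion_homs:
  "incl g k n \<in> hom (punctured_braid g k n) (mixed_braid g k n)"
  "iota_mixed g k n \<in> hom (mixed_braid 0 k n) (mixed_braid g k n)"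
  "iota_punctured g k n \<in> hom (punctured_braid 0 k n) (punctured_braid g k n)"
  "iota_surface g n \<in> hom (surface_braid 0 n) (surface_braid g n)"
  "section_map g k n \<in> hom (surface_braid g n) (mixed_braid g k n)"
  by (simp_all add: incl_def iota_mixed_def iota_punctured_def iota_surface_def section_map_def
    mixed_braid_def punctured_braid_def surface_braid_def inclusion_extends)

lemma inclusion_gens:
  "x \<in> fst (punctured_pres g k n) \<Longrightarrow> incl g k n (gen_of (punctured_pres g k n) x) = gen_of (mixed_pres g k n) x"
  "x \<in> fst (mixed_pres 0 k n) \<Longrightarrow> iota_mixed g k n (gen_of (mixed_pres 0 k n) x) = gen_of (mixed_pres g k n) x"
  "x \<in> fst (punctured_pres 0 k n) \<Longrightarrow> iota_punctured g k n (gen_of (punctured_pres 0 k n) x) = gen_of (punctured_pres g k n) x"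
  "x \<in> fst (surface_pres 0 n) \<Longrightarrow> iota_surface g n (gen_of (surface_pres 0 n) x) = gen_of (surface_pres g n) x"
  "x \<in> fst (surface_pres g n) \<Longrightarrow> section_map g k n (gen_of (surface_pres g n) x) = gen_of (mixed_pres g k n) x"
  by (simp_all add: incl_def iota_mixed_def iota_punctured_def iota_surface_def section_map_def
    mixed_braid_def punctured_braid_def surface_braid_def inclusion_extends)

lemma weval_one:
  assumes "group H" "\<And>x. x \<in> X \<Longrightarrow> f x = \<one>\<^bsub>H\<^esub>" "w \<in> words X"
  shows "weval H f w = \<one>\<^bsub>H\<^esub>"
proof -
  interpret group H by fact
  show ?thesis using assms(3) by (induction w) (auto simp: assms(2))
qed

text \<open>Killing the plain letters makes both sides of a plain relation trivial and reduces a
  mixed relation to y y^-1 = 1 or y = y; the relations among tilde letters are kept.\<close>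

lemma forget_hom:
  "forget g k n \<in> hom (mixed_braid g k n) (surface_braid g n)"
  and forget_gen: "x \<in> fst (mixed_pres g k n) \<Longrightarrow> forget g k n (gen_of (mixed_pres g k n) x)
    = (if x \<in> fst (surface_pres g n) then gen_of (surface_pres g n) x else \<one>\<^bsub>surface_braid g n\<^esub>)"
proof -
  interpret group "surface_braid g n" by simp
  define \<phi> where "\<phi> x = (if x \<in> fst (surface_pres g n) then gen_of (surface_pres g n) x else \<one>\<^bsub>surface_braid g n\<^esub>)" for x
  have closed: "\<phi> x \<in> carrier (surface_braid g n)" for x
    by (simp add: \<phi>_def gen_mem)
  have triv: "\<phi> (S i) = \<one>\<^bsub>surface_braid g n\<^esub>" "\<phi> (A i) = \<one>\<^bsub>surface_braid g n\<^esub>"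
    "\<phi> (B i) = \<one>\<^bsub>surface_braid g n\<^esub>" "\<phi> (Zeta i) = \<one>\<^bsub>surface_braid g n\<^esub>" for i
    by (auto simp: \<phi>_def fst_pres sigmas_def handles_def)
  have rels: "weval (surface_braid g n) \<phi> u = weval (surface_braid g n) \<phi> v"
    if uv: "(u, v) \<in> snd (mixed_pres g k n)" for u v
  proof -
    consider "(u, v) \<in> braid_rels S A B k g n" | "(u, v) \<in> snd (surface_pres g n)" | "(u, v) \<in> mixed_rels g k n"
      using uv by (auto simp: snd_pres)
    then show ?thesis
    proof cases
      case 1
      have one: "\<phi> x = \<one>\<^bsub>surface_braid g n\<^esub>" if "x \<in> sigmas S k \<union> handles A B g \<union> zetas n" for x
        using that triv by (auto simp: sigmas_def handles_def zetas_def)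
      then show ?thesis
        using weval_one[OF is_group one braid_rels_words(1)[OF 1]]
          weval_one[OF is_group one braid_rels_words(2)[OF 1]] by simp
    next
      case 2
      then have w: "u \<in> words (fst (surface_pres g n))" "v \<in> words (fst (surface_pres g n))"
        using pres_words by blast+
      have "weval (surface_braid g n) (gen_of (surface_pres g n)) u
          = weval (surface_braid g n) (gen_of (surface_pres g n)) v"
        using weval_gen_of[OF w(1)] weval_gen_of[OF w(2)] wclass_eqI[OF weq.rel[OF 2 w]]
        by (simp add: surface_braid_def)
      then show ?thesis
        using weval_cong[OF w(1), of \<phi> "gen_of (surface_pres g n)" "surface_braid g n"]
          weval_cong[OF w(2), of \<phi> "gen_of (surface_pres g n)" "surface_braid g n"] by (simp add: \<phi>_def)
    next
      case 3
      then show ?thesis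
        by (cases rule: mixed_rels.cases) (auto simp: word_simps triv closed handles_def)
    qed
  qed
  have closed': "\<phi> \<in> fst (mixed_pres g k n) \<rightarrow> carrier (surface_braid g n)"
    using closed by auto
  have eq: "forget g k n = extend (surface_braid g n) \<phi>"
    by (simp add: forget_def \<phi>_def[abs_def])
  show "forget g k n \<in> hom (mixed_braid g k n) (surface_braid g n)"
    unfolding eq mixed_braid_def by (rule extend_hom(1)[OF is_group closed' rels])
  show "x \<in> fst (mixed_pres g k n) \<Longrightarrow> forget g k n (gen_of (mixed_pres g k n) x)
    = (if x \<in> fst (surface_pres g n) then gen_of (surface_pres g n) x else \<one>\<^bsub>surface_braid g n\<^esub>)"
    unfolding eq using extend_hom(2)[OF is_group closed' rels] by (simp add: \<phi>_def)
qed

lemma forget_section: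
  assumes "x \<in> carrier (surface_braid g n)" shows "forget g k n (section_map g k n x) = x"
proof -
  have "(forget g k n \<circ> section_map g k n) x = (\<lambda>x. x) x"
  proof (rule hom_presented_eqI[where y = x and \<rho> = "forget g k n \<circ> section_map g k n" and \<rho>' = "\<lambda>x. x" and P = "surface_pres g n", folded surface_braid_def])
    show "forget g k n \<circ> section_map g k n \<in> hom (surface_braid g n) (surface_braid g n)"
      by (rule Group.hom_compose[OF inclusion_homs(5) forget_hom])
    show "(forget g k n \<circ> section_map g k n) (gen_of (surface_pres g n) x) = gen_of (surface_pres g n) x"
      if "x \<in> fst (surface_pres g n)" for x
      using that fst_pres_mono(5)[of g n k] by (auto simp: inclusion_gens forget_gen)
  qed (use assms in \<open>auto simp: hom_def\<close>)
  then show ?thesis by simp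
qed

lemma forget_incl:
  assumes "x \<in> carrier (punctured_braid g k n)" shows "forget g k n (incl g k n x) = \<one>\<^bsub>surface_braid g n\<^esub>"
proof -
  interpret group "surface_braid g n" by simp
  have disj: "x \<notin> fst (surface_pres g n)" if "x \<in> fst (punctured_pres g k n)" for x
    using that by (auto simp: fst_pres sigmas_def handles_def zetas_def)
  have "(forget g k n \<circ> incl g k n) x = (\<lambda>x. \<one>\<^bsub>surface_braid g n\<^esub>) x"
  proof (rule hom_presented_eqI[where y = x and \<rho> = "forget g k n \<circ> incl g k n" and \<rho>' = "\<lambda>x. \<one>\<^bsub>surface_braid g n\<^esub>" and P = "punctured_pres g k n", folded punctured_braid_def])
    show "forget g k n \<circ> incl g k n \<in> hom (punctured_braid g k n) (surface_braid g n)"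
      by (rule Group.hom_compose[OF inclusion_homs(1) forget_hom])
    show "(forget g k n \<circ> incl g k n) (gen_of (punctured_pres g k n) x) = \<one>\<^bsub>surface_braid g n\<^esub>"
      if "x \<in> fst (punctured_pres g k n)" for x
      using that fst_pres_mono(4)[of g k n] disj[OF that] by (auto simp: inclusion_gens forget_gen)
  qed (use assms in \<open>auto simp: hom_def\<close>)
  then show ?thesis by simp
qed

lemma forget_iota:
  assumes "x \<in> carrier (mixed_braid 0 k n)"
  shows "forget g k n (iota_mixed g k n x) = iota_surface g n (forget 0 k n x)"
proof -
  interpret h: group_hom "surface_braid 0 n" "surface_braid g n" "iota_surface g n"
    using inclusion_homs by (simp add: group_hom_def group_hom_axioms_def)
  have "(forget g k n \<circ> iota_mixed g k n) x = (iota_surface g n \<circ> forget 0 k n) x"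
  proof (rule hom_presented_eqI[where y = x and \<rho> = "forget g k n \<circ> iota_mixed g k n" and \<rho>' = "iota_surface g n \<circ> forget 0 k n" and P = "mixed_pres 0 k n" and H = "surface_braid g n", folded mixed_braid_def])
    show "forget g k n \<circ> iota_mixed g k n \<in> hom (mixed_braid 0 k n) (surface_braid g n)"
      by (rule Group.hom_compose[OF inclusion_homs(2) forget_hom])
    show "iota_surface g n \<circ> forget 0 k n \<in> hom (mixed_braid 0 k n) (surface_braid g n)"
      by (rule Group.hom_compose[OF forget_hom inclusion_homs(4)])
    fix y assume y: "y \<in> fst (mixed_pres 0 k n)"
    then have "y \<in> fst (mixed_pres g k n)" "y \<in> fst (surface_pres 0 n) \<longleftrightarrow> y \<in> fst (surface_pres g n)"
      by (auto simp: fst_pres sigmas_def handles_def zetas_def)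
    then show "(forget g k n \<circ> iota_mixed g k n) (gen_of (mixed_pres 0 k n) y)
      = (iota_surface g n \<circ> forget 0 k n) (gen_of (mixed_pres 0 k n) y)"
      using y by (simp add: inclusion_gens forget_gen)
  qed (use assms in auto)
  then show ?thesis by simp
qed

lemma incl_iota:
  assumes "x \<in> carrier (punctured_braid 0 k n)"
  shows "incl g k n (iota_punctured g k n x) = iota_mixed g k n (incl 0 k n x)"
proof -
  have "(incl g k n \<circ> iota_punctured g k n) x = (iota_mixed g k n \<circ> incl 0 k n) x"
  proof (rule hom_presented_eqI[where y = x and \<rho> = "incl g k n \<circ> iota_punctured g k n" and \<rho>' = "iota_mixed g k n \<circ> incl 0 k n" and P = "punctured_pres 0 k n" and H = "mixed_braid g k n", folded punctured_braid_def])
    show "incl g k n \<circ> iota_punctured g k n \<in> hom (punctured_braid 0 k n) (mixed_braid g k n)"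
      by (rule Group.hom_compose[OF inclusion_homs(3) inclusion_homs(1)])
    show "iota_mixed g k n \<circ> incl 0 k n \<in> hom (punctured_braid 0 k n) (mixed_braid g k n)"
      by (rule Group.hom_compose[OF inclusion_homs(1) inclusion_homs(2)])
    fix y assume y: "y \<in> fst (punctured_pres 0 k n)"
    then have "y \<in> fst (punctured_pres g k n)" "y \<in> fst (mixed_pres 0 k n)"
      using fst_pres_mono by blast+
    then show "(incl g k n \<circ> iota_punctured g k n) (gen_of (punctured_pres 0 k n) y)
      = (iota_mixed g k n \<circ> incl 0 k n) (gen_of (punctured_pres 0 k n) y)"
      using y by (simp add: inclusion_gens)
  qed (use assms in auto)
  then show ?thesis by simp
qed

text \<open>\<open>quot_map\<close> is a union over the members of a coset; all of them contribute
  the same coset because \<open>forget\<close> carries \<Gamma>_i into \<Gamma>_i.\<close>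

lemma forget_quot_proj:
  assumes x: "x \<in> carrier (mixed_braid g k n)"
  shows "forget_quot i g k n (mixed_proj i g k n x) = surface_proj i g n (forget g k n x)"
proof -
  interpret N: normal "\<Gamma> (mixed_braid g k n) i" "mixed_braid g k n"
    by (simp add: group.normal_lower_central)
  interpret N': normal "\<Gamma> (surface_braid g n) i" "surface_braid g n"
    by (simp add: group.normal_lower_central)
  let ?N' = "\<Gamma> (surface_braid g n) i" and ?N = "\<Gamma> (mixed_braid g k n) i"
  have "?N' #>\<^bsub>surface_braid g n\<^esub> forget g k n y = ?N' #>\<^bsub>surface_braid g n\<^esub> forget g k n x"
    if y: "y \<in> ?N #>\<^bsub>mixed_braid g k n\<^esub> x" for y
  proof -
    obtain h where h: "h \<in> ?N" "y = h \<otimes>\<^bsub>mixed_braid g k n\<^esub> x"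
      using y by (auto simp: r_coset_def)
    have "h \<in> carrier (mixed_braid g k n)"
      using h N.subset by auto
    then have "forget g k n y = forget g k n h \<otimes>\<^bsub>surface_braid g n\<^esub> forget g k n x"
      using h x forget_hom[of g k n] by (auto simp: hom_def)
    moreover have fh: "forget g k n h \<in> ?N'"
      using hom_lower_central[OF _ _ forget_hom h(1)] by simp
    moreover have "forget g k n x \<in> carrier (surface_braid g n)"
      using forget_hom x by (rule hom_in_carrier)
    ultimately show ?thesis
      using N'.coset_mult_assoc[of ?N' "forget g k n h" "forget g k n x"] N'.subset
        N'.coset_join2[OF _ N'.subgroup_axioms fh] by auto
  qed
  moreover have "x \<in> ?N #>\<^bsub>mixed_braid g k n\<^esub> x"
    using x by (rule N.rcos_self) (rule N.subgroup_axioms)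
  ultimately show ?thesis
    unfolding forget_quot_def quot_map_def mixed_proj_def surface_proj_def by blast
qed

lemma forget_quot_epi: "forget_quot i g k n \<in> epi (mixed_quot i g k n) (surface_quot i g n)"
proof -
  have car: "carrier (mixed_quot i g k n) = mixed_proj i g k n ` carrier (mixed_braid g k n)"
    "carrier (surface_quot i g n) = surface_proj i g n ` carrier (surface_braid g n)"
    using proj_epi by (auto simp: epi_def)
  have "forget_quot i g k n \<in> hom (mixed_quot i g k n) (surface_quot i g n)"
  proof (rule homI)
    fix X assume "X \<in> carrier (mixed_quot i g k n)"
    then show "forget_quot i g k n X \<in> carrier (surface_quot i g n)"
      using hom_in_carrier[OF forget_hom] by (auto simp: car forget_quot_proj)
  next
    fix X Y assume "X \<in> carrier (mixed_quot i g k n)" "Y \<in> carrier (mixed_quot i g k n)"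
    then obtain x y where xy: "X = mixed_proj i g k n x" "Y = mixed_proj i g k n y"
      "x \<in> carrier (mixed_braid g k n)" "y \<in> carrier (mixed_braid g k n)"
      by (auto simp: car)
    then have "x \<otimes>\<^bsub>mixed_braid g k n\<^esub> y \<in> carrier (mixed_braid g k n)"
      by (simp add: group.is_monoid monoid.m_closed)
    then show "forget_quot i g k n (X \<otimes>\<^bsub>mixed_quot i g k n\<^esub> Y)
      = forget_quot i g k n X \<otimes>\<^bsub>surface_quot i g n\<^esub> forget_quot i g k n Y"
      using xy hom_in_carrier[OF forget_hom]
      by (simp add: forget_quot_proj hom_mult[OF forget_hom] hom_mult[OF proj_hom(2)] flip: hom_mult[OF proj_hom(1)])
  qed
  moreover have "surface_proj i g n y \<in> forget_quot i g k n ` carrier (mixed_quot i g k n)"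
    if "y \<in> carrier (surface_braid g n)" for y
  proof (rule image_eqI)
    have "section_map g k n y \<in> carrier (mixed_braid g k n)"
      using inclusion_homs(5) that by (rule hom_in_carrier)
    then show "surface_proj i g n y = forget_quot i g k n (mixed_proj i g k n (section_map g k n y))"
      "mixed_proj i g k n (section_map g k n y) \<in> carrier (mixed_quot i g k n)"
      using that by (auto simp: forget_quot_proj forget_section car)
  qed
  ultimately show ?thesis
    by (auto simp: epi_iff_subset car(2))
qed

section \<open>Collapse of the Artin generators modulo \<Gamma>_2 and \<Gamma>_3\<close>

text \<open>Centrality is phrased as the vanishing of h on an iterated commutator, the form in which
  \<open>commutator_central_mod_lower_central\<close> supplies it for a projection.\<close>

lemma (in group_hom) braid_collapse:
  assumes a: "a \<in> carrier G" and b: "b \<in> carrier G"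
    and braid: "h a \<otimes>\<^bsub>H\<^esub> h b \<otimes>\<^bsub>H\<^esub> h a = h b \<otimes>\<^bsub>H\<^esub> h a \<otimes>\<^bsub>H\<^esub> h b"
    and central: "h (b \<otimes> (a \<otimes> b \<otimes> inv a \<otimes> inv b) \<otimes> inv b \<otimes> inv (a \<otimes> b \<otimes> inv a \<otimes> inv b)) = \<one>\<^bsub>H\<^esub>"
  shows "h a = h b"
proof -
  define c where "c = a \<otimes> b \<otimes> inv a \<otimes> inv b"
  have c: "c \<in> carrier G" using a b by (simp add: c_def)
  have "h b \<otimes>\<^bsub>H\<^esub> h c \<otimes>\<^bsub>H\<^esub> inv\<^bsub>H\<^esub> h b \<otimes>\<^bsub>H\<^esub> inv\<^bsub>H\<^esub> h c = \<one>\<^bsub>H\<^esub>"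
    using central b c by (simp flip: c_def)
  then have "h b \<otimes>\<^bsub>H\<^esub> h c \<otimes>\<^bsub>H\<^esub> inv\<^bsub>H\<^esub> h b = h c"
    using b c by (simp add: H.inv_solve_right')
  then have "h b \<otimes>\<^bsub>H\<^esub> h c = h c \<otimes>\<^bsub>H\<^esub> h b"
    using b c by (simp add: H.inv_solve_right')
  moreover have "h c = h a \<otimes>\<^bsub>H\<^esub> h b \<otimes>\<^bsub>H\<^esub> inv\<^bsub>H\<^esub> h a \<otimes>\<^bsub>H\<^esub> inv\<^bsub>H\<^esub> h b"
    using a b by (simp add: c_def)
  ultimately show ?thesis
    using H.braid_relation_collapse[OF hom_closed[OF a] hom_closed[OF b] braid] by metis
qed

lemma quotient_braid_collapse:
  fixes P :: "'x presentation"
  defines "G \<equiv> presented_group P"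
  assumes i: "i \<in> {2, 3}" and x: "x \<in> fst P" and y: "y \<in> fst P"
    and braid: "(pos [x, y, x], pos [y, x, y]) \<in> snd P"
  shows "\<Gamma> G i #>\<^bsub>G\<^esub> gen_of P x = \<Gamma> G i #>\<^bsub>G\<^esub> gen_of P y"
proof -
  interpret G: group G by (simp add: G_def group_presented)
  interpret N: normal "\<Gamma> G i" G by (rule G.normal_lower_central)
  interpret h: group_hom G "G Mod \<Gamma> G i" "\<lambda>a. \<Gamma> G i #>\<^bsub>G\<^esub> a"
    using N.factorgroup_is_group N.r_coset_hom_Mod G.is_group by (simp add: group_hom_def group_hom_axioms_def)
  let ?h = "\<lambda>a. \<Gamma> G i #>\<^bsub>G\<^esub> a" and ?a = "gen_of P x" and ?b = "gen_of P y"
  have ab: "?a \<in> carrier G" "?b \<in> carrier G"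
    using x y by (simp_all add: G_def gen_of_closed)
  have "weval (G Mod \<Gamma> G i) (\<lambda>x. ?h (gen_of P x)) (pos [x, y, x])
      = weval (G Mod \<Gamma> G i) (\<lambda>x. ?h (gen_of P x)) (pos [y, x, y])"
    using braid x y N.factorgroup_is_group N.r_coset_hom_Mod
    by (intro hom_relation) (auto simp: pos_def G_def)
  then have "?h ?a \<otimes>\<^bsub>G Mod \<Gamma> G i\<^esub> (?h ?b \<otimes>\<^bsub>G Mod \<Gamma> G i\<^esub> (?h ?a \<otimes>\<^bsub>G Mod \<Gamma> G i\<^esub> \<one>\<^bsub>G Mod \<Gamma> G i\<^esub>))
      = ?h ?b \<otimes>\<^bsub>G Mod \<Gamma> G i\<^esub> (?h ?a \<otimes>\<^bsub>G Mod \<Gamma> G i\<^esub> (?h ?b \<otimes>\<^bsub>G Mod \<Gamma> G i\<^esub> \<one>\<^bsub>G Mod \<Gamma> G i\<^esub>))"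
    by (simp only: pos_def list.map weval_Cons weval_Nil if_True)
  then have "?h ?a \<otimes>\<^bsub>G Mod \<Gamma> G i\<^esub> ?h ?b \<otimes>\<^bsub>G Mod \<Gamma> G i\<^esub> ?h ?a
      = ?h ?b \<otimes>\<^bsub>G Mod \<Gamma> G i\<^esub> ?h ?a \<otimes>\<^bsub>G Mod \<Gamma> G i\<^esub> ?h ?b"
    using h.hom_closed[OF ab(1)] h.hom_closed[OF ab(2)] by (simp only: h.H.r_one h.H.m_assoc)
  then show ?thesis
    using G.commutator_central_mod_lower_central[OF i ab ab(2)] ab
    by (intro h.braid_collapse N.quotient_kernel[THEN iffD2]) simp_all
qed

text \<open>Adjacent generators satisfy a braid relation, hence have equal classes; induction on the
  index links each of them to the first.\<close>

lemma sigma_collapse: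
  assumes i: "i \<in> {2, 3}"
  shows "j \<in> {1..<k} \<Longrightarrow> mixed_proj i g k n (gen_of (mixed_pres g k n) (S j))
      = mixed_proj i g k n (gen_of (mixed_pres g k n) (S 1))"
    and "j \<in> {1..<n} \<Longrightarrow> mixed_proj i g k n (gen_of (mixed_pres g k n) (St j))
      = mixed_proj i g k n (gen_of (mixed_pres g k n) (St 1))"
    and "j \<in> {1..<n} \<Longrightarrow> surface_proj i g n (gen_of (surface_pres g n) (St j))
      = surface_proj i g n (gen_of (surface_pres g n) (St 1))"
proof -
  have step: "F (s j) = F (s 1)"
    if "j \<in> {1..<m}" "\<And>j. j \<in> {1..<m} \<Longrightarrow> j + 1 \<in> {1..<m} \<Longrightarrow> F (s j) = F (s (j + 1))"
    for F :: "letter \<Rightarrow> letter word set set" and s :: "nat \<Rightarrow> letter" and m j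
  proof -
    have "1 \<le> j" using that by simp
    then show ?thesis using that(1)
    proof (induction j rule: dec_induct)
      case (step j)
      then show ?case using that(2)[of j] by simp
    qed simp
  qed
  show "j \<in> {1..<k} \<Longrightarrow> mixed_proj i g k n (gen_of (mixed_pres g k n) (S j))
      = mixed_proj i g k n (gen_of (mixed_pres g k n) (S 1))"
    by (rule step, assumption, unfold mixed_proj_def mixed_braid_def, rule quotient_braid_collapse[OF i])
      (auto simp: fst_pres snd_pres sigmas_def simp del: One_nat_def intro: braid_rels.braid)
  show "j \<in> {1..<n} \<Longrightarrow> mixed_proj i g k n (gen_of (mixed_pres g k n) (St j))
      = mixed_proj i g k n (gen_of (mixed_pres g k n) (St 1))"
    by (rule step, assumption, unfold mixed_proj_def mixed_braid_def, rule quotient_braid_collapse[OF i])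
      (auto simp: fst_pres snd_pres sigmas_def simp del: One_nat_def intro: braid_rels.braid)
  show "j \<in> {1..<n} \<Longrightarrow> surface_proj i g n (gen_of (surface_pres g n) (St j))
      = surface_proj i g n (gen_of (surface_pres g n) (St 1))"
    by (rule step, assumption, unfold surface_proj_def surface_braid_def, rule quotient_braid_collapse[OF i])
      (auto simp: fst_pres snd_pres sigmas_def simp del: One_nat_def intro: braid_rels.braid)
qed

section \<open>Homomorphisms as central representations, and comparison of their kernels\<close>

lemma hom_mixed_rep:
  assumes "group H" "\<rho> \<in> hom (mixed_braid g k n) H" "k \<ge> 3" "n \<ge> 3"
    and "\<And>i. i \<in> {1..<k} \<Longrightarrow> \<rho> (gen_of (mixed_pres g k n) (S i)) = s"
    and "\<And>i. i \<in> {1..<n} \<Longrightarrow> \<rho> (gen_of (mixed_pres g k n) (St i)) = t"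
  shows "central_rep H s (\<rho> (gen_of (mixed_pres g k n) (Zeta 1))) t (fst (mixed_pres g k n))
      (\<lambda>x. \<rho> (gen_of (mixed_pres g k n) x))" (is ?rep)
    and "i \<in> {1..n} \<Longrightarrow> \<rho> (gen_of (mixed_pres g k n) (Zeta i)) = \<rho> (gen_of (mixed_pres g k n) (Zeta 1))"
proof -
  have closed: "(\<lambda>x. \<rho> (gen_of (mixed_pres g k n) x)) \<in> fst (mixed_pres g k n) \<rightarrow> carrier H"
    using assms(2) gen_mem by (auto simp: hom_def)
  have rels: "weval H (\<lambda>x. \<rho> (gen_of (mixed_pres g k n) x)) u = weval H (\<lambda>x. \<rho> (gen_of (mixed_pres g k n) x)) v"
    if "(u, v) \<in> snd (mixed_pres g k n)" for u v
    using hom_relation[OF assms(1) assms(2)[unfolded mixed_braid_def] that] pres_words(3)[OF that] by blast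
  note rep = group.mixed_central_rep[OF assms(1) closed rels assms(3,4), of s t]
  show ?rep by (rule rep(1)) (use assms in auto)
  show "i \<in> {1..n} \<Longrightarrow> \<rho> (gen_of (mixed_pres g k n) (Zeta i)) = \<rho> (gen_of (mixed_pres g k n) (Zeta 1))"
    by (rule rep(2)) (use assms in auto)
qed

lemma hom_surface_rep:
  assumes "group H" "\<rho> \<in> hom (surface_braid g n) H" "n \<ge> 3"
    and "\<And>i. i \<in> {1..<n} \<Longrightarrow> \<rho> (gen_of (surface_pres g n) (St i)) = t"
  shows "central_rep H \<one>\<^bsub>H\<^esub> \<one>\<^bsub>H\<^esub> t (fst (surface_pres g n)) (\<lambda>x. \<rho> (gen_of (surface_pres g n) x))"
proof (rule group.surface_central_rep[OF assms(1) _ _ assms(3)])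
  show "(\<lambda>x. \<rho> (gen_of (surface_pres g n) x)) \<in> fst (surface_pres g n) \<rightarrow> carrier H"
    using assms(2) gen_mem by (auto simp: hom_def)
  show "weval H (\<lambda>x. \<rho> (gen_of (surface_pres g n) x)) u = weval H (\<lambda>x. \<rho> (gen_of (surface_pres g n) x)) v"
    if "(u, v) \<in> snd (surface_pres g n)" for u v
    using hom_relation[OF assms(1) assms(2)[unfolded surface_braid_def] that] pres_words(2)[OF that] by blast
qed (use assms in auto)

lemma hom_punctured_rep:
  assumes "group H" "\<rho> \<in> hom (punctured_braid g k n) H" "k \<ge> 3" "n \<ge> 1"
    and "\<And>i. i \<in> {1..<k} \<Longrightarrow> \<rho> (gen_of (punctured_pres g k n) (S i)) = s"
    and "\<And>i. i \<in> {1..n} \<Longrightarrow> \<rho> (gen_of (punctured_pres g k n) (Zeta i)) = z"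
  shows "central_rep H s z \<one>\<^bsub>H\<^esub> (fst (punctured_pres g k n)) (\<lambda>x. \<rho> (gen_of (punctured_pres g k n) x))"
proof (rule group.punctured_central_rep[OF assms(1) _ _ assms(3,4)])
  show "(\<lambda>x. \<rho> (gen_of (punctured_pres g k n) x)) \<in> fst (punctured_pres g k n) \<rightarrow> carrier H"
    using assms(2) gen_mem by (auto simp: hom_def)
  show "weval H (\<lambda>x. \<rho> (gen_of (punctured_pres g k n) x)) u = weval H (\<lambda>x. \<rho> (gen_of (punctured_pres g k n) x)) v"
    if "(u, v) \<in> snd (punctured_pres g k n)" for u v
    using hom_relation[OF assms(1) assms(2)[unfolded punctured_braid_def] that] pres_words(1)[OF that] by blast
qed (use assms in auto)

text \<open>\<open>central_rep_kernel\<close> transfers triviality in one direction and needs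
  independence at its source; independence on both sides gives the equivalence.\<close>

lemma rep_same_kernel:
  assumes "\<rho> \<in> hom (presented_group P) H" "\<rho>' \<in> hom (presented_group P) H'"
    and rep: "central_rep H s z t (fst P) (\<lambda>x. \<rho> (gen_of P x))"
    and rep': "central_rep H' s' z' t' (fst P) (\<lambda>x. \<rho>' (gen_of P x))"
    and "paired (fst P)"
    and "\<And>c. c \<in> weights (fst P) \<Longrightarrow> kap H s z t c = \<one>\<^bsub>H\<^esub> \<Longrightarrow> c = 0"
    and "\<And>c. c \<in> weights (fst P) \<Longrightarrow> kap H' s' z' t' c = \<one>\<^bsub>H'\<^esub> \<Longrightarrow> c = 0"
    and "x \<in> carrier (presented_group P)"
  shows "\<rho> x = \<one>\<^bsub>H\<^esub> \<longleftrightarrow> \<rho>' x = \<one>\<^bsub>H'\<^esub>"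
proof -
  have H: "group H" "group H'"
    using rep rep' by (simp_all add: central_rep_def central_triple_def)
  obtain w where w: "x = wclass P w" "w \<in> words (fst P)"
    using assms(8) by (auto simp: carrier_presented)
  then show ?thesis
    using hom_wclass[OF H(1) assms(1) w(2)] hom_wclass[OF H(2) assms(2) w(2)]
      central_rep_kernel[OF rep rep' assms(5,6) w(2)] central_rep_kernel[OF rep' rep assms(5,7) w(2)]
    by auto
qed

lemma paired_pres:
  "paired (fst (mixed_pres g k n))" "paired (fst (punctured_pres g k n))" "paired (fst (surface_pres g n))"
  by (auto simp: paired_def fst_pres sigmas_def handles_def zetas_def)

text \<open>Justifies the neutral element in the slot of t: independence is tested only on exponents
  whose third entry is 0.\<close>

lemma weights_punctured: "c \<in> weights (fst (punctured_pres g k n)) \<Longrightarrow> snd (snd c) = 0"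
proof (induction rule: weights.induct)
  case (comm_form x y)
  then show ?case
    by (auto simp: fst_pres sigmas_def handles_def zetas_def comm_form_def bform_def)
qed (auto simp: fst_pres sigmas_def handles_def zetas_def wt_def)

lemma weights_surface: "c \<in> weights (fst (surface_pres g n)) \<Longrightarrow> fst c = 0 \<and> fst (snd c) = 0"
proof (induction rule: weights.induct)
  case (comm_form x y)
  then show ?case
    by (auto simp: fst_pres sigmas_def handles_def zetas_def comm_form_def bform_def)
qed (auto simp: fst_pres sigmas_def handles_def zetas_def wt_def)

text \<open>Here y may be a tilde letter, which \<open>weights_punctured\<close> does not cover. A
  nonzero third entry of \<open>comm_form\<close> arises only between two tilde letters.\<close>

lemma comm_exp_punctured:
  assumes "w \<in> words (fst (punctured_pres g k n))"
  shows "snd (snd (comm_exp w y)) = 0"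
  using assms
proof (induction w)
  case (Cons a w)
  obtain x e where a: "a = (x, e)" by fastforce
  then have "x \<in> range S \<union> range A \<union> range B \<union> range Zeta"
    using Cons.prems by (auto simp: fst_pres sigmas_def handles_def zetas_def)
  then have "snd (snd (bform x y)) = 0" "snd (snd (bform y x)) = 0"
    by (auto simp: bform_def split: letter.split)
  then have "snd (snd (comm_form x y)) = 0"
    by (simp add: comm_form_def)
  then show ?case
    using Cons by (cases e) (auto simp: a)
qed simp

lemma group_homI: "group G \<Longrightarrow> group H \<Longrightarrow> h \<in> hom G H \<Longrightarrow> group_hom G H h"
  by (simp add: group_hom_def group_hom_axioms_def)

section \<open>Independence of s, z and t in the quotients\<close>

lemma mixed_letters:
  assumes "k \<ge> 3" "n \<ge> 3"
  shows "S 1 \<in> fst (mixed_pres g k n)" "Zeta 1 \<in> fst (mixed_pres g k n)" "St 1 \<in> fst (mixed_pres g k n)"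
    "S 1 \<in> fst (punctured_pres g k n)" "Zeta 1 \<in> fst (punctured_pres g k n)" "St 1 \<in> fst (surface_pres g n)"
  using assms by (auto simp: fst_pres sigmas_def zetas_def)

lemma mixed_quot_independent:
  assumes "i = 2 \<and> g = 0 \<or> i = 3" and kn: "k \<ge> 3" "n \<ge> 3"
    and c: "kap (mixed_quot i g k n) (mixed_proj i g k n (gen_of (mixed_pres g k n) (S 1)))
      (mixed_proj i g k n (gen_of (mixed_pres g k n) (Zeta 1)))
      (mixed_proj i g k n (gen_of (mixed_pres g k n) (St 1))) c = \<one>\<^bsub>mixed_quot i g k n\<^esub>"
  shows "c = 0"
proof -
  let ?P = "mixed_pres g k n"
  interpret h: group_hom "mixed_braid g k n" "mixed_quot i g k n" "mixed_proj i g k n"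
    by (rule group_homI) (simp_all add: proj_hom)
  have mem: "gen_of ?P (S 1) \<in> carrier (mixed_braid g k n)" "gen_of ?P (Zeta 1) \<in> carrier (mixed_braid g k n)"
    "gen_of ?P (St 1) \<in> carrier (mixed_braid g k n)"
    using mixed_letters[OF kn] by (simp_all add: gen_mem del: One_nat_def)
  let ?x = "kap (mixed_braid g k n) (gen_of ?P (S 1)) (gen_of ?P (Zeta 1)) (gen_of ?P (St 1)) c"
  have "mixed_proj i g k n ?x = \<one>\<^bsub>mixed_quot i g k n\<^esub>"
    using c hom_kap[OF h.group_hom_axioms mem] by simp
  moreover have "?x \<in> carrier (mixed_braid g k n)"
    using mem by (simp add: kap_def)
  ultimately show ?thesis
    using mixed_independent[OF assms(1), of k n c] kn proj_kernel(1) by simp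
qed

text \<open>The section of \<open>forget\<close> carries the question into a mixed group, where the
  model detects t.\<close>

lemma surface_quot_independent:
  assumes i: "i = 2 \<and> g = 0 \<or> i = 3" and n: "n \<ge> 3"
    and c0: "fst c = 0 \<and> fst (snd c) = 0"
    and c: "kap (surface_quot i g n) \<one>\<^bsub>surface_quot i g n\<^esub> \<one>\<^bsub>surface_quot i g n\<^esub>
      (surface_proj i g n (gen_of (surface_pres g n) (St 1))) c = \<one>\<^bsub>surface_quot i g n\<^esub>"
  shows "c = 0"
proof -
  let ?k = "3 :: nat"
  let ?P = "mixed_pres g ?k n" and ?t = "gen_of (surface_pres g n) (St 1)"
  interpret h: group_hom "surface_braid g n" "surface_quot i g n" "surface_proj i g n"
    by (rule group_homI) (simp_all add: proj_hom)
  interpret s: group_hom "surface_braid g n" "mixed_braid g ?k n" "section_map g ?k n"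
    by (rule group_homI) (simp_all add: inclusion_homs)
  note letters = mixed_letters[OF le_refl n, of g]
  have t: "?t \<in> carrier (surface_braid g n)"
    using letters by (simp add: gen_mem del: One_nat_def)
  let ?x = "kap (surface_braid g n) \<one>\<^bsub>surface_braid g n\<^esub> \<one>\<^bsub>surface_braid g n\<^esub> ?t c"
  have "surface_proj i g n ?x = \<one>\<^bsub>surface_quot i g n\<^esub>"
    using c hom_kap[OF h.group_hom_axioms _ _ t] by simp
  moreover have "?x \<in> carrier (surface_braid g n)"
    using t by (simp add: kap_def)
  ultimately have "?x \<in> \<Gamma> (surface_braid g n) i"
    using proj_kernel(2) by simp
  then have "section_map g ?k n ?x \<in> \<Gamma> (mixed_braid g ?k n) i"
    using hom_lower_central[OF _ _ inclusion_homs(5)] by simp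
  also have "section_map g ?k n ?x = kap (mixed_braid g ?k n) \<one>\<^bsub>mixed_braid g ?k n\<^esub> \<one>\<^bsub>mixed_braid g ?k n\<^esub> (gen_of ?P (St 1)) c"
    using hom_kap[OF s.group_hom_axioms _ _ t] inclusion_gens(5)[OF letters(6)] by simp
  also have "\<dots> = kap (mixed_braid g ?k n) (gen_of ?P (S 1)) (gen_of ?P (Zeta 1)) (gen_of ?P (St 1)) c"
    using c0 by (simp add: kap_def)
  finally show ?thesis
    using mixed_independent[OF i, of ?k n c] n by simp
qed

section \<open>The kernel G_k and the projection onto it\<close>

lemma kernel_quot_simps [simp]:
  "\<one>\<^bsub>kernel_quot i g k n\<^esub> = \<one>\<^bsub>mixed_quot i g k n\<^esub>"
  "x \<otimes>\<^bsub>kernel_quot i g k n\<^esub> y = x \<otimes>\<^bsub>mixed_quot i g k n\<^esub> y"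
  "carrier (kernel_quot i g k n) = kernel (mixed_quot i g k n) (surface_quot i g n) (forget_quot i g k n)"
  by (simp_all add: kernel_quot_def kernel_group_def)

lemma forget_quot_group_hom: "group_hom (mixed_quot i g k n) (surface_quot i g n) (forget_quot i g k n)"
  using forget_quot_epi by (intro group_homI) (simp_all add: epi_def)

lemma group_kernel_quot [simp]: "group (kernel_quot i g k n)"
  using subgroup.subgroup_is_group[OF group_hom.subgroup_kernel[OF forget_quot_group_hom]]
  by (simp add: kernel_quot_def kernel_group_def)

lemma kernel_inclusion: "group_hom (kernel_quot i g k n) (mixed_quot i g k n) (\<lambda>x. x)"
  by (intro group_homI) (auto simp: hom_def kernel_def)

lemma kernel_proj_gen:
  "x \<in> fst (punctured_pres g k n) \<Longrightarrow>
    kernel_proj i g k n (gen_of (punctured_pres g k n) x) = mixed_proj i g k n (gen_of (mixed_pres g k n) x)"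
  by (simp add: kernel_proj_def inclusion_gens)

lemma kernel_proj_hom: "kernel_proj i g k n \<in> hom (punctured_braid g k n) (kernel_quot i g k n)"
proof -
  interpret f: group_hom "surface_braid g n" "surface_quot i g n" "surface_proj i g n"
    by (rule group_homI) (simp_all add: proj_hom)
  have "kernel_proj i g k n \<in> hom (punctured_braid g k n) (mixed_quot i g k n)"
    unfolding kernel_proj_def by (rule Group.hom_compose[OF inclusion_homs(1) proj_hom(1)])
  moreover have "kernel_proj i g k n x \<in> carrier (kernel_quot i g k n)"
    if "x \<in> carrier (punctured_braid g k n)" for x
    using that hom_in_carrier[OF inclusion_homs(1) that] hom_in_carrier[OF proj_hom(1)] f.hom_one
    by (simp add: kernel_def kernel_proj_def forget_quot_proj forget_incl)
  ultimately show ?thesis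
    by (auto simp: hom_def)
qed

text \<open>An equation in the kernel is one in the mixed quotient; as the third exponent is 0, the
  neutral element in the slot of t can be traded for the class of \<open>St 1\<close>.\<close>

lemma kernel_quot_independent:
  assumes i: "i = 2 \<and> g = 0 \<or> i = 3" and kn: "k \<ge> 3" "n \<ge> 3"
    and c0: "snd (snd c) = 0"
    and c: "kap (kernel_quot i g k n) (kernel_proj i g k n (gen_of (punctured_pres g k n) (S 1)))
      (kernel_proj i g k n (gen_of (punctured_pres g k n) (Zeta 1))) \<one>\<^bsub>kernel_quot i g k n\<^esub> c
      = \<one>\<^bsub>kernel_quot i g k n\<^esub>"
  shows "c = 0"
proof -
  interpret M: group "mixed_quot i g k n" by simp
  interpret K: group "kernel_quot i g k n" by simp
  note letters = mixed_letters[OF kn, of g]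
  have mem: "kernel_proj i g k n (gen_of (punctured_pres g k n) (S 1)) \<in> carrier (kernel_quot i g k n)"
    "kernel_proj i g k n (gen_of (punctured_pres g k n) (Zeta 1)) \<in> carrier (kernel_quot i g k n)"
    using letters(4,5) by (auto simp only: intro!: hom_in_carrier[OF kernel_proj_hom] gen_mem)
  have "kap (mixed_quot i g k n) (mixed_proj i g k n (gen_of (mixed_pres g k n) (S 1)))
      (mixed_proj i g k n (gen_of (mixed_pres g k n) (Zeta 1))) \<one>\<^bsub>mixed_quot i g k n\<^esub> c
      = \<one>\<^bsub>mixed_quot i g k n\<^esub>"
    using c hom_kap[OF kernel_inclusion mem K.one_closed, of c] letters(4,5)
    by (simp only: kernel_proj_gen kernel_quot_simps)
  then show ?thesis
    using mixed_quot_independent[OF i kn, of c] c0 by (simp add: kap_def)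
qed

lemma mixed_proj_rep:
  assumes i: "i \<in> {2, 3}" and kn: "k \<ge> 3" "n \<ge> 3"
  shows "central_rep (mixed_quot i g k n) (mixed_proj i g k n (gen_of (mixed_pres g k n) (S 1)))
      (mixed_proj i g k n (gen_of (mixed_pres g k n) (Zeta 1)))
      (mixed_proj i g k n (gen_of (mixed_pres g k n) (St 1)))
      (fst (mixed_pres g k n)) (\<lambda>x. mixed_proj i g k n (gen_of (mixed_pres g k n) x))"
    and "j \<in> {1..n} \<Longrightarrow> mixed_proj i g k n (gen_of (mixed_pres g k n) (Zeta j))
      = mixed_proj i g k n (gen_of (mixed_pres g k n) (Zeta 1))"
  using hom_mixed_rep[OF quotient_groups(1) proj_hom(1) kn sigma_collapse(1)[OF i] sigma_collapse(2)[OF i]]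
  by blast+

text \<open>The equality of the \<open>Zeta j\<close> is read off in the mixed quotient, where the
  tilde generators conjugate them into one another.\<close>

lemma kernel_proj_collapse:
  assumes i: "i \<in> {2, 3}" and kn: "k \<ge> 3" "n \<ge> 3"
  shows "j \<in> {1..<k} \<Longrightarrow> kernel_proj i g k n (gen_of (punctured_pres g k n) (S j))
      = kernel_proj i g k n (gen_of (punctured_pres g k n) (S 1))"
    and "j \<in> {1..n} \<Longrightarrow> kernel_proj i g k n (gen_of (punctured_pres g k n) (Zeta j))
      = kernel_proj i g k n (gen_of (punctured_pres g k n) (Zeta 1))"
proof -
  have mem: "j \<in> {1..<k} \<Longrightarrow> S j \<in> fst (punctured_pres g k n)" "j \<in> {1..n} \<Longrightarrow> Zeta j \<in> fst (punctured_pres g k n)"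
    by (auto simp: fst_pres sigmas_def zetas_def)
  show "j \<in> {1..<k} \<Longrightarrow> kernel_proj i g k n (gen_of (punctured_pres g k n) (S j))
      = kernel_proj i g k n (gen_of (punctured_pres g k n) (S 1))"
    using kernel_proj_gen[OF mem(1)] kernel_proj_gen[OF mixed_letters(4)[OF kn]] sigma_collapse(1)[OF i]
    by metis
  show "j \<in> {1..n} \<Longrightarrow> kernel_proj i g k n (gen_of (punctured_pres g k n) (Zeta j))
      = kernel_proj i g k n (gen_of (punctured_pres g k n) (Zeta 1))"
    using kernel_proj_gen[OF mem(2)] kernel_proj_gen[OF mixed_letters(5)[OF kn]] mixed_proj_rep(2)[OF i kn]
    by metis
qed

text \<open>Modulo \<open>\<Gamma>\<close>, conjugating a word in the punctured letters by a letter with a tilde only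
  multiplies it by central elements of the punctured group, so every class is a product of a
  punctured class and a tilde class.\<close>

lemma mixed_quot_factor:
  assumes i: "i \<in> {2, 3}" and kn: "k \<ge> 3" "n \<ge> 3" and w: "w \<in> words (fst (mixed_pres g k n))"
  defines "f \<equiv> \<lambda>x. mixed_proj i g k n (gen_of (mixed_pres g k n) x)"
  shows "\<exists>a \<in> carrier (punctured_braid g k n). \<exists>v \<in> carrier (surface_braid g n).
    weval (mixed_quot i g k n) f w = kernel_proj i g k n a \<otimes>\<^bsub>mixed_quot i g k n\<^esub> mixed_proj i g k n (section_map g k n v)"
proof -
  let ?Q = "mixed_quot i g k n" and ?\<tau> = "\<lambda>v. mixed_proj i g k n (section_map g k n v)"
  interpret K: group_hom "punctured_braid g k n" ?Q "kernel_proj i g k n"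
    using kernel_proj_hom[of i g k n] by (intro group_homI) (auto simp: hom_def kernel_def)
  interpret T: group_hom "surface_braid g n" ?Q ?\<tau>
    using Group.hom_compose[OF inclusion_homs(5) proj_hom(1)] by (intro group_homI) (simp_all add: comp_def)
  note letters = mixed_letters[OF kn, of g]
  interpret R: central_rep ?Q "f (S 1)" "f (Zeta 1)" "f (St 1)" "fst (mixed_pres g k n)" f
    using mixed_proj_rep(1)[OF i kn] unfolding f_def .
  let ?N = "kernel_proj i g k n ` carrier (punctured_braid g k n)"
  have N: "subgroup ?N ?Q"
    by (rule K.img_is_subgroup)
  have fN: "f x \<in> ?N" if "x \<in> fst (punctured_pres g k n)" for x
    using kernel_proj_gen[OF that, of i] gen_mem(2)[OF that] unfolding f_def by (metis imageI)
  \<comment> \<open>A central element without t-part is a product of powers of the values of the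
    punctured letters \<open>S 1\<close> and \<open>Zeta 1\<close>.\<close>
  have kapN: "R.\<kappa> c \<in> ?N" if "snd (snd c) = 0" for c
  proof -
    have "R.\<kappa> c = f (S 1) [^]\<^bsub>?Q\<^esub> fst c \<otimes>\<^bsub>?Q\<^esub> f (Zeta 1) [^]\<^bsub>?Q\<^esub> fst (snd c)"
      using that letters by (simp add: kap_def)
    then show ?thesis
      using fN[OF letters(4)] fN[OF letters(5)] N
      by (simp add: subgroup.m_closed K.H.subgroup_int_pow_closed)
  qed
  show ?thesis
    using w
  proof (induction w)
    case Nil
    have "weval ?Q f [] = kernel_proj i g k n \<one>\<^bsub>punctured_braid g k n\<^esub> \<otimes>\<^bsub>?Q\<^esub> ?\<tau> \<one>\<^bsub>surface_braid g n\<^esub>"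
      by simp
    then show ?case by blast
  next
    case (Cons b w)
    obtain x e where b: "b = (x, e)" by fastforce
    have x: "x \<in> fst (mixed_pres g k n)" and w: "w \<in> words (fst (mixed_pres g k n))"
      using Cons.prems by (auto simp: b)
    obtain a v where a: "a \<in> carrier (punctured_braid g k n)" and v: "v \<in> carrier (surface_braid g n)"
      and IH: "weval ?Q f w = kernel_proj i g k n a \<otimes>\<^bsub>?Q\<^esub> ?\<tau> v"
      using Cons.IH[OF w] by blast
    let ?l = "R.letter_val x e" and ?l' = "R.letter_val x (\<not> e)"
    have step: "weval ?Q f (b # w) = ?l \<otimes>\<^bsub>?Q\<^esub> (kernel_proj i g k n a \<otimes>\<^bsub>?Q\<^esub> ?\<tau> v)"
      by (simp only: b R.weval_letter IH)
    have split: "\<exists>a \<in> carrier (punctured_braid g k n). \<exists>v \<in> carrier (surface_braid g n).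
        weval ?Q f (b # w) = kernel_proj i g k n a \<otimes>\<^bsub>?Q\<^esub> ?\<tau> v"
      if "weval ?Q f (b # w) = m \<otimes>\<^bsub>?Q\<^esub> ?\<tau> v'" "m \<in> ?N" "v' \<in> carrier (surface_braid g n)" for m v'
      using that by auto
    consider "x \<in> fst (punctured_pres g k n)" | "x \<in> fst (surface_pres g n)"
      using x by (auto simp: fst_pres)
    then show ?case
    proof cases
      case 1
      have "?l \<in> ?N"
        using fN[OF 1] subgroup.m_inv_closed[OF N] by (simp add: R.letter_val_def)
      then have "?l \<otimes>\<^bsub>?Q\<^esub> kernel_proj i g k n a \<in> ?N"
        using a N by (intro subgroup.m_closed) auto
      moreover have "weval ?Q f (b # w) = ?l \<otimes>\<^bsub>?Q\<^esub> kernel_proj i g k n a \<otimes>\<^bsub>?Q\<^esub> ?\<tau> v"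
        unfolding step using x a v by (simp add: K.H.m_assoc)
      ultimately show ?thesis
        using split v by blast
    next
      case 2
      let ?y = "gen_of (surface_pres g n) x"
      define y' where "y' = (if e then ?y else inv\<^bsub>surface_braid g n\<^esub> ?y)"
      have y: "?y \<in> carrier (surface_braid g n)"
        using 2 by (rule gen_mem)
      have "?\<tau> ?y = f x"
        by (simp add: f_def inclusion_gens(5)[OF 2])
      then have y': "y' \<in> carrier (surface_braid g n)" "?l = ?\<tau> y'"
        using y by (simp_all add: y'_def R.letter_val_def)
      obtain u where u: "a = wclass (punctured_pres g k n) u" "u \<in> words (fst (punctured_pres g k n))"
        using a by (auto simp: punctured_braid_def carrier_presented)
      then have u': "u \<in> words (fst (mixed_pres g k n))"
        using fst_pres_mono(4)[of g k n] by (auto simp: words_def)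
      have "kernel_proj i g k n a = weval ?Q (\<lambda>x. kernel_proj i g k n (gen_of (punctured_pres g k n) x)) u"
        unfolding u(1) using K.homh by (intro hom_wclass u(2)) (simp_all add: punctured_braid_def)
      also have "\<dots> = weval ?Q f u"
        unfolding f_def by (rule weval_cong[OF u(2)]) (rule kernel_proj_gen)
      finally have au: "kernel_proj i g k n a = weval ?Q f u" .
      have "?l' \<otimes>\<^bsub>?Q\<^esub> ?l = \<one>\<^bsub>?Q\<^esub>"
        using R.letter_val_cancel[OF x, of "\<not> e"] by simp
      then have "?l' \<otimes>\<^bsub>?Q\<^esub> (?l \<otimes>\<^bsub>?Q\<^esub> ?\<tau> v) = ?\<tau> v"
        using x v by (simp flip: K.H.m_assoc)
      \<comment> \<open>Inserting \<open>?l'\<close> and \<open>?l\<close> moves the tilde letter to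
        the right of u. The conjugate of u differs from u by a central element without t-part, so
        the left factor stays in \<open>?N\<close>.\<close>
      then have "weval ?Q f (b # w) = ?l \<otimes>\<^bsub>?Q\<^esub> (weval ?Q f u \<otimes>\<^bsub>?Q\<^esub> ?l') \<otimes>\<^bsub>?Q\<^esub> (?l \<otimes>\<^bsub>?Q\<^esub> ?\<tau> v)"
        unfolding step au using x u' v by (simp add: K.H.m_assoc)
      also have "?l \<otimes>\<^bsub>?Q\<^esub> (weval ?Q f u \<otimes>\<^bsub>?Q\<^esub> ?l') = R.\<kappa> (- signed e (comm_exp u x)) \<otimes>\<^bsub>?Q\<^esub> kernel_proj i g k n a"
        unfolding au by (rule R.weval_conj[OF u' x])
      also have "?l \<otimes>\<^bsub>?Q\<^esub> ?\<tau> v = ?\<tau> (y' \<otimes>\<^bsub>surface_braid g n\<^esub> v)"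
        using y' v by simp
      finally have "weval ?Q f (b # w) = R.\<kappa> (- signed e (comm_exp u x)) \<otimes>\<^bsub>?Q\<^esub> kernel_proj i g k n a
        \<otimes>\<^bsub>?Q\<^esub> ?\<tau> (y' \<otimes>\<^bsub>surface_braid g n\<^esub> v)" .
      moreover have "R.\<kappa> (- signed e (comm_exp u x)) \<otimes>\<^bsub>?Q\<^esub> kernel_proj i g k n a \<in> ?N"
        using a comm_exp_punctured[OF u(2), of x] by (intro subgroup.m_closed[OF N] kapN) (auto simp: signed_def)
      ultimately show ?thesis
        using split y' v T.G.m_closed by blast
    qed
  qed
qed

text \<open>Write Y as the class of a punctured element times the class of a lifted v. The induced
  map sends Y to the class of v, so v lies in \<Gamma>_i; its lift then lies in \<Gamma>_i of the
  mixed group, and the second factor disappears.\<close>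

lemma kernel_proj_epi:
  assumes i: "i \<in> {2, 3}" and kn: "k \<ge> 3" "n \<ge> 3"
  shows "kernel_proj i g k n \<in> epi (punctured_braid g k n) (kernel_quot i g k n)"
proof -
  interpret Q: group "mixed_quot i g k n" by simp
  interpret F: group_hom "mixed_quot i g k n" "surface_quot i g n" "forget_quot i g k n"
    by (rule forget_quot_group_hom)
  interpret P: group_hom "surface_braid g n" "surface_quot i g n" "surface_proj i g n"
    by (rule group_homI) (simp_all add: proj_hom)
  have "Y \<in> kernel_proj i g k n ` carrier (punctured_braid g k n)" if Y: "Y \<in> carrier (kernel_quot i g k n)" for Y
  proof -
    have YQ: "Y \<in> carrier (mixed_quot i g k n)" and Y1: "forget_quot i g k n Y = \<one>\<^bsub>surface_quot i g n\<^esub>"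
      using Y by (simp_all add: kernel_def)
    have "mixed_proj i g k n ` carrier (mixed_braid g k n) = carrier (mixed_quot i g k n)"
      using proj_epi(1) by (simp add: epi_def)
    then obtain y where y: "Y = mixed_proj i g k n y" "y \<in> carrier (mixed_braid g k n)"
      using YQ by blast
    then obtain w where w: "y = wclass (mixed_pres g k n) w" "w \<in> words (fst (mixed_pres g k n))"
      by (auto simp: mixed_braid_def carrier_presented)
    then have Yw: "Y = weval (mixed_quot i g k n) (\<lambda>x. mixed_proj i g k n (gen_of (mixed_pres g k n) x)) w"
      using hom_wclass[OF Q.is_group proj_hom(1)[unfolded mixed_braid_def] w(2)] y by simp
    obtain a v where a: "a \<in> carrier (punctured_braid g k n)" and v: "v \<in> carrier (surface_braid g n)"
      and Yav: "Y = kernel_proj i g k n a \<otimes>\<^bsub>mixed_quot i g k n\<^esub> mixed_proj i g k n (section_map g k n v)"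
      using mixed_quot_factor[OF i kn w(2), folded Yw] by blast
    have sv: "section_map g k n v \<in> carrier (mixed_braid g k n)"
      using inclusion_homs(5) v by (rule hom_in_carrier)
    then have psv: "mixed_proj i g k n (section_map g k n v) \<in> carrier (mixed_quot i g k n)"
      using hom_in_carrier[OF proj_hom(1)] by blast
    have ka: "kernel_proj i g k n a \<in> carrier (mixed_quot i g k n)"
      "forget_quot i g k n (kernel_proj i g k n a) = \<one>\<^bsub>surface_quot i g n\<^esub>"
      using hom_in_carrier[OF kernel_proj_hom a] by (simp_all add: kernel_def)
    have "surface_proj i g n v = forget_quot i g k n Y"
      using ka psv v sv by (simp add: Yav forget_quot_proj forget_section)
    then have "v \<in> \<Gamma> (surface_braid g n) i"
      using Y1 proj_kernel(2) v by simp
    then have "section_map g k n v \<in> \<Gamma> (mixed_braid g k n) i"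
      using hom_lower_central[OF _ _ inclusion_homs(5)] by simp
    then have "mixed_proj i g k n (section_map g k n v) = \<one>\<^bsub>mixed_quot i g k n\<^esub>"
      using proj_kernel(1) sv by simp
    then have "Y = kernel_proj i g k n a"
      using Yav ka by simp
    then show ?thesis using a by blast
  qed
  then show ?thesis
    using kernel_proj_hom by (auto simp: epi_iff_subset simp del: kernel_quot_simps)
qed

section \<open>The universal properties\<close>

lemma mon_eq_one:
  assumes "group G" "group H" "j \<in> mon G H" "x \<in> carrier G" "j x = \<one>\<^bsub>H\<^esub>"
  shows "x = \<one>\<^bsub>G\<^esub>"
  using assms mon_iff_hom_one[of G H j] by blast

lemma mon_group_hom: "group G \<Longrightarrow> group H \<Longrightarrow> j \<in> mon G H \<Longrightarrow> group_hom G H j"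
  by (intro group_homI) (simp_all add: mon_def)

lemma kap_carrier:
  "group G \<Longrightarrow> s \<in> carrier G \<Longrightarrow> z \<in> carrier G \<Longrightarrow> t \<in> carrier G \<Longrightarrow> kap G s z t c \<in> carrier G"
  by (simp add: kap_def group.int_pow_closed group.is_monoid monoid.m_closed)

text \<open>Pulls an equation in an arbitrary target group back to a disc quotient, where
  independence is known.\<close>

lemma mon_kap_eq_one:
  assumes "group G" "group H" "j \<in> mon G H" "s \<in> carrier G" "z \<in> carrier G" "t \<in> carrier G"
    and "kap H (j s) (j z) (j t) c = \<one>\<^bsub>H\<^esub>"
  shows "kap G s z t c = \<one>\<^bsub>G\<^esub>"
proof (rule mon_eq_one[OF assms(1-3)])
  show "kap G s z t c \<in> carrier G"
    using assms by (simp add: kap_carrier)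
  show "j (kap G s z t c) = \<one>\<^bsub>H\<^esub>"
    using hom_kap[OF mon_group_hom[OF assms(1-3)] assms(4-6), of c] assms(7) by simp
qed

text \<open>The abelianisation of the disc group and its map to the surface quotient are both
  central representations of the disc letters with independent s, z, t. Equality of their kernels
  gives existence and injectivity of \<alpha> at once.\<close>

lemma mixed_induced:
  assumes kn: "k \<ge> 3" "n \<ge> 3"
  obtains \<alpha> where "\<alpha> \<in> mon (mixed_quot 2 0 k n) (mixed_quot 3 g k n)"
    "\<And>x. x \<in> carrier (mixed_braid 0 k n) \<Longrightarrow>
      \<alpha> (mixed_proj 2 0 k n x) = mixed_proj 3 g k n (iota_mixed g k n x)"
proof -
  let ?P = "mixed_pres 0 k n" and ?h = "mixed_proj 3 g k n \<circ> iota_mixed g k n"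
  let ?f = "\<lambda>x. mixed_proj 3 g k n (gen_of (mixed_pres g k n) x)"
  have h: "?h \<in> hom (mixed_braid 0 k n) (mixed_quot 3 g k n)"
    by (rule Group.hom_compose[OF inclusion_homs(2) proj_hom(1)])
  have gen: "?h (gen_of ?P x) = ?f x" if "x \<in> fst ?P" for x
    using that by (simp add: inclusion_gens)
  have mem: "i \<in> {1..<k} \<Longrightarrow> S i \<in> fst ?P" "i \<in> {1..<n} \<Longrightarrow> St i \<in> fst ?P" for i
    by (auto simp: fst_pres sigmas_def)
  have rep: "central_rep (mixed_quot 3 g k n) (?f (S 1)) (?h (gen_of ?P (Zeta 1))) (?f (St 1)) (fst ?P)
      (\<lambda>x. ?h (gen_of ?P x))"
  proof (rule hom_mixed_rep(1)[OF quotient_groups(1) h kn])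
    show "?h (gen_of ?P (S i)) = ?f (S 1)" if "i \<in> {1..<k}" for i
      using gen[OF mem(1)[OF that]] sigma_collapse(1)[OF _ that, of 3 g n] by (simp del: One_nat_def)
    show "?h (gen_of ?P (St i)) = ?f (St 1)" if "i \<in> {1..<n}" for i
      using gen[OF mem(2)[OF that]] sigma_collapse(2)[OF _ that, of 3 g k] by (simp del: One_nat_def)
  qed
  have rep0: "central_rep (mixed_quot 2 0 k n) (mixed_proj 2 0 k n (gen_of ?P (S 1)))
      (mixed_proj 2 0 k n (gen_of ?P (Zeta 1))) (mixed_proj 2 0 k n (gen_of ?P (St 1))) (fst ?P)
      (\<lambda>x. mixed_proj 2 0 k n (gen_of ?P x))"
    by (rule mixed_proj_rep(1)[OF _ kn]) simp
  have "mixed_proj 2 0 k n x = \<one>\<^bsub>mixed_quot 2 0 k n\<^esub> \<longleftrightarrow> ?h x = \<one>\<^bsub>mixed_quot 3 g k n\<^esub>"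
    if "x \<in> carrier (mixed_braid 0 k n)" for x
  proof (rule rep_same_kernel[OF _ _ rep0 rep])
    show "mixed_proj 2 0 k n \<in> hom (presented_group ?P) (mixed_quot 2 0 k n)"
      "?h \<in> hom (presented_group ?P) (mixed_quot 3 g k n)" "x \<in> carrier (presented_group ?P)"
      using proj_hom(1)[of 2 0 k n] h that by (simp_all add: mixed_braid_def)
    show "c = 0" if "kap (mixed_quot 2 0 k n) (mixed_proj 2 0 k n (gen_of ?P (S 1)))
      (mixed_proj 2 0 k n (gen_of ?P (Zeta 1))) (mixed_proj 2 0 k n (gen_of ?P (St 1))) c = \<one>\<^bsub>mixed_quot 2 0 k n\<^esub>" for c
      using mixed_quot_independent[OF _ kn that] by simp
    show "c = 0" if "kap (mixed_quot 3 g k n) (?f (S 1)) (?h (gen_of ?P (Zeta 1))) (?f (St 1)) c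
        = \<one>\<^bsub>mixed_quot 3 g k n\<^esub>" for c
      using mixed_quot_independent[OF _ kn, of 3 g c] that
      unfolding gen[OF mixed_letters(2)[OF kn]] by simp
  qed (rule paired_pres)
  then obtain \<alpha> where "\<alpha> \<in> mon (mixed_quot 2 0 k n) (mixed_quot 3 g k n)"
    "\<And>x. x \<in> carrier (mixed_braid 0 k n) \<Longrightarrow> ?h x = \<alpha> (mixed_proj 2 0 k n x)"
    using same_kernel_factor[OF group_braids(1) quotient_groups(1) quotient_groups(1) proj_epi(1) h] by blast
  then show thesis
    using that[of \<alpha>] by simp
qed

lemma surface_induced:
  assumes n: "n \<ge> 3"
  obtains \<beta> where "\<beta> \<in> mon (surface_quot 2 0 n) (surface_quot 3 g n)"
    "\<And>x. x \<in> carrier (surface_braid 0 n) \<Longrightarrow>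
      \<beta> (surface_proj 2 0 n x) = surface_proj 3 g n (iota_surface g n x)"
proof -
  let ?P = "surface_pres 0 n" and ?h = "surface_proj 3 g n \<circ> iota_surface g n"
  let ?f = "\<lambda>x. surface_proj 3 g n (gen_of (surface_pres g n) x)"
  have h: "?h \<in> hom (surface_braid 0 n) (surface_quot 3 g n)"
    by (rule Group.hom_compose[OF inclusion_homs(4) proj_hom(2)])
  have gen: "?h (gen_of ?P x) = ?f x" if "x \<in> fst ?P" for x
    using that by (simp add: inclusion_gens)
  have mem: "i \<in> {1..<n} \<Longrightarrow> St i \<in> fst ?P" for i
    by (auto simp: fst_pres sigmas_def)
  have rep: "central_rep (surface_quot 3 g n) \<one>\<^bsub>surface_quot 3 g n\<^esub> \<one>\<^bsub>surface_quot 3 g n\<^esub> (?f (St 1)) (fst ?P)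
      (\<lambda>x. ?h (gen_of ?P x))"
  proof (rule hom_surface_rep[OF quotient_groups(2) h n])
    show "?h (gen_of ?P (St i)) = ?f (St 1)" if "i \<in> {1..<n}" for i
      using gen[OF mem[OF that]] sigma_collapse(3)[OF _ that, of 3 g] by (simp del: One_nat_def)
  qed
  have rep0: "central_rep (surface_quot 2 0 n) \<one>\<^bsub>surface_quot 2 0 n\<^esub> \<one>\<^bsub>surface_quot 2 0 n\<^esub>
      (surface_proj 2 0 n (gen_of ?P (St 1))) (fst ?P) (\<lambda>x. surface_proj 2 0 n (gen_of ?P x))"
    by (rule hom_surface_rep[OF quotient_groups(2) proj_hom(2) n sigma_collapse(3)]) simp_all
  have "surface_proj 2 0 n x = \<one>\<^bsub>surface_quot 2 0 n\<^esub> \<longleftrightarrow> ?h x = \<one>\<^bsub>surface_quot 3 g n\<^esub>"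
    if "x \<in> carrier (surface_braid 0 n)" for x
  proof (rule rep_same_kernel[OF _ _ rep0 rep])
    show "surface_proj 2 0 n \<in> hom (presented_group ?P) (surface_quot 2 0 n)"
      "?h \<in> hom (presented_group ?P) (surface_quot 3 g n)" "x \<in> carrier (presented_group ?P)"
      using proj_hom(2)[of 2 0 n] h that by (simp_all add: surface_braid_def)
    show "c = 0" if "c \<in> weights (fst ?P)" "kap (surface_quot 2 0 n) \<one>\<^bsub>surface_quot 2 0 n\<^esub> \<one>\<^bsub>surface_quot 2 0 n\<^esub>
      (surface_proj 2 0 n (gen_of ?P (St 1))) c = \<one>\<^bsub>surface_quot 2 0 n\<^esub>" for c
      using surface_quot_independent[OF _ n weights_surface[OF that(1)] that(2)] by simp
    show "c = 0" if "c \<in> weights (fst ?P)" "kap (surface_quot 3 g n) \<one>\<^bsub>surface_quot 3 g n\<^esub> \<one>\<^bsub>surface_quot 3 g n\<^esub>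
      (?f (St 1)) c = \<one>\<^bsub>surface_quot 3 g n\<^esub>" for c
      using surface_quot_independent[OF _ n weights_surface[OF that(1)] that(2)] by simp
  qed (rule paired_pres)
  then obtain \<beta> where "\<beta> \<in> mon (surface_quot 2 0 n) (surface_quot 3 g n)"
    "\<And>x. x \<in> carrier (surface_braid 0 n) \<Longrightarrow> ?h x = \<beta> (surface_proj 2 0 n x)"
    using same_kernel_factor[OF group_braids(3) quotient_groups(2) quotient_groups(2) proj_epi(2) h] by blast
  then show thesis
    using that[of \<beta>] by simp
qed

lemma kernel_short_exact:
  "short_exact_sequence (surface_quot i g n) (mixed_quot i g k n) (kernel_quot i g k n)
    (forget_quot i g k n) (\<lambda>x. x)"
proof -
  interpret I: group_hom "kernel_quot i g k n" "mixed_quot i g k n" "\<lambda>x. x"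
    by (rule kernel_inclusion)
  have "exact_seq ([mixed_quot i g k n, kernel_quot i g k n], [\<lambda>x. x])"
    by (rule exact_seq.unity) (rule kernel_inclusion)
  then have "exact_seq ([surface_quot i g n, mixed_quot i g k n, kernel_quot i g k n], [forget_quot i g k n, \<lambda>x. x])"
    using forget_quot_epi by (intro exact_seq.extension) (simp_all add: epi_def)
  moreover have "(\<lambda>x. x) \<in> mon (kernel_quot i g k n) (mixed_quot i g k n)"
    using I.homh by (simp add: mon_def)
  ultimately show ?thesis
    using forget_quot_epi by (simp only: short_exact_sequence_iff)
qed

lemma induced_ses_morphism:
  assumes kn: "k \<ge> 3" "n \<ge> 3"
  shows "\<exists>\<gamma> \<alpha> \<beta>.
        \<gamma> \<in> mon (kernel_quot 2 0 k n) (kernel_quot 3 g k n) \<and>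
        \<alpha> \<in> mon (mixed_quot 2 0 k n) (mixed_quot 3 g k n) \<and>
        \<beta> \<in> mon (surface_quot 2 0 n) (surface_quot 3 g n) \<and>
        (\<forall>x \<in> carrier (punctured_braid 0 k n).
           \<gamma> (kernel_proj 2 0 k n x) = kernel_proj 3 g k n (iota_punctured g k n x)) \<and>
        (\<forall>x \<in> carrier (mixed_braid 0 k n).
           \<alpha> (mixed_proj 2 0 k n x) = mixed_proj 3 g k n (iota_mixed g k n x)) \<and>
        (\<forall>x \<in> carrier (surface_braid 0 n).
           \<beta> (surface_proj 2 0 n x) = surface_proj 3 g n (iota_surface g n x)) \<and>
        ses_morphism
          (kernel_quot 2 0 k n) (mixed_quot 2 0 k n) (surface_quot 2 0 n) (\<lambda>x. x) (forget_quot 2 0 k n)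
          (kernel_quot 3 g k n) (mixed_quot 3 g k n) (surface_quot 3 g n) (\<lambda>x. x) (forget_quot 3 g k n)
          \<gamma> \<alpha> \<beta>"
proof -
  obtain \<alpha> where \<alpha>: "\<alpha> \<in> mon (mixed_quot 2 0 k n) (mixed_quot 3 g k n)"
    "\<And>x. x \<in> carrier (mixed_braid 0 k n) \<Longrightarrow>
      \<alpha> (mixed_proj 2 0 k n x) = mixed_proj 3 g k n (iota_mixed g k n x)"
    using mixed_induced[OF kn] by blast
  obtain \<beta> where \<beta>: "\<beta> \<in> mon (surface_quot 2 0 n) (surface_quot 3 g n)"
    "\<And>x. x \<in> carrier (surface_braid 0 n) \<Longrightarrow>
      \<beta> (surface_proj 2 0 n x) = surface_proj 3 g n (iota_surface g n x)"
    using surface_induced[OF kn(2)] by blast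
  interpret \<beta>: group_hom "surface_quot 2 0 n" "surface_quot 3 g n" \<beta>
    by (rule mon_group_hom[OF quotient_groups(2) quotient_groups(2) \<beta>(1)])
  have square: "\<beta> (forget_quot 2 0 k n X) = forget_quot 3 g k n (\<alpha> X)"
    if X: "X \<in> carrier (mixed_quot 2 0 k n)" for X
  proof -
    have "mixed_proj 2 0 k n ` carrier (mixed_braid 0 k n) = carrier (mixed_quot 2 0 k n)"
      using proj_epi(1) by (simp add: epi_def)
    then obtain x where x: "X = mixed_proj 2 0 k n x" "x \<in> carrier (mixed_braid 0 k n)"
      using X by blast
    then show ?thesis
      using hom_in_carrier[OF forget_hom x(2)] hom_in_carrier[OF inclusion_homs(2) x(2)]
      by (simp add: \<alpha>(2) \<beta>(2) forget_quot_proj forget_iota)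
  qed
  \<comment> \<open>The carrier of G_k is a subset of the mixed quotient, so \<gamma> is taken to be
    the function \<alpha> itself; \<open>square\<close> shows that it maps one kernel into the
    other.\<close>
  have "\<alpha> X \<in> carrier (kernel_quot 3 g k n)" if "X \<in> carrier (kernel_quot 2 0 k n)" for X
    using that square[of X] \<alpha>(1) by (auto simp: kernel_def mon_def hom_def)
  then have \<alpha>_kernel: "\<alpha> \<in> mon (kernel_quot 2 0 k n) (kernel_quot 3 g k n)"
    using \<alpha>(1) by (auto simp: mon_def hom_def kernel_def inj_on_def)
  moreover have "\<alpha> (kernel_proj 2 0 k n x) = kernel_proj 3 g k n (iota_punctured g k n x)"
    if "x \<in> carrier (punctured_braid 0 k n)" for x
    using \<alpha>(2) hom_in_carrier[OF inclusion_homs(1) that] incl_iota[OF that] by (simp add: kernel_proj_def)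
  moreover have "ses_morphism
          (kernel_quot 2 0 k n) (mixed_quot 2 0 k n) (surface_quot 2 0 n) (\<lambda>x. x) (forget_quot 2 0 k n)
          (kernel_quot 3 g k n) (mixed_quot 3 g k n) (surface_quot 3 g n) (\<lambda>x. x) (forget_quot 3 g k n)
          \<alpha> \<alpha> \<beta>"
    unfolding ses_morphism_def
    by (intro conjI ballI kernel_short_exact square refl)
      (use \<alpha>_kernel \<alpha>(1) \<beta>(1) in \<open>simp_all only: mon_def mem_Collect_eq\<close>)
  ultimately show ?thesis
    using \<alpha> \<beta> by (intro exI[of _ \<alpha>] exI[of _ \<beta>] conjI ballI)
qed

text \<open>Through j the disc supplies what the presentation alone does not: one common value for
  all \<open>S i\<close>, one for all \<open>Zeta i\<close>, and their independence in G.\<close>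

lemma punctured_universal:
  fixes G :: "('c, 'p) monoid_scheme"
  assumes kn: "k \<ge> 3" "n \<ge> 3" and G: "group G" and \<Phi>: "\<Phi> \<in> epi (punctured_braid g k n) G"
    and j: "j \<in> mon (kernel_quot 2 0 k n) G"
    and comm: "\<And>x. x \<in> carrier (punctured_braid 0 k n) \<Longrightarrow> \<Phi> (iota_punctured g k n x) = j (kernel_proj 2 0 k n x)"
  shows "\<exists>\<theta> \<in> iso (kernel_quot 3 g k n) G. \<forall>x \<in> carrier (punctured_braid g k n). \<Phi> x = \<theta> (kernel_proj 3 g k n x)"
proof (rule same_kernel_iso[OF group_braids(2) group_kernel_quot G kernel_proj_epi \<Phi>])
  let ?P = "punctured_pres g k n" and ?Q = "punctured_pres 0 k n"
  let ?e = "\<lambda>x. kernel_proj 2 0 k n (gen_of ?Q x)"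
  let ?f = "\<lambda>x. kernel_proj 3 g k n (gen_of ?P x)"
  interpret j: group_hom "kernel_quot 2 0 k n" G j
    by (rule mon_group_hom[OF group_kernel_quot G j])
  have \<Phi>_hom: "\<Phi> \<in> hom (punctured_braid g k n) G"
    using \<Phi> by (simp add: epi_def)
  have gen: "\<Phi> (gen_of ?P x) = j (?e x)" if "x \<in> fst ?Q" for x
    using comm[OF gen_mem(2)[OF that]] inclusion_gens(3)[OF that, of g] by simp
  have mem: "i \<in> {1..<k} \<Longrightarrow> S i \<in> fst ?Q" "i \<in> {1..n} \<Longrightarrow> Zeta i \<in> fst ?Q" for i
    by (auto simp: fst_pres sigmas_def zetas_def)
  note letters = mixed_letters[OF kn, of 0]
  have closed: "?e (S 1) \<in> carrier (kernel_quot 2 0 k n)" "?e (Zeta 1) \<in> carrier (kernel_quot 2 0 k n)"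
    by (rule hom_in_carrier[OF kernel_proj_hom gen_mem(2)[OF letters(4)]])
      (rule hom_in_carrier[OF kernel_proj_hom gen_mem(2)[OF letters(5)]])
  have n1: "n \<ge> 1" using kn by simp
  have rep: "central_rep G (j (?e (S 1))) (j (?e (Zeta 1))) \<one>\<^bsub>G\<^esub> (fst ?P) (\<lambda>x. \<Phi> (gen_of ?P x))"
  proof (rule hom_punctured_rep[OF G \<Phi>_hom kn(1) n1])
    show "\<Phi> (gen_of ?P (S i)) = j (?e (S 1))" if "i \<in> {1..<k}" for i
      unfolding gen[OF mem(1)[OF that]] by (subst kernel_proj_collapse(1)[OF _ kn that]) simp_all
    show "\<Phi> (gen_of ?P (Zeta i)) = j (?e (Zeta 1))" if "i \<in> {1..n}" for i
      unfolding gen[OF mem(2)[OF that]] by (subst kernel_proj_collapse(2)[OF _ kn that]) simp_all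
  qed
  have rep': "central_rep (kernel_quot 3 g k n) (?f (S 1)) (?f (Zeta 1)) \<one>\<^bsub>kernel_quot 3 g k n\<^esub> (fst ?P) ?f"
    using kernel_proj_collapse[OF _ kn, of 3]
    by (intro hom_punctured_rep[OF group_kernel_quot kernel_proj_hom kn(1) n1]) blast+
  show "kernel_proj 3 g k n x = \<one>\<^bsub>kernel_quot 3 g k n\<^esub> \<longleftrightarrow> \<Phi> x = \<one>\<^bsub>G\<^esub>"
    if "x \<in> carrier (punctured_braid g k n)" for x
  proof (rule rep_same_kernel[OF _ _ rep' rep])
    show "kernel_proj 3 g k n \<in> hom (presented_group ?P) (kernel_quot 3 g k n)"
      "\<Phi> \<in> hom (presented_group ?P) G" "x \<in> carrier (presented_group ?P)"
      using kernel_proj_hom[of 3 g k n] \<Phi>_hom that by (simp_all only: punctured_braid_def)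
    show "c = 0" if "c \<in> weights (fst ?P)"
      "kap (kernel_quot 3 g k n) (?f (S 1)) (?f (Zeta 1)) \<one>\<^bsub>kernel_quot 3 g k n\<^esub> c = \<one>\<^bsub>kernel_quot 3 g k n\<^esub>" for c
      using kernel_quot_independent[OF _ kn weights_punctured[OF that(1)] that(2)] by simp
    show "c = 0" if "c \<in> weights (fst ?P)"
      "kap G (j (?e (S 1))) (j (?e (Zeta 1))) \<one>\<^bsub>G\<^esub> c = \<one>\<^bsub>G\<^esub>" for c
      using kernel_quot_independent[OF _ kn weights_punctured[OF that(1)]
          mon_kap_eq_one[OF group_kernel_quot G j closed j.G.one_closed]] that(2) j.hom_one
      by simp
  qed (rule paired_pres)
qed (use kn in simp_all)

text \<open>Through j the \<open>S i\<close> and the \<open>St i\<close> acquire common values; the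
  mixed relations then produce the rest of the collapse.\<close>

lemma mixed_universal:
  fixes H :: "('c, 'p) monoid_scheme"
  assumes kn: "k \<ge> 3" "n \<ge> 3" and H: "group H" and \<rho>: "\<rho> \<in> epi (mixed_braid g k n) H"
    and j: "j \<in> mon (mixed_quot 2 0 k n) H"
    and comm: "\<And>x. x \<in> carrier (mixed_braid 0 k n) \<Longrightarrow> \<rho> (iota_mixed g k n x) = j (mixed_proj 2 0 k n x)"
  shows "\<exists>\<theta> \<in> iso (mixed_quot 3 g k n) H. \<forall>x \<in> carrier (mixed_braid g k n). \<rho> x = \<theta> (mixed_proj 3 g k n x)"
proof (rule same_kernel_iso[OF group_braids(1) quotient_groups(1) H proj_epi(1) \<rho>])
  let ?P = "mixed_pres g k n" and ?Q = "mixed_pres 0 k n"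
  let ?e = "\<lambda>x. mixed_proj 2 0 k n (gen_of ?Q x)"
  let ?f = "\<lambda>x. mixed_proj 3 g k n (gen_of ?P x)"
  have \<rho>_hom: "\<rho> \<in> hom (mixed_braid g k n) H"
    using \<rho> by (simp add: epi_def)
  have gen: "\<rho> (gen_of ?P x) = j (?e x)" if "x \<in> fst ?Q" for x
    using comm[OF gen_mem(1)[OF that]] inclusion_gens(2)[OF that, of g] by simp
  have mem: "i \<in> {1..<k} \<Longrightarrow> S i \<in> fst ?Q" "i \<in> {1..<n} \<Longrightarrow> St i \<in> fst ?Q" for i
    by (auto simp: fst_pres sigmas_def)
  note letters = mixed_letters[OF kn, of 0]
  have closed: "?e (S 1) \<in> carrier (mixed_quot 2 0 k n)" "?e (Zeta 1) \<in> carrier (mixed_quot 2 0 k n)"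
    "?e (St 1) \<in> carrier (mixed_quot 2 0 k n)"
    by (rule hom_in_carrier[OF proj_hom(1) gen_mem(1)], rule letters)+
  have rep: "central_rep H (j (?e (S 1))) (\<rho> (gen_of ?P (Zeta 1))) (j (?e (St 1))) (fst ?P) (\<lambda>x. \<rho> (gen_of ?P x))"
  proof (rule hom_mixed_rep(1)[OF H \<rho>_hom kn])
    show "\<rho> (gen_of ?P (S i)) = j (?e (S 1))" if "i \<in> {1..<k}" for i
      unfolding gen[OF mem(1)[OF that]] by (subst sigma_collapse(1)[OF _ that]) simp_all
    show "\<rho> (gen_of ?P (St i)) = j (?e (St 1))" if "i \<in> {1..<n}" for i
      unfolding gen[OF mem(2)[OF that]] by (subst sigma_collapse(2)[OF _ that]) simp_all
  qed
  have rep': "central_rep (mixed_quot 3 g k n) (?f (S 1)) (?f (Zeta 1)) (?f (St 1)) (fst ?P) ?f"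
    by (rule mixed_proj_rep(1)[OF _ kn]) simp
  show "mixed_proj 3 g k n x = \<one>\<^bsub>mixed_quot 3 g k n\<^esub> \<longleftrightarrow> \<rho> x = \<one>\<^bsub>H\<^esub>"
    if "x \<in> carrier (mixed_braid g k n)" for x
  proof (rule rep_same_kernel[OF _ _ rep' rep])
    show "mixed_proj 3 g k n \<in> hom (presented_group ?P) (mixed_quot 3 g k n)"
      "\<rho> \<in> hom (presented_group ?P) H" "x \<in> carrier (presented_group ?P)"
      using proj_hom(1)[of 3 g k n] \<rho>_hom that by (simp_all only: mixed_braid_def)
    show "c = 0" if "kap (mixed_quot 3 g k n) (?f (S 1)) (?f (Zeta 1)) (?f (St 1)) c = \<one>\<^bsub>mixed_quot 3 g k n\<^esub>" for c
      using mixed_quot_independent[OF _ kn that] by simp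
    \<comment> \<open>\<open>Zeta 1\<close> is a disc letter too, so its value is an image under j
      and the equation can be pulled back to the disc quotient.\<close>
    show "c = 0" if "kap H (j (?e (S 1))) (\<rho> (gen_of ?P (Zeta 1))) (j (?e (St 1))) c = \<one>\<^bsub>H\<^esub>" for c
      using mixed_quot_independent[OF _ kn mon_kap_eq_one[OF quotient_groups(1) H j closed]]
        that[unfolded gen[OF letters(2)]] by simp
  qed (rule paired_pres)
qed

lemma surface_universal:
  fixes K :: "('c, 'p) monoid_scheme"
  assumes n: "n \<ge> 3" and K: "group K" and \<rho>: "\<rho> \<in> epi (surface_braid g n) K"
    and j: "j \<in> mon (surface_quot 2 0 n) K"
    and comm: "\<And>x. x \<in> carrier (surface_braid 0 n) \<Longrightarrow> \<rho> (iota_surface g n x) = j (surface_proj 2 0 n x)"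
  shows "\<exists>\<theta> \<in> iso (surface_quot 3 g n) K. \<forall>x \<in> carrier (surface_braid g n). \<rho> x = \<theta> (surface_proj 3 g n x)"
proof (rule same_kernel_iso[OF group_braids(3) quotient_groups(2) K proj_epi(2) \<rho>])
  let ?P = "surface_pres g n" and ?Q = "surface_pres 0 n"
  let ?e = "\<lambda>x. surface_proj 2 0 n (gen_of ?Q x)"
  let ?f = "\<lambda>x. surface_proj 3 g n (gen_of ?P x)"
  interpret j: group_hom "surface_quot 2 0 n" K j
    by (rule mon_group_hom[OF quotient_groups(2) K j])
  have \<rho>_hom: "\<rho> \<in> hom (surface_braid g n) K"
    using \<rho> by (simp add: epi_def)
  have gen: "\<rho> (gen_of ?P x) = j (?e x)" if "x \<in> fst ?Q" for x
    using comm[OF gen_mem(3)[OF that]] inclusion_gens(4)[OF that, of g] by simp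
  have mem: "i \<in> {1..<n} \<Longrightarrow> St i \<in> fst ?Q" for i
    by (auto simp: fst_pres sigmas_def)
  have closed: "?e (St 1) \<in> carrier (surface_quot 2 0 n)"
    by (rule hom_in_carrier[OF proj_hom(2) gen_mem(3)], rule mixed_letters(6)[OF le_refl n])
  have rep: "central_rep K \<one>\<^bsub>K\<^esub> \<one>\<^bsub>K\<^esub> (j (?e (St 1))) (fst ?P) (\<lambda>x. \<rho> (gen_of ?P x))"
  proof (rule hom_surface_rep[OF K \<rho>_hom n])
    show "\<rho> (gen_of ?P (St i)) = j (?e (St 1))" if "i \<in> {1..<n}" for i
      unfolding gen[OF mem[OF that]] by (subst sigma_collapse(3)[OF _ that]) simp_all
  qed
  have rep': "central_rep (surface_quot 3 g n) \<one>\<^bsub>surface_quot 3 g n\<^esub> \<one>\<^bsub>surface_quot 3 g n\<^esub> (?f (St 1)) (fst ?P) ?f"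
    by (rule hom_surface_rep[OF quotient_groups(2) proj_hom(2) n sigma_collapse(3)]) simp_all
  show "surface_proj 3 g n x = \<one>\<^bsub>surface_quot 3 g n\<^esub> \<longleftrightarrow> \<rho> x = \<one>\<^bsub>K\<^esub>"
    if "x \<in> carrier (surface_braid g n)" for x
  proof (rule rep_same_kernel[OF _ _ rep' rep])
    show "surface_proj 3 g n \<in> hom (presented_group ?P) (surface_quot 3 g n)"
      "\<rho> \<in> hom (presented_group ?P) K" "x \<in> carrier (presented_group ?P)"
      using proj_hom(2)[of 3 g n] \<rho>_hom that by (simp_all only: surface_braid_def)
    show "c = 0" if "c \<in> weights (fst ?P)" "kap (surface_quot 3 g n) \<one>\<^bsub>surface_quot 3 g n\<^esub> \<one>\<^bsub>surface_quot 3 g n\<^esub>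
      (?f (St 1)) c = \<one>\<^bsub>surface_quot 3 g n\<^esub>" for c
      using surface_quot_independent[OF _ n weights_surface[OF that(1)] that(2)] by simp
    show "c = 0" if "c \<in> weights (fst ?P)" "kap K \<one>\<^bsub>K\<^esub> \<one>\<^bsub>K\<^esub> (j (?e (St 1))) c = \<one>\<^bsub>K\<^esub>" for c
      using surface_quot_independent[OF _ n weights_surface[OF that(1)]
          mon_kap_eq_one[OF quotient_groups(2) K j j.G.one_closed j.G.one_closed closed]] that(2)
      by simp
  qed (rule paired_pres)
qed

theorem theorem1p2:
  fixes g k n :: nat
  assumes "g \<ge> 1" and "k \<ge> 3" and "n \<ge> 3"
  shows
    "(\<exists>\<gamma> \<alpha> \<beta>.
        \<gamma> \<in> mon (kernel_quot 2 0 k n) (kernel_quot 3 g k n) \<and>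
        \<alpha> \<in> mon (mixed_quot 2 0 k n) (mixed_quot 3 g k n) \<and>
        \<beta> \<in> mon (surface_quot 2 0 n) (surface_quot 3 g n) \<and>
        (\<forall>x \<in> carrier (punctured_braid 0 k n).
           \<gamma> (kernel_proj 2 0 k n x) = kernel_proj 3 g k n (iota_punctured g k n x)) \<and>
        (\<forall>x \<in> carrier (mixed_braid 0 k n).
           \<alpha> (mixed_proj 2 0 k n x) = mixed_proj 3 g k n (iota_mixed g k n x)) \<and>
        (\<forall>x \<in> carrier (surface_braid 0 n).
           \<beta> (surface_proj 2 0 n x) = surface_proj 3 g n (iota_surface g n x)) \<and>
        ses_morphism
          (kernel_quot 2 0 k n) (mixed_quot 2 0 k n) (surface_quot 2 0 n) (\<lambda>x. x) (forget_quot 2 0 k n)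
          (kernel_quot 3 g k n) (mixed_quot 3 g k n) (surface_quot 3 g n) (\<lambda>x. x) (forget_quot 3 g k n)
          \<gamma> \<alpha> \<beta>) \<and>
     (\<forall>(G :: ('c, 'p) monoid_scheme) \<Phi> j.
        group G \<and> \<Phi> \<in> epi (punctured_braid g k n) G \<and> j \<in> mon (kernel_quot 2 0 k n) G \<and>
        (\<forall>x \<in> carrier (punctured_braid 0 k n). \<Phi> (iota_punctured g k n x) = j (kernel_proj 2 0 k n x)) \<longrightarrow>
        (\<exists>\<theta> \<in> iso (kernel_quot 3 g k n) G.
           \<forall>x \<in> carrier (punctured_braid g k n). \<Phi> x = \<theta> (kernel_proj 3 g k n x))) \<and>
     (\<forall>(H :: ('d, 'q) monoid_scheme) \<rho> j.
        group H \<and> \<rho> \<in> epi (mixed_braid g k n) H \<and> j \<in> mon (mixed_quot 2 0 k n) H \<and>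
        (\<forall>x \<in> carrier (mixed_braid 0 k n). \<rho> (iota_mixed g k n x) = j (mixed_proj 2 0 k n x)) \<longrightarrow>
        (\<exists>\<theta> \<in> iso (mixed_quot 3 g k n) H.
           \<forall>x \<in> carrier (mixed_braid g k n). \<rho> x = \<theta> (mixed_proj 3 g k n x))) \<and>
     (\<forall>(K :: ('e, 'r) monoid_scheme) \<rho> j.
        group K \<and> \<rho> \<in> epi (surface_braid g n) K \<and> j \<in> mon (surface_quot 2 0 n) K \<and>
        (\<forall>x \<in> carrier (surface_braid 0 n). \<rho> (iota_surface g n x) = j (surface_proj 2 0 n x)) \<longrightarrow>
        (\<exists>\<theta> \<in> iso (surface_quot 3 g n) K.
           \<forall>x \<in> carrier (surface_braid g n). \<rho> x = \<theta> (surface_proj 3 g n x)))"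
proof (intro conjI, goal_cases)
  case 1
  show ?case
    by (rule induced_ses_morphism[OF assms(2,3)])
next
  case 2
  show ?case
    by (intro allI impI, elim conjE, rule punctured_universal[OF assms(2,3)]) (assumption | erule bspec)+
next
  case 3
  show ?case
    by (intro allI impI, elim conjE, rule mixed_universal[OF assms(2,3)]) (assumption | erule bspec)+
next
  case 4
  show ?case
    by (intro allI impI, elim conjE, rule surface_universal[OF assms(3)]) (assumption | erule bspec)+
qed

end
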